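(* Let $P=UU^T\in\mathrm{Gr}(n,p)$ with $U\in\mathrm{St}(n,p)$ and let $\Delta_1,\Delta_2\in T_P\mathrm{Gr}(n,p)$ be two tangent vectors, where the singular values of $(\Delta_1)^{\mathsf{hor}}_U$ are mutually distinct and non-zero. Define the geodesic $\gamma(t):=\mathrm{Exp}^{\mathrm{Gr}}_P(t\Delta_1)$. Let $(t\Delta_1)^{\mathsf{hor}}_U=Q(t\Sigma)V^T$ and $(t(\Delta_1+s\Delta_2))^{\mathsf{hor}}_U=Q(s)(t\Sigma(s))V(s)^T$ be given via the compact SVDs of the horizontal lifts, i.e. $Q(s)\in\mathrm{St}(n,p)$, $\Sigma(s)=\mathrm{diag}(\sigma_1(s),\dots,\sigma_p(s))$, $V(s)\in\mathrm{O}(p)$, with $Q(0)=Q$, $\Sigma(0)=\Sigma$, $V(0)=V$, where for $s$ near $0$ the factors depend differentiably on $s$. Write $\dot Q=\frac{\mathrm dQ}{\mathrm ds}(0)$, $\dot\Sigma=\frac{\mathrm d\Sigma}{\mathrm ds}(0)$, $\dot V=\frac{\mathrm dV}{\mathrm ds}(0)$. Define $$Y(t):=UV\cos(t\Sigma)+Q\sin(t\Sigma)\in\mathrm{St}(n,p)$$ and $$\Gamma(t):=U\dot V\cos(t\Sigma)-tUV\sin(t\Sigma)\dot\Sigma+\dot Q\sin(t\Sigma)+tQ\cos(t\Sigma)\dot\Sigma\in T_{Y(t)}\mathrm{St}(n,p).$$ Then the Jacobi field $J$ along $\gamma$ fulfilling $J(0)=0$ and $D_tJ(0)=\Delta_2$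 is given by $$J(t)=\Gamma(t)Y(t)^T+Y(t)\Gamma(t)^T\in T_{\gamma(t)}\mathrm{Gr}(n,p).$$ The horizontal lift of $J(t)$ to $Y(t)$ is accordingly $$(J(t))^{\mathsf{hor}}_{Y(t)}=\Gamma(t)+Y(t)\Gamma(t)^TY(t)=(I_n-Y(t)Y(t)^T)\Gamma(t).$$ Moreover, $J$ is the variation field of the variation of $\gamma$ through geodesics given by $\Xi(s,t):=\mathrm{Exp}^{\mathrm{Gr}}_P(t(\Delta_1+s\Delta_2))$.
   Context: Let $1\le p\le n$ be integers. $\mathrm{St}(n,p)=\{U\in\mathbb{R}^{n\times p}: U^TU=I_p\}$, with tangent space $T_U\mathrm{St}(n,p)=\{D\in\mathbb{R}^{n\times p}: U^TD=-D^TU\}$. $\mathrm{Gr}(n,p)=\{P\in\mathbb{R}^{n\times n}: P^T=P,\ P^2=P,\ \mathrm{rank}\,P=p\}$, an embedded submanifold of the symmetric $n\times n$ matrices, with tangent space $T_P\mathrm{Gr}(n,p)=\{\Delta=\Delta^T: \Delta P+P\Delta=\Delta\}$ and Riemannian metric $g_P(\Delta_1,\Delta_2)=\frac12\mathrm{tr}(\Delta_1\Delta_2)$. For $P=UU^T$ with $U\in\mathrm{St}(n,p)$, the horizontal lift of $\Delta\in T_P\mathrm{Gr}(n,p)$ to $U$ is $\Delta^{\mathsf{hor}}_U:=\Delta U\in\{D\in\mathbb{R}^{n\times p}: U^TD=0\}$. $\mathrm{Exp}^{\mathrm{Gr}}_P$ is the Riemannian exponential map; explicitly $\mathrm{Exp}^{\mathrm{Gr}}_P(\Delta)=\exp_m([\Delta,P])\,P\,\exp_m(-[\Delta,P])$,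 with $\exp_m$ the matrix exponential and $[A,B]=AB-BA$. A compact SVD of $X\in\mathbb{R}^{n\times p}$ is $X=Q\Sigma V^T$ with $Q\in\mathrm{St}(n,p)$, $\Sigma\in\mathbb{R}^{p\times p}$ diagonal with nonnegative entries, $V\in\mathrm{O}(p)$. Functions $\sin,\cos$ of diagonal matrices act entrywise on the diagonal. A Jacobi field along a geodesic $\gamma$ is a smooth vector field $J$ along $\gamma$ with $D_t^2J+R(J,\dot\gamma)\dot\gamma=0$, where $D_t$ is the covariant derivative along $\gamma$ (Levi-Civita connection) and $R$ the Riemannian curvature tensor. The variation field of a variation $\Xi(s,t)$ with $\Xi(0,t)=\gamma(t)$ is $t\mapsto\frac{\partial}{\partial s}\big|_{s=0}\Xi(s,t)$. *)

theory Defs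
  imports "HOL-Analysis.Analysis"
begin

section \<open>Smooth maps\<close>

text \<open>For open \<open>S\<close> in a finite-dimensional space, a map is \<open>C\<^sup>k\<^sup>+\<^sup>1\<close> iff it is differentiable
  and all its directional derivatives are \<open>C\<^sup>k\<close>.\<close>

primrec Ck_on :: "nat \<Rightarrow> 'a::euclidean_space set \<Rightarrow> ('a \<Rightarrow> 'b::euclidean_space) \<Rightarrow> bool" where
  "Ck_on 0 S f \<longleftrightarrow> continuous_on S f"
| "Ck_on (Suc k) S f \<longleftrightarrow>
     (\<forall>x\<in>S. f differentiable (at x)) \<and>
     (\<forall>v. Ck_on k S (\<lambda>x. frechet_derivative f (at x) v))"

definition smooth_on :: "'a::euclidean_space set \<Rightarrow> ('a \<Rightarrow> 'b::euclidean_space) \<Rightarrow> bool" where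
  "smooth_on S f \<longleftrightarrow> open S \<and> (\<forall>k. Ck_on k S f)"


section \<open>Stiefel and Grassmann manifolds\<close>

text \<open>A real \<open>n \<times> p\<close> matrix is of type \<^typ>\<open>real^'p^'n\<close>, with \<open>n\<close> and \<open>p\<close> the cardinalities
  of \<^typ>\<open>'n\<close> and \<^typ>\<open>'p\<close>.\<close>

definition St :: "(real^'p^'n) set" where
  "St = {U. transpose U ** U = mat 1}"

definition TSt :: "real^'p^'n \<Rightarrow> (real^'p^'n) set" where
  "TSt U = {D. transpose U ** D = - (transpose D ** U)}"

definition Gr :: "nat \<Rightarrow> (real^'n^'n) set" where
  "Gr p = {P. transpose P = P \<and> P ** P = P \<and> rank P = p}"

definition TGr :: "real^'n^'n \<Rightarrow> (real^'n^'n) set" where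
  "TGr P = {D. transpose D = D \<and> D ** P + P ** D = D}"

text \<open>The formula for the metric does not involve the base point.\<close>

definition gmetric :: "real^'n^'n \<Rightarrow> real^'n^'n \<Rightarrow> real" where
  "gmetric D1 D2 = 1/2 * trace (D1 ** D2)"

definition hor_lift :: "real^'p^'n \<Rightarrow> real^'n^'n \<Rightarrow> real^'p^'n" where
  "hor_lift U D = D ** U"


section \<open>Compact singular value decomposition\<close>

definition compact_svd ::
    "real^'p^'n \<Rightarrow> real^'p^'n \<Rightarrow> real^'p^'p \<Rightarrow> real^'p^'p \<Rightarrow> bool" where
  "compact_svd X Q S V \<longleftrightarrow>
     Q \<in> St \<and>
     (\<forall>i j. i \<noteq> j \<longrightarrow> S $ i $ j = 0) \<and> (\<forall>i. 0 \<le> S $ i $ i) \<and>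
     orthogonal_matrix V \<and>
     X = Q ** S ** transpose V"

definition diag_fun :: "(real \<Rightarrow> real) \<Rightarrow> real^'p^'p \<Rightarrow> real^'p^'p" where
  "diag_fun f S = (\<chi> i j. if i = j then f (S $ i $ i) else 0)"


section \<open>Calculus on the Grassmann manifold\<close>

text \<open>Functions and vector fields on \<open>Gr\<close> are total functions on the matrix space; only their
  values on \<open>Gr\<close> matter. Smoothness on the embedded submanifold is the existence of local smooth
  extensions to the surrounding matrix space.\<close>

definition smooth_on_Gr :: "nat \<Rightarrow> (real^'n^'n \<Rightarrow> 'b::euclidean_space) \<Rightarrow> bool" where
  "smooth_on_Gr p f \<longleftrightarrow>
     (\<forall>P\<in>Gr p. \<exists>W F. P \<in> W \<and> smooth_on W F \<and> (\<forall>P'\<in>W \<inter> Gr p. F P' = f P'))"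

text \<open>The derivative of \<open>f\<close> at \<open>P\<close> in the tangent direction \<open>v\<close>, computed along arbitrary curves
  in \<open>Gr\<close> through \<open>P\<close> with velocity \<open>v\<close>.\<close>

definition dir_deriv ::
    "nat \<Rightarrow> (real^'n^'n \<Rightarrow> 'b::euclidean_space) \<Rightarrow> real^'n^'n \<Rightarrow> real^'n^'n \<Rightarrow> 'b" where
  "dir_deriv p f P v =
     (THE d. \<forall>c::real \<Rightarrow> real^'n^'n.
        (\<forall>t. c t \<in> Gr p) \<and> c 0 = P \<and> (c has_vector_derivative v) (at 0) \<longrightarrow>
        ((\<lambda>t. f (c t)) has_vector_derivative d) (at 0))"

definition vfield :: "nat \<Rightarrow> (real^'n^'n \<Rightarrow> real^'n^'n) \<Rightarrow> bool" where
  "vfield p X \<longleftrightarrow> smooth_on_Gr p X \<and> (\<forall>P\<in>Gr p. X P \<in> TGr P)"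

definition lie_bracket ::
    "nat \<Rightarrow> (real^'n^'n \<Rightarrow> real^'n^'n) \<Rightarrow> (real^'n^'n \<Rightarrow> real^'n^'n) \<Rightarrow> real^'n^'n \<Rightarrow> real^'n^'n" where
  "lie_bracket p X Y P = dir_deriv p Y P (X P) - dir_deriv p X P (Y P)"

type_synonym 'n connection =
  "(real^'n^'n \<Rightarrow> real^'n^'n) \<Rightarrow> (real^'n^'n \<Rightarrow> real^'n^'n) \<Rightarrow> real^'n^'n \<Rightarrow> real^'n^'n"

definition affine_connection :: "nat \<Rightarrow> 'n::finite connection \<Rightarrow> bool" where
  "affine_connection p D \<longleftrightarrow>
     (\<forall>X Y. vfield p X \<and> vfield p Y \<longrightarrow> vfield p (D X Y)) \<and>
     (\<forall>X X' Y f f'. vfield p X \<and> vfield p X' \<and> vfield p Y \<and>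
        smooth_on_Gr p (f :: _ \<Rightarrow> real) \<and> smooth_on_Gr p (f' :: _ \<Rightarrow> real) \<longrightarrow>
        (\<forall>P\<in>Gr p. D (\<lambda>A. f A *\<^sub>R X A + f' A *\<^sub>R X' A) Y P = f P *\<^sub>R D X Y P + f' P *\<^sub>R D X' Y P)) \<and>
     (\<forall>X Y Y' a b. vfield p X \<and> vfield p Y \<and> vfield p Y' \<longrightarrow>
        (\<forall>P\<in>Gr p. D X (\<lambda>A. a *\<^sub>R Y A + b *\<^sub>R Y' A) P = a *\<^sub>R D X Y P + b *\<^sub>R D X Y' P)) \<and>
     (\<forall>X Y f. vfield p X \<and> vfield p Y \<and> smooth_on_Gr p (f :: _ \<Rightarrow> real) \<longrightarrow>
        (\<forall>P\<in>Gr p. D X (\<lambda>A. f A *\<^sub>R Y A) P = f P *\<^sub>R D X Y P + dir_deriv p f P (X P) *\<^sub>R Y P))"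

definition is_levi_civita :: "nat \<Rightarrow> 'n::finite connection \<Rightarrow> bool" where
  "is_levi_civita p D \<longleftrightarrow>
     affine_connection p D \<and>
     (\<forall>X Y. vfield p X \<and> vfield p Y \<longrightarrow>
        (\<forall>P\<in>Gr p. D X Y P - D Y X P = lie_bracket p X Y P)) \<and>
     (\<forall>X Y Z. vfield p X \<and> vfield p Y \<and> vfield p Z \<longrightarrow>
        (\<forall>P\<in>Gr p. dir_deriv p (\<lambda>A. gmetric (Y A) (Z A)) P (X P)
                 = gmetric (D X Y P) (Z P) + gmetric (Y P) (D X Z P)))"

text \<open>By the fundamental theorem of Riemannian geometry the choice is immaterial: the values
  \<open>nabla p X Y P\<close> for smooth vector fields \<open>X\<close>, \<open>Y\<close> and \<open>P \<in> Gr p\<close> are determined.\<close>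

definition nabla :: "nat \<Rightarrow> 'n::finite connection" where
  "nabla p = (SOME D. is_levi_civita p D)"

definition curvature ::
    "nat \<Rightarrow> (real^'n^'n \<Rightarrow> real^'n^'n) \<Rightarrow> (real^'n^'n \<Rightarrow> real^'n^'n) \<Rightarrow> (real^'n^'n \<Rightarrow> real^'n^'n) \<Rightarrow>
      real^'n^'n \<Rightarrow> real^'n^'n" where
  "curvature p X Y Z P =
     nabla p X (nabla p Y Z) P - nabla p Y (nabla p X Z) P - nabla p (lie_bracket p X Y) Z P"

text \<open>The pointwise tensor \<open>R\<^sub>P(x, y) z\<close>; it does not depend on the extensions of the tangent
  vectors to vector fields.\<close>

definition riemann ::
    "nat \<Rightarrow> real^'n^'n \<Rightarrow> real^'n^'n \<Rightarrow> real^'n^'n \<Rightarrow> real^'n^'n \<Rightarrow> real^'n^'n" where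
  "riemann p P x y z =
     (THE r. \<forall>X Y Z. vfield p X \<and> vfield p Y \<and> vfield p Z \<and> X P = x \<and> Y P = y \<and> Z P = z \<longrightarrow>
        curvature p X Y Z P = r)"


section \<open>Curves, covariant derivative along curves, Jacobi fields\<close>

definition smooth_curve :: "nat \<Rightarrow> (real \<Rightarrow> real^'n^'n) \<Rightarrow> bool" where
  "smooth_curve p c \<longleftrightarrow> smooth_on UNIV c \<and> (\<forall>t. c t \<in> Gr p)"

definition velocity :: "(real \<Rightarrow> real^'n^'n) \<Rightarrow> real \<Rightarrow> real^'n^'n" where
  "velocity c t = vector_derivative c (at t)"

definition field_along :: "(real \<Rightarrow> real^'n^'n) \<Rightarrow> (real \<Rightarrow> real^'n^'n) \<Rightarrow> bool" where
  "field_along c V \<longleftrightarrow> smooth_on UNIV V \<and> (\<forall>t. V t \<in> TGr (c t))"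

text \<open>The last clause says \<open>D\<^sub>t (X \<circ> c) = \<nabla>\<^bsub>c'(t)\<^esub> X\<close>, where the right-hand side is
  computed with any vector field \<open>W\<close> that takes the value \<open>c'(t)\<close> at \<open>c(t)\<close>.\<close>

definition is_cov_deriv ::
    "nat \<Rightarrow> (real \<Rightarrow> real^'n^'n) \<Rightarrow> ((real \<Rightarrow> real^'n^'n) \<Rightarrow> real \<Rightarrow> real^'n^'n) \<Rightarrow> bool" where
  "is_cov_deriv p c D \<longleftrightarrow>
     (\<forall>V. field_along c V \<longrightarrow> field_along c (D V)) \<and>
     (\<forall>V V' a b t. field_along c V \<and> field_along c V' \<longrightarrow>
        D (\<lambda>u. a *\<^sub>R V u + b *\<^sub>R V' u) t = a *\<^sub>R D V t + b *\<^sub>R D V' t) \<and>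
     (\<forall>V f t. field_along c V \<and> smooth_on UNIV (f :: real \<Rightarrow> real) \<longrightarrow>
        D (\<lambda>u. f u *\<^sub>R V u) t = vector_derivative f (at t) *\<^sub>R V t + f t *\<^sub>R D V t) \<and>
     (\<forall>X W t. vfield p X \<and> vfield p W \<and> W (c t) = velocity c t \<longrightarrow>
        D (\<lambda>u. X (c u)) t = nabla p W X (c t))"

text \<open>Along a smooth curve in \<open>Gr\<close> such an operator exists and is unique on smooth vector fields
  along the curve.\<close>

definition cov_deriv ::
    "nat \<Rightarrow> (real \<Rightarrow> real^'n^'n) \<Rightarrow> (real \<Rightarrow> real^'n^'n) \<Rightarrow> real \<Rightarrow> real^'n^'n" where
  "cov_deriv p c = (SOME D. is_cov_deriv p c D)"

definition geodesic :: "nat \<Rightarrow> (real \<Rightarrow> real^'n^'n) \<Rightarrow> bool" where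
  "geodesic p c \<longleftrightarrow> smooth_curve p c \<and> (\<forall>t. cov_deriv p c (velocity c) t = 0)"

text \<open>\<open>Gr\<close> is compact, so geodesics are defined on all of \<open>\<real>\<close>.\<close>

definition Exp_Gr :: "nat \<Rightarrow> real^'n^'n \<Rightarrow> real^'n^'n \<Rightarrow> real^'n^'n" where
  "Exp_Gr p P D = (THE q. \<exists>c. geodesic p c \<and> c 0 = P \<and> velocity c 0 = D \<and> q = c 1)"

definition jacobi_field :: "nat \<Rightarrow> (real \<Rightarrow> real^'n^'n) \<Rightarrow> (real \<Rightarrow> real^'n^'n) \<Rightarrow> bool" where
  "jacobi_field p c J \<longleftrightarrow>
     field_along c J \<and>
     (\<forall>t. cov_deriv p c (cov_deriv p c J) t
            + riemann p (c t) (J t) (velocity c t) (velocity c t) = 0)"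

definition geodesic_variation ::
    "nat \<Rightarrow> (real \<Rightarrow> real^'n^'n) \<Rightarrow> (real \<Rightarrow> real \<Rightarrow> real^'n^'n) \<Rightarrow> bool" where
  "geodesic_variation p c F \<longleftrightarrow>
     smooth_on UNIV (\<lambda>(s, t). F s t) \<and> (\<forall>t. F 0 t = c t) \<and> (\<forall>s. geodesic p (F s))"

end

theory Submission
  imports Defs
begin

text \<open>With \<open>A = [\<Delta>, P]\<close>, the curve \<open>c\<close> is a geodesic iff \<open>[c', c]\<close> is constant, hence iff it
  solves the linear equation \<open>c' = [A, c]\<close>; its solution is \<open>P\<close> conjugated by \<open>exp (t A)\<close>. The
  Levi-Civita connection is the tangential projection of the ambient derivative, its curvature is
  \<open>R(x, y) z = [[x, y], z]\<close>, and conjugation by \<open>exp (t A)\<close> is parallel transport along the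
  geodesic. In the transported frame the Jacobi equation becomes \<open>k'' = - [[k, \<Delta>], \<Delta>]\<close>, whose
  solutions are determined by \<open>k 0\<close> and \<open>k' 0\<close> by conservation of energy. The variation field of a geodesic
  variation solves it because the mixed derivatives of the variation commute. Finally, the
  frame \<open>Y\<close> built from a singular value decomposition solves \<open>Y' = A Y\<close>, so \<open>Y Y\<^sup>T\<close> is the geodesic,
  and differentiating \<open>Y Y\<^sup>T\<close> with respect to \<open>s\<close> gives the formula for the Jacobi field.\<close>

section \<open>Calculus of smooth maps\<close>

text \<open>The exponential map, the connection, the covariant derivative and the curvature tensor
  are given by descriptions, so each is identified with an explicit formula by an existence and
  uniqueness argument, and existence includes smoothness in the sense of local extensions. This
  calls for a calculus of smooth maps with symmetric second derivatives and for smoothness of the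
  exponential on the whole matrix space, since a geodesic variation has to be smooth jointly in
  \<open>s\<close> and \<open>t\<close>. The factors of the singular value decomposition are only
  differentiable in \<open>s\<close> near \<open>0\<close> and cannot supply joint smoothness or
  exchange of mixed derivatives; they serve only to evaluate one derivative at \<open>s = 0\<close>.
  The matrix identities rest on a grading: relative to the image of \<open>P\<close>, tangent
  matrices and \<open>comm D P\<close> are off-diagonal, normal ones are block diagonal, and a
  bracket of two off-diagonal matrices is block diagonal.\<close>

lemma Ck_on_cong_imp:
  assumes "open S" "\<And>x. x \<in> S \<Longrightarrow> f x = g x" "Ck_on k S f"
  shows "Ck_on k S g"
  using assms(2,3)
proof (induction k arbitrary: f g)
  case 0
  then show ?case using continuous_on_eq by auto
next
  case (Suc k)
  have d: "(g has_derivative frechet_derivative f (at x)) (at x)" if "x \<in> S" for x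
  proof -
    have "(f has_derivative frechet_derivative f (at x)) (at x)"
      using Suc.prems(2) that by (simp flip: frechet_derivative_works)
    then show ?thesis
      by (rule has_derivative_transform_within_open[OF _ \<open>open S\<close> that]) (use Suc.prems(1) in auto)
  qed
  have "Ck_on k S (\<lambda>x. frechet_derivative g (at x) v)" for v
    by (rule Suc.IH[of "\<lambda>x. frechet_derivative f (at x) v"])
       (use Suc.prems(2) in \<open>auto simp: frechet_derivative_at[OF d, symmetric]\<close>)
  then show ?case using d by (auto simp: differentiable_def)
qed

text \<open>Lets smoothness be checked on any explicit formula for the derivative instead of on the
  chosen \<open>frechet_derivative\<close>.\<close>

lemma Ck_on_SucI:
  assumes "open S" "\<And>x. x \<in> S \<Longrightarrow> (f has_derivative f' x) (at x)"
    and "\<And>v. Ck_on k S (\<lambda>x. f' x v)"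
  shows "Ck_on (Suc k) S f"
proof -
  have "Ck_on k S (\<lambda>x. frechet_derivative f (at x) v)" for v
    by (rule Ck_on_cong_imp[OF assms(1) _ assms(3)[of v]])
       (auto simp: frechet_derivative_at[OF assms(2), symmetric])
  then show ?thesis using assms(2) by (auto simp: differentiable_def)
qed

lemma Ck_on_SucD: "Ck_on (Suc k) S f \<Longrightarrow> Ck_on k S f"
proof (induction k arbitrary: f)
  case 0
  then show ?case
    by (auto intro!: continuous_at_imp_continuous_on differentiable_imp_continuous_within)
qed auto

lemma Ck_on_has_derivative:
  "Ck_on (Suc k) S f \<Longrightarrow> x \<in> S \<Longrightarrow> (f has_derivative frechet_derivative f (at x)) (at x)"
  by (simp flip: frechet_derivative_works)

lemma Ck_on_subset: "T \<subseteq> S \<Longrightarrow> Ck_on k S f \<Longrightarrow> Ck_on k T f"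
  by (induction k arbitrary: f) (auto intro: continuous_on_subset)

lemma Ck_on_const: "open S \<Longrightarrow> Ck_on k S (\<lambda>x. c)"
  by (induction k arbitrary: c) auto

lemma Ck_on_add:
  assumes "open S" "Ck_on k S f" "Ck_on k S g"
  shows "Ck_on k S (\<lambda>x. f x + g x)"
  using assms(2,3)
proof (induction k arbitrary: f g)
  case (Suc k)
  show ?case
    by (rule Ck_on_SucI[OF \<open>open S\<close>, where f' = "\<lambda>x v. frechet_derivative f (at x) v + frechet_derivative g (at x) v"])
       (use Suc in \<open>auto intro!: has_derivative_add Ck_on_has_derivative simp del: Ck_on.simps(2)\<close>,
        use Suc in \<open>auto\<close>)
qed (auto intro: continuous_intros)

lemma Ck_on_bounded_linear:
  assumes "open S" "bounded_linear L" "Ck_on k S f"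
  shows "Ck_on k S (\<lambda>x. L (f x))"
  using assms(3)
proof (induction k arbitrary: f)
  case 0
  then show ?case using bounded_linear.continuous_on[OF assms(2)] by auto
next
  case (Suc k)
  show ?case
    by (rule Ck_on_SucI[OF \<open>open S\<close>, where f' = "\<lambda>x v. L (frechet_derivative f (at x) v)"])
       (use Suc Ck_on_has_derivative[OF Suc.prems] in \<open>auto intro!: bounded_linear.has_derivative[OF assms(2)]\<close>)
qed

lemma Ck_on_bilinear:
  assumes "open S" "bounded_bilinear h" "Ck_on k S f" "Ck_on k S g"
  shows "Ck_on k S (\<lambda>x. h (f x) (g x))"
  using assms(3,4)
proof (induction k arbitrary: f g)
  case 0
  then show ?case using bounded_bilinear.continuous_on[OF assms(2)] by auto
next
  case (Suc k)
  have "Ck_on k S (\<lambda>x. h (f x) (frechet_derivative g (at x) v) + h (frechet_derivative f (at x) v) (g x))" for v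
    by (intro Ck_on_add assms Suc.IH Ck_on_SucD[OF Suc.prems(1)] Ck_on_SucD[OF Suc.prems(2)])
      (use Suc.prems in auto)
  then show ?case
    by (intro Ck_on_SucI[OF \<open>open S\<close>, where f' = "\<lambda>x v. h (f x) (frechet_derivative g (at x) v) + h (frechet_derivative f (at x) v) (g x)"])
       (auto intro!: bounded_bilinear.FDERIV[OF assms(2)] Ck_on_has_derivative Suc.prems simp del: Ck_on.simps(2))
qed

lemma Ck_on_ident: "open S \<Longrightarrow> Ck_on k S (\<lambda>x. x)"
  by (cases k) (auto intro!: Ck_on_const)

lemma Ck_on_sum:
  assumes "open S" "\<And>i. i \<in> I \<Longrightarrow> Ck_on k S (f i)"
  shows "Ck_on k S (\<lambda>x. \<Sum>i\<in>I. f i x)"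
  using assms(2)
  by (induction I rule: infinite_finite_induct) (auto intro!: Ck_on_add Ck_on_const assms(1))

lemma linear_basis_expansion:
  fixes v :: "'a::euclidean_space"
  assumes "linear L"
  shows "L v = (\<Sum>b\<in>Basis. (v \<bullet> b) *\<^sub>R L b)"
proof -
  have "L v = L (\<Sum>b\<in>Basis. (v \<bullet> b) *\<^sub>R b)" by (simp add: euclidean_representation)
  also have "\<dots> = (\<Sum>b\<in>Basis. (v \<bullet> b) *\<^sub>R L b)"
    by (simp add: linear_sum[OF assms] linear_scale[OF assms])
  finally show ?thesis .
qed

text \<open>The recursion in \<open>Ck_on\<close> speaks of fixed directions only. A direction that
  varies with the point is expanded in the standard basis, which leaves scalar coefficients times
  values in fixed directions.\<close>

lemma Ck_on_linear_apply:
  fixes g :: "'a::euclidean_space \<Rightarrow> 'b::euclidean_space"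
  assumes "open S" "\<And>x. x \<in> S \<Longrightarrow> linear (L x)" "\<And>b. Ck_on k S (\<lambda>x. L x b)" "Ck_on k S g"
  shows "Ck_on k S (\<lambda>x. L x (g x))"
proof (rule Ck_on_cong_imp[OF assms(1)])
  show "(\<Sum>b\<in>Basis. (g x \<bullet> b) *\<^sub>R L x b) = L x (g x)" if "x \<in> S" for x
    by (rule linear_basis_expansion[where L = "L x", OF assms(2)[OF that], symmetric])
  show "Ck_on k S (\<lambda>x. \<Sum>b\<in>Basis. (g x \<bullet> b) *\<^sub>R L x b)"
    by (intro Ck_on_sum[OF assms(1)] Ck_on_bilinear[OF assms(1) bounded_bilinear_scaleR]
        Ck_on_bounded_linear[OF assms(1) bounded_linear_inner_left] assms(3,4))
qed

text \<open>The induction keeps \<open>g\<close> fixed: the chain rule yields a derivative of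
  \<open>f\<close> at \<open>g x\<close> in a moving direction, and the derivatives of
  \<open>f\<close> in basis directions fall under the induction hypothesis.\<close>

lemma Ck_on_compose:
  fixes g :: "'a::euclidean_space \<Rightarrow> 'b::euclidean_space"
  assumes "open S" "open T" "g ` S \<subseteq> T" "Ck_on k T f" "Ck_on k S g"
  shows "Ck_on k S (\<lambda>x. f (g x))"
  using assms(4,5)
proof (induction k arbitrary: f)
  case 0
  then show ?case using assms(3) by (auto intro: continuous_on_compose2)
next
  case (Suc k)
  have gT: "g x \<in> T" if "x \<in> S" for x using that assms(3) by auto
  have lin: "linear (frechet_derivative f (at (g x)))" if "x \<in> S" for x
    using Suc.prems(1) gT[OF that] by (auto intro: linear_frechet_derivative)
  have "Ck_on k S (\<lambda>x. frechet_derivative f (at (g x)) (frechet_derivative g (at x) v))" for v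
    by (rule Ck_on_linear_apply[where L = "\<lambda>x. frechet_derivative f (at (g x))"])
      (use assms lin Suc.IH[of "\<lambda>y. frechet_derivative f (at y) b" for b] Suc.prems Ck_on_SucD[OF Suc.prems(2)] in auto)
  then show ?case
    by (intro Ck_on_SucI[OF \<open>open S\<close>, where f' = "\<lambda>x v. frechet_derivative f (at (g x)) (frechet_derivative g (at x) v)"])
       (auto intro!: has_derivative_compose[where g=f] Ck_on_has_derivative Suc.prems gT simp del: Ck_on.simps(2))
qed

lemma smooth_on_open: "smooth_on S f \<Longrightarrow> open S"
  by (simp add: smooth_on_def)

lemma smooth_on_has_derivative:
  "smooth_on S f \<Longrightarrow> x \<in> S \<Longrightarrow> (f has_derivative frechet_derivative f (at x)) (at x)"
  unfolding smooth_on_def by (metis Ck_on_has_derivative)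

lemma smooth_on_linear_frechet:
  "smooth_on S f \<Longrightarrow> x \<in> S \<Longrightarrow> linear (frechet_derivative f (at x))"
  using smooth_on_has_derivative has_derivative_linear by blast

lemma smooth_on_subset: "smooth_on S f \<Longrightarrow> open T \<Longrightarrow> T \<subseteq> S \<Longrightarrow> smooth_on T f"
  unfolding smooth_on_def by (metis Ck_on_subset)

lemma smooth_on_cong:
  "smooth_on S f \<Longrightarrow> (\<And>x. x \<in> S \<Longrightarrow> f x = g x) \<Longrightarrow> smooth_on S g"
  unfolding smooth_on_def by (metis Ck_on_cong_imp)

lemma smooth_on_const: "open S \<Longrightarrow> smooth_on S (\<lambda>x. c)"
  by (simp add: smooth_on_def Ck_on_const)

lemma smooth_on_ident: "open S \<Longrightarrow> smooth_on S (\<lambda>x. x)"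
  by (simp add: smooth_on_def Ck_on_ident)

lemma smooth_on_add: "smooth_on S f \<Longrightarrow> smooth_on S g \<Longrightarrow> smooth_on S (\<lambda>x. f x + g x)"
  by (simp add: smooth_on_def Ck_on_add)

lemma smooth_on_bounded_linear:
  "bounded_linear L \<Longrightarrow> smooth_on S f \<Longrightarrow> smooth_on S (\<lambda>x. L (f x))"
  by (simp add: smooth_on_def Ck_on_bounded_linear)

lemma smooth_on_bilinear:
  "bounded_bilinear h \<Longrightarrow> smooth_on S f \<Longrightarrow> smooth_on S g \<Longrightarrow> smooth_on S (\<lambda>x. h (f x) (g x))"
  by (simp add: smooth_on_def Ck_on_bilinear)

lemma smooth_on_minus: "smooth_on S f \<Longrightarrow> smooth_on S (\<lambda>x. - f x)"
  by (rule smooth_on_bounded_linear[OF bounded_linear_minus[OF bounded_linear_ident]])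

lemma smooth_on_diff: "smooth_on S f \<Longrightarrow> smooth_on S g \<Longrightarrow> smooth_on S (\<lambda>x. f x - g x)"
  using smooth_on_add[OF _ smooth_on_minus, of S f g] by simp

lemma smooth_on_scaleR_const: "smooth_on S f \<Longrightarrow> smooth_on S (\<lambda>x. a *\<^sub>R f x)"
  by (rule smooth_on_bounded_linear[OF bounded_linear_scaleR_right])

lemma smooth_on_compose:
  "smooth_on T f \<Longrightarrow> smooth_on S g \<Longrightarrow> g ` S \<subseteq> T \<Longrightarrow> smooth_on S (\<lambda>x. f (g x))"
  unfolding smooth_on_def by (blast intro: Ck_on_compose)

lemma smooth_on_frechet: "smooth_on S f \<Longrightarrow> smooth_on S (\<lambda>x. frechet_derivative f (at x) v)"
  unfolding smooth_on_def by (metis Ck_on.simps(2))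

lemma smooth_on_frechet_apply:
  "smooth_on S f \<Longrightarrow> smooth_on S g \<Longrightarrow> smooth_on S (\<lambda>x. frechet_derivative f (at x) (g x))"
  using Ck_on_linear_apply[where L = "\<lambda>x. frechet_derivative f (at x)" and S = S and g = g]
    smooth_on_frechet[of S f] smooth_on_linear_frechet[of S f]
  by (simp add: smooth_on_def)

lemma smooth_on_vector_derivative:
  fixes c :: "real \<Rightarrow> 'a::euclidean_space"
  assumes "smooth_on UNIV c"
  shows "(c has_vector_derivative vector_derivative c (at t)) (at t)"
    and "smooth_on UNIV (\<lambda>t. vector_derivative c (at t))"
proof -
  have d: "c differentiable (at t)" for t
    using smooth_on_has_derivative[OF assms] by (auto simp: differentiable_def)
  then show "(c has_vector_derivative vector_derivative c (at t)) (at t)"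
    by (simp add: vector_derivative_works)
  show "smooth_on UNIV (\<lambda>t. vector_derivative c (at t))"
    using smooth_on_frechet[OF assms, of 1] d
    by (auto intro!: smooth_on_cong simp: frechet_derivative_eq_vector_derivative)
qed

section \<open>Symmetry of second derivatives\<close>

text \<open>Two applications of the mean value theorem: along \<open>v\<close> to the difference of
  \<open>f\<close> on two parallel segments offset by \<open>h *\<^sub>R w\<close>, then along
  \<open>w\<close> to the resulting difference of first derivatives. The bound on \<open>h\<close>
  keeps the parallelogram inside the ball.\<close>

lemma second_difference_mean_value:
  fixes f :: "'a::euclidean_space \<Rightarrow> real"
  assumes C: "Ck_on (Suc (Suc 0)) S f" and r: "ball x r \<subseteq> S"
    and h: "h > 0" "h * (norm v + norm w) < r"
  shows "\<exists>y\<in>ball x r. f (x + h *\<^sub>R v + h *\<^sub>R w) - f (x + h *\<^sub>R v) - (f (x + h *\<^sub>R w) - f x) =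
           h * h * frechet_derivative (\<lambda>x. frechet_derivative f (at x) v) (at y) w"
proof -
  let ?G = "\<lambda>x. frechet_derivative f (at x) v"
  have inball: "x + s *\<^sub>R v + t *\<^sub>R w \<in> ball x r" if "0 \<le> s" "s \<le> h" "0 \<le> t" "t \<le> h" for s t
  proof -
    have "norm (s *\<^sub>R v + t *\<^sub>R w) \<le> s * norm v + t * norm w"
      using that by (metis abs_of_nonneg norm_scaleR norm_triangle_ineq)
    also have "\<dots> \<le> h * norm v + h * norm w"
      using that by (intro add_mono mult_right_mono) auto
    also have "\<dots> < r" using h by (simp add: algebra_simps)
    finally show ?thesis
      by (simp add: dist_norm add.assoc) (metis minus_add_distrib norm_minus_cancel uminus_add_conv_diff add.commute)
  qed
  have df: "(f has_derivative frechet_derivative f (at y)) (at y)" if "y \<in> ball x r" for y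
    using Ck_on_has_derivative[OF C] r that by blast
  have dG: "(?G has_derivative frechet_derivative ?G (at y)) (at y)" if "y \<in> ball x r" for y
    using Ck_on_has_derivative[of 0 S ?G] C r that by auto
  have 1: "((\<lambda>s. f (x + s *\<^sub>R v + t *\<^sub>R w)) has_real_derivative ?G (x + s *\<^sub>R v + t *\<^sub>R w)) (at s)"
    if st: "0 \<le> s" "s \<le> h" "0 \<le> t" "t \<le> h" for s t
  proof -
    have "((\<lambda>s. f (x + s *\<^sub>R v + t *\<^sub>R w)) has_derivative
        (\<lambda>u. frechet_derivative f (at (x + s *\<^sub>R v + t *\<^sub>R w)) (u *\<^sub>R v))) (at s)"
      by (rule has_derivative_compose[where f = "\<lambda>s. x + s *\<^sub>R v + t *\<^sub>R w", OF _ df[OF inball[OF st]]]) (auto intro!: derivative_eq_intros)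
    moreover have "linear (frechet_derivative f (at (x + s *\<^sub>R v + t *\<^sub>R w)))"
      using has_derivative_linear[OF df[OF inball[OF st]]] .
    ultimately show ?thesis
      by (simp add: has_field_derivative_def linear_scale mult_commute_abs)
  qed
  have 2: "((\<lambda>t. ?G (x + s *\<^sub>R v + t *\<^sub>R w)) has_real_derivative
        frechet_derivative ?G (at (x + s *\<^sub>R v + t *\<^sub>R w)) w) (at t)"
    if st: "0 \<le> s" "s \<le> h" "0 \<le> t" "t \<le> h" for s t
  proof -
    have "((\<lambda>t. ?G (x + s *\<^sub>R v + t *\<^sub>R w)) has_derivative
        (\<lambda>u. frechet_derivative ?G (at (x + s *\<^sub>R v + t *\<^sub>R w)) (u *\<^sub>R w))) (at t)"
      by (rule has_derivative_compose[where f = "\<lambda>t. x + s *\<^sub>R v + t *\<^sub>R w", OF _ dG[OF inball[OF st]]]) (auto intro!: derivative_eq_intros)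
    moreover have "linear (frechet_derivative ?G (at (x + s *\<^sub>R v + t *\<^sub>R w)))"
      using has_derivative_linear[OF dG[OF inball[OF st]]] .
    ultimately show ?thesis
      by (simp add: has_field_derivative_def linear_scale mult_commute_abs)
  qed
  have "\<exists>s>0. s < h \<and> (f (x + h *\<^sub>R v + h *\<^sub>R w) - f (x + h *\<^sub>R v + 0 *\<^sub>R w)) - (f (x + 0 *\<^sub>R v + h *\<^sub>R w) - f (x + 0 *\<^sub>R v + 0 *\<^sub>R w))
      = (h - 0) * (?G (x + s *\<^sub>R v + h *\<^sub>R w) - ?G (x + s *\<^sub>R v + 0 *\<^sub>R w))"
    by (rule MVT2) (use h in \<open>auto intro!: DERIV_diff 1[of _ h] 1[of _ 0, simplified]\<close>)
  then obtain s where s: "0 < s" "s < h" and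
    es: "f (x + h *\<^sub>R v + h *\<^sub>R w) - f (x + h *\<^sub>R v) - (f (x + h *\<^sub>R w) - f x)
      = h * (?G (x + s *\<^sub>R v + h *\<^sub>R w) - ?G (x + s *\<^sub>R v + 0 *\<^sub>R w))" by auto
  have "\<exists>t>0. t < h \<and> ?G (x + s *\<^sub>R v + h *\<^sub>R w) - ?G (x + s *\<^sub>R v + 0 *\<^sub>R w)
      = (h - 0) * frechet_derivative ?G (at (x + s *\<^sub>R v + t *\<^sub>R w)) w"
    by (rule MVT2) (use h s in \<open>auto intro!: 2\<close>)
  then obtain t where t: "0 < t" "t < h" and
    et: "?G (x + s *\<^sub>R v + h *\<^sub>R w) - ?G (x + s *\<^sub>R v + 0 *\<^sub>R w)
      = h * frechet_derivative ?G (at (x + s *\<^sub>R v + t *\<^sub>R w)) w" by auto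
  show ?thesis
    by (rule bexI[of _ "x + s *\<^sub>R v + t *\<^sub>R w"]) (use es et inball s t in auto)
qed

text \<open>The second difference is symmetric in \<open>v\<close> and \<open>w\<close>, so the two
  mixed derivatives share a value at two points near \<open>x\<close>; continuity then moves both
  points to \<open>x\<close>.\<close>

lemma second_derivative_symmetric_real:
  fixes f :: "'a::euclidean_space \<Rightarrow> real"
  assumes "open S" and C: "Ck_on (Suc (Suc 0)) S f" and x: "x \<in> S"
  shows "frechet_derivative (\<lambda>x. frechet_derivative f (at x) v) (at x) w =
         frechet_derivative (\<lambda>x. frechet_derivative f (at x) w) (at x) v"
proof (rule ccontr)
  let ?A = "\<lambda>y. frechet_derivative (\<lambda>x. frechet_derivative f (at x) v) (at y) w"
  let ?B = "\<lambda>y. frechet_derivative (\<lambda>x. frechet_derivative f (at x) w) (at y) v"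
  assume ne: "?A x \<noteq> ?B x"
  \<comment> \<open>Half of the supposed gap: two deviations strictly below \<open>e\<close> cannot
    bridge it.\<close>
  define e where "e = \<bar>?A x - ?B x\<bar> / 2"
  have e: "e > 0" using ne by (simp add: e_def)
  have "isCont ?A x" "isCont ?B x"
    using C x \<open>open S\<close> by (auto simp: continuous_on_eq_continuous_at)
  then obtain d1 d2 where d: "d1 > 0" "d2 > 0"
    and dA: "\<And>y. dist y x < d1 \<Longrightarrow> \<bar>?A y - ?A x\<bar> < e" and dB: "\<And>y. dist y x < d2 \<Longrightarrow> \<bar>?B y - ?B x\<bar> < e"
    using e by (auto simp: continuous_at_eps_delta dist_real_def)
      (metis dist_real_def)
  obtain r0 where r0: "r0 > 0" "ball x r0 \<subseteq> S" using \<open>open S\<close> x by (meson openE)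
  define r where "r = min r0 (min d1 d2)"
  have r: "r > 0" "ball x r \<subseteq> S" using r0 d by (auto simp: r_def)
  \<comment> \<open>The summand \<open>1\<close> avoids division by zero and makes the bound on
    \<open>h\<close> strict.\<close>
  define h where "h = r / (norm v + norm w + 1)"
  have pos: "norm v + norm w + 1 > 0" by (smt (verit) norm_ge_zero)
  have h: "h > 0" "h * (norm v + norm w) < r" "h * (norm w + norm v) < r"
    using r pos by (auto simp: h_def divide_simps add.commute algebra_simps)
  obtain y where y: "y \<in> ball x r" "f (x + h *\<^sub>R v + h *\<^sub>R w) - f (x + h *\<^sub>R v) - (f (x + h *\<^sub>R w) - f x) = h * h * ?A y"
    using second_difference_mean_value[OF C r(2) h(1,2)] by auto
  obtain z where z: "z \<in> ball x r" "f (x + h *\<^sub>R w + h *\<^sub>R v) - f (x + h *\<^sub>R w) - (f (x + h *\<^sub>R v) - f x) = h * h * ?B z"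
    using second_difference_mean_value[OF C r(2) h(1,3)] by auto
  have "h * h * ?A y = h * h * ?B z"
    using y(2) z(2) by (simp add: algebra_simps)
  then have eq: "?A y = ?B z" using h by simp
  have "\<bar>?A y - ?A x\<bar> < e" "\<bar>?B z - ?B x\<bar> < e"
    using y z by (auto intro!: dA dB simp: r_def dist_commute)
  moreover have "\<bar>?A x - ?B x\<bar> \<le> \<bar>?A y - ?A x\<bar> + \<bar>?B z - ?B x\<bar>"
    unfolding eq by simp
  moreover have "\<bar>?A x - ?B x\<bar> = e + e" by (simp add: e_def)
  ultimately show False by argo
qed

text \<open>The mean value argument needs real values, so it is applied to each coordinate.\<close>

lemma second_derivative_symmetric:
  fixes f :: "'a::euclidean_space \<Rightarrow> 'b::euclidean_space"
  assumes f: "smooth_on S f" and x: "x \<in> S"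
  shows "frechet_derivative (\<lambda>x. frechet_derivative f (at x) v) (at x) w =
         frechet_derivative (\<lambda>x. frechet_derivative f (at x) w) (at x) v"
proof (rule euclidean_eqI)
  fix b :: 'b assume b: "b \<in> Basis"
  let ?g = "\<lambda>x. f x \<bullet> b"
  have S: "open S" using f smooth_on_open by auto
  have g: "smooth_on S ?g"
    by (rule smooth_on_bounded_linear[OF bounded_linear_inner_left f])
  have 1: "frechet_derivative ?g (at y) u = frechet_derivative f (at y) u \<bullet> b" if "y \<in> S" for y u
    using frechet_derivative_at[OF bounded_linear.has_derivative[OF bounded_linear_inner_left smooth_on_has_derivative[OF f that]]]
    by metis
  have 2: "frechet_derivative (\<lambda>x. frechet_derivative ?g (at x) u) (at x) u' =
      frechet_derivative (\<lambda>x. frechet_derivative f (at x) u) (at x) u' \<bullet> b" for u u'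
  proof -
    have "((\<lambda>y. frechet_derivative f (at y) u \<bullet> b) has_derivative
        (\<lambda>u'. frechet_derivative (\<lambda>x. frechet_derivative f (at x) u) (at x) u' \<bullet> b)) (at x)"
      by (rule bounded_linear.has_derivative[OF bounded_linear_inner_left smooth_on_has_derivative[OF smooth_on_frechet[OF f] x]])
    then have "((\<lambda>y. frechet_derivative ?g (at y) u) has_derivative
        (\<lambda>u'. frechet_derivative (\<lambda>x. frechet_derivative f (at x) u) (at x) u' \<bullet> b)) (at x)"
      by (rule has_derivative_transform_within_open[OF _ S x]) (use 1 in auto)
    from frechet_derivative_at[OF this] show ?thesis by metis
  qed
  have "frechet_derivative (\<lambda>x. frechet_derivative ?g (at x) v) (at x) w =
        frechet_derivative (\<lambda>x. frechet_derivative ?g (at x) w) (at x) v"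
    by (rule second_derivative_symmetric_real[OF S _ x]) (use g smooth_on_def in blast)
  then show "frechet_derivative (\<lambda>x. frechet_derivative f (at x) v) (at x) w \<bullet> b =
        frechet_derivative (\<lambda>x. frechet_derivative f (at x) w) (at x) v \<bullet> b"
    by (simp only: 2)
qed

section \<open>The matrix exponential\<close>

lemma bounded_bilinear_matrix_mult:
  "bounded_bilinear ((**) :: real^'b::finite^'a::finite \<Rightarrow> real^'c::finite^'b \<Rightarrow> real^'c^'a)"
  unfolding bilinear_conv_bounded_bilinear[symmetric] bilinear_def
  by (auto intro!: linearI simp: matrix_add_ldistrib matrix_add_ldistrib matrix_matrix_mult_def sum.distrib vec_eq_iff algebra_simps sum_distrib_left scalar_matrix_assoc matrix_scalar_ac)

interpretation matmul: bounded_bilinear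
  "(**) :: real^'b::finite^'a::finite \<Rightarrow> real^'c::finite^'b \<Rightarrow> real^'c^'a"
  by (rule bounded_bilinear_matrix_mult)

lemma bounded_linear_transpose:
  "bounded_linear (transpose :: real^'b::finite^'a::finite \<Rightarrow> real^'a^'b)"
  unfolding linear_conv_bounded_linear[symmetric]
  by (auto intro!: linearI simp: transpose_def vec_eq_iff)

lemma transpose_sub_distrib: "transpose (A - B) = transpose A - transpose B"
  for A B :: "real^'b::finite^'a::finite"
  by (simp add: transpose_def vec_eq_iff)

lemma transpose_add_distrib: "transpose (A + B) = transpose A + transpose B"
  for A B :: "real^'b::finite^'a::finite"
  by (simp add: transpose_def vec_eq_iff)

lemma transpose_uminus: "transpose (- A) = - transpose A"
  for A :: "real^'b::finite^'a::finite"
  by (simp add: transpose_def vec_eq_iff)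

lemma transpose_zero: "transpose (0 :: real^'b::finite^'a::finite) = 0"
  by (simp add: transpose_def vec_eq_iff)

text \<open>On these types \<open>numeral k * A\<close> is a componentwise product with a constant
  matrix. Simplification can produce it from repeated summands, so it is reduced to a scalar
  multiple, to which bilinearity applies.\<close>

lemma numeral_times_matrix: "numeral k * A = (numeral k :: real) *\<^sub>R A"
  for A :: "real^'b::finite^'a::finite"
  by (simp add: vec_eq_iff)

lemma matmul_numeral_left: "(numeral k * A) ** B = numeral k * (A ** B)"
  for A :: "real^'b::finite^'a::finite" and B :: "real^'c::finite^'b"
  by (simp only: numeral_times_matrix matmul.scaleR_left)

lemma matmul_numeral_right: "A ** (numeral k * B) = numeral k * (A ** B)"
  for A :: "real^'b::finite^'a::finite" and B :: "real^'c::finite^'b"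
  by (simp only: numeral_times_matrix matmul.scaleR_right)

lemma transpose_numeral: "transpose (numeral k * A) = numeral k * transpose A"
  for A :: "real^'b::finite^'a::finite"
  by (simp only: numeral_times_matrix transpose_scalar)

text \<open>Expands products over sums and nests them to the right, the form in which the rewrite
  rules for projections and orthonormal frames are stated.\<close>

lemmas mat_simps = matmul_numeral_left matmul_numeral_right matmul.add_left matmul.add_right matmul.diff_left matmul.diff_right
  matmul.minus_left matmul.minus_right matmul.scaleR_left matmul.scaleR_right
  matmul.zero_left matmul.zero_right matrix_mul_assoc[symmetric]

lemmas transpose_simps = transpose_numeral transpose_add_distrib transpose_sub_distrib transpose_uminus transpose_scalar transpose_zero
  matrix_transpose_mul transpose_transpose

text \<open>\<open>word n Hs A\<close> is the sum of all products of \<open>n\<close> factors in which the matrices \<open>Hs\<close> occur once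
  each in the given order and all other factors are \<open>A\<close>. These sums are closed under
  differentiation with respect to \<open>A\<close>: a direction is inserted into \<open>Hs\<close> at all places.\<close>

fun word :: "nat \<Rightarrow> (real^'n^'n) list \<Rightarrow> real^'n^'n \<Rightarrow> real^'n^'n" where
  "word 0 [] A = mat 1"
| "word 0 (H # Hs) A = 0"
| "word (Suc n) [] A = A ** word n [] A"
| "word (Suc n) (H # Hs) A = A ** word n (H # Hs) A + H ** word n Hs A"

fun insertions :: "'a \<Rightarrow> 'a list \<Rightarrow> 'a list list" where
  "insertions K [] = [[K]]"
| "insertions K (H # Hs) = (K # H # Hs) # map ((#) H) (insertions K Hs)"

lemma length_insertions: "length (insertions K Hs) = Suc (length Hs)"
  by (induction Hs) auto

lemma sum_list_norm_insertions:
  "Gs \<in> set (insertions K Hs) \<Longrightarrow> (\<Sum>G\<leftarrow>Gs. norm G) = norm K + (\<Sum>H\<leftarrow>Hs. norm H)"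
  by (induction Hs arbitrary: Gs) auto

text \<open>Lists of \<open>insertions\<close> are non-empty, and a word of length \<open>0\<close>
  has no room for a marked factor.\<close>

lemma word_0_insertions: "(\<Sum>Gs\<leftarrow>insertions K Hs. word 0 Gs A) = 0"
  by (induction Hs) (auto simp: o_def)

lemma matmul_sum_list_right:
  fixes A :: "real^'n^'n" and f :: "'a \<Rightarrow> real^'n^'n"
  shows "A ** (\<Sum>x\<leftarrow>xs. f x) = (\<Sum>x\<leftarrow>xs. A ** f x)"
  by (induction xs) (auto simp: mat_simps)

text \<open>The Leibniz rule along the recursion of \<open>word\<close>: varying the leading factor
  \<open>A\<close> puts \<open>K\<close> in front, varying the rest of the word inserts
  \<open>K\<close> further back.\<close>

lemma has_derivative_word:
  fixes A :: "real^'n^'n"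
  shows "(word n Hs has_derivative (\<lambda>K. \<Sum>Gs\<leftarrow>insertions K Hs. word n Gs A)) (at A)"
proof (induction n arbitrary: Hs)
  case 0
  have "word 0 Hs = (\<lambda>A. if Hs = [] then mat 1 else 0)"
    by (cases Hs) auto
  then show ?case by (simp add: word_0_insertions)
next
  case (Suc n)
  show ?case
  proof (cases Hs)
    case Nil
    have "((\<lambda>A. A ** word n [] A) has_derivative (\<lambda>K. A ** (\<Sum>Gs\<leftarrow>insertions K []. word n Gs A) + K ** word n [] A)) (at A)"
      by (rule matmul.FDERIV[OF has_derivative_ident Suc.IH])
    then show ?thesis by (simp add: Nil)
  next
    case (Cons H Hs')
    have "((\<lambda>A. A ** word n (H # Hs') A + H ** word n Hs' A) has_derivative
        (\<lambda>K. A ** (\<Sum>Gs\<leftarrow>insertions K (H # Hs'). word n Gs A) + K ** word n (H # Hs') A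
          + H ** (\<Sum>Gs\<leftarrow>insertions K Hs'. word n Gs A))) (at A)"
      by (intro has_derivative_add matmul.FDERIV[OF has_derivative_ident Suc.IH]
        bounded_linear.has_derivative[OF matmul.bounded_linear_right] Suc.IH)
    then show ?thesis
      by (simp add: Cons o_def mat_simps matmul_sum_list_right sum_list_addf algebra_simps)
  qed
qed

text \<open>A word is part of the expansion of a power of the sum of all matrices involved.
  \<open>K0\<close> is the bound of the bilinear product and \<open>B0\<close> the norm of the
  identity; neither depends on \<open>n\<close>, \<open>Hs\<close> or \<open>A\<close>, as uniform
  convergence requires.\<close>

lemma word_bound:
  "\<exists>K0 B0 :: real. K0 > 0 \<and> B0 \<ge> 0 \<and>
    (\<forall>n Hs A. norm (word n Hs A :: real^'n^'n) \<le> B0 * (K0 * (norm A + (\<Sum>H\<leftarrow>Hs. norm H))) ^ n)"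
proof -
  obtain K0 where K0: "K0 > 0" "\<And>(A :: real^'n^'n) (B :: real^'n^'n). norm (A ** B) \<le> norm A * norm B * K0"
    using matmul.pos_bounded by blast
  let ?B = "norm (mat 1 :: real^'n^'n)"
  have "norm (word n Hs A :: real^'n^'n) \<le> ?B * (K0 * (norm A + (\<Sum>H\<leftarrow>Hs. norm H))) ^ n" for n Hs A
  proof (induction n arbitrary: Hs)
    case 0
    then show ?case by (cases Hs) auto
  next
    case (Suc n)
    show ?case
    proof (cases Hs)
      case Nil
      have "norm (A ** word n [] A) \<le> K0 * norm A * norm (word n [] A)"
        using K0(2)[of A "word n [] A"] by (simp add: ac_simps)
      also have "\<dots> \<le> K0 * norm A * (?B * (K0 * norm A) ^ n)"
        using Suc[of "[]"] K0(1) by (intro mult_left_mono) auto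
      finally show ?thesis by (simp add: Nil ac_simps)
    next
      case (Cons H Hs')
      let ?s = "\<Sum>H\<leftarrow>Hs'. norm H"
      have s: "?s \<ge> 0" by (intro sum_list_nonneg) auto
      let ?X = "?B * (K0 * (norm A + (norm H + ?s))) ^ n"
      have 1: "norm (word n (H # Hs') A) \<le> ?X" using Suc[of "H # Hs'"] by simp
      have "norm (word n Hs' A) \<le> ?B * (K0 * (norm A + ?s)) ^ n" using Suc[of Hs'] .
      also have "\<dots> \<le> ?X"
        using K0(1) s by (intro mult_left_mono power_mono) auto
      finally have 2: "norm (word n Hs' A) \<le> ?X" .
      have "norm (A ** word n (H # Hs') A + H ** word n Hs' A)
          \<le> K0 * norm A * norm (word n (H # Hs') A) + K0 * norm H * norm (word n Hs' A)"
        using K0(2)[of A "word n (H # Hs') A"] K0(2)[of H "word n Hs' A"]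
        by (intro norm_triangle_le) (simp add: ac_simps)
      also have "\<dots> \<le> K0 * norm A * ?X + K0 * norm H * ?X"
        using 1 2 K0(1) by (intro add_mono mult_left_mono) auto
      also have "\<dots> \<le> K0 * (norm A + (norm H + ?s)) * ?X"
        using K0(1) s by (simp add: algebra_simps)
      finally show ?thesis by (simp add: Cons ac_simps)
    qed
  qed
  then show ?thesis using K0(1) norm_ge_zero by blast
qed

text \<open>For \<open>[]\<close> this is the exponential series; the iterated directional
  derivatives of the exponential are finite sums of such series.\<close>

definition word_series :: "(real^'n^'n) list \<Rightarrow> real^'n^'n \<Rightarrow> real^'n^'n" where
  "word_series Hs A = (\<Sum>n. word n Hs A /\<^sub>R fact n)"

lemma summable_exp_bound: "summable (\<lambda>n. c * ((r::real) ^ n / fact n))"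
  using summable_exp[of r] by (intro summable_mult) (simp add: divide_inverse mult.commute)

lemma norm_divide_fact: "norm (x /\<^sub>R fact n) = norm x / fact n" for x :: "'a::real_normed_vector"
  by (simp add: divide_inverse mult.commute)

lemma word_series_sums:
  fixes A :: "real^'n^'n"
  shows "(\<lambda>n. word n Hs A /\<^sub>R fact n) sums word_series Hs A"
proof -
  obtain K0 B0 :: real where "K0 > 0" "B0 \<ge> 0" and b: "\<And>n Hs A. norm (word n Hs A :: real^'n^'n) \<le> B0 * (K0 * (norm A + (\<Sum>H\<leftarrow>Hs. norm H))) ^ n"
    using word_bound by metis
  have "summable (\<lambda>n. word n Hs A /\<^sub>R fact n)"
  proof (rule summable_comparison_test'[OF summable_exp_bound])
    show "norm (word n Hs A /\<^sub>R fact n) \<le> B0 * ((K0 * (norm A + (\<Sum>H\<leftarrow>Hs. norm H))) ^ n / fact n)" for n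
      using divide_right_mono[OF b[of n Hs A], of "fact n"]
      unfolding norm_divide_fact by simp
  qed
  then show ?thesis unfolding word_series_def by (rule summable_sums)
qed

lemma sums_sum_list:
  fixes s :: "'a \<Rightarrow> 'b::real_normed_vector"
  shows "(\<And>x. x \<in> set xs \<Longrightarrow> f x sums s x) \<Longrightarrow> (\<lambda>n. \<Sum>x\<leftarrow>xs. f x n) sums (\<Sum>x\<leftarrow>xs. s x)"
proof (induction xs)
  case (Cons a xs)
  then show ?case using sums_add[of "f a" "s a"] by simp
qed simp

lemma scaleR_sum_list:
  fixes f :: "'a \<Rightarrow> 'b::real_vector"
  shows "a *\<^sub>R (\<Sum>x\<leftarrow>xs. f x) = (\<Sum>x\<leftarrow>xs. a *\<^sub>R f x)"
  by (induction xs) (auto simp: scaleR_right_distrib)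

lemma norm_sum_list_le: "norm (\<Sum>x\<leftarrow>xs. f x) \<le> (\<Sum>x\<leftarrow>xs. norm (f x))"
  by (induction xs) (auto intro: norm_triangle_le)

text \<open>Termwise differentiation: on a ball the differentiated series has a summable majorant
  \<open>c\<close>, so its tails are uniformly small relative to the direction.\<close>

lemma has_derivative_word_series:
  fixes A :: "real^'n^'n"
  shows "(word_series Hs has_derivative (\<lambda>K. \<Sum>Gs\<leftarrow>insertions K Hs. word_series Gs A)) (at A)"
proof -
  obtain K0 B0 :: real where K0: "K0 > 0" "B0 \<ge> 0" and
    b: "\<And>n Hs A. norm (word n Hs A :: real^'n^'n) \<le> B0 * (K0 * (norm A + (\<Sum>H\<leftarrow>Hs. norm H))) ^ n"
    using word_bound by metis
  \<comment> \<open>The radius places \<open>A\<close> inside the open ball \<open>S\<close> around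
    \<open>0\<close>.\<close>
  define R where "R = norm A + 1"
  define S where "S = ball (0 :: real^'n^'n) R"
  \<comment> \<open>\<open>m\<close> counts the lists in \<open>insertions K Hs\<close>, and the
    \<open>1\<close> in \<open>r\<close> below is the norm of a unit direction
    \<open>K\<close>.\<close>
  define m where "m = real (Suc (length Hs))"
  define r where "r = K0 * (R + (1 + (\<Sum>H\<leftarrow>Hs. norm H)))"
  define c where "c n = m * B0 * (r ^ n / fact n)" for n
  define f' where "f' n A K = (\<Sum>Gs\<leftarrow>insertions K Hs. word n Gs A) /\<^sub>R fact n" for n and A K :: "real^'n^'n"
  define g' where "g' A K = (\<Sum>Gs\<leftarrow>insertions K Hs. word_series Gs A)" for A K :: "real^'n^'n"
  have hs: "(\<Sum>H\<leftarrow>Hs. norm H) \<ge> 0" by (intro sum_list_nonneg) auto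
  have der: "((\<lambda>A. word n Hs A /\<^sub>R fact n) has_derivative f' n A) (at A)" for n A
    unfolding f'_def
    by (rule bounded_linear.has_derivative[OF bounded_linear_scaleR_right has_derivative_word])
  have f'_sums: "(\<lambda>n. f' n A K) sums g' A K" for A K
  proof -
    have "(\<lambda>n. \<Sum>Gs\<leftarrow>insertions K Hs. word n Gs A /\<^sub>R fact n) sums g' A K"
      unfolding g'_def by (rule sums_sum_list) (rule word_series_sums)
    then show ?thesis by (simp add: f'_def scaleR_sum_list)
  qed
  have bound1: "norm (f' n A K) \<le> c n" if A: "A \<in> S" and K: "norm K = 1" for n A K
  proof -
    have w: "norm (word n Gs A) \<le> B0 * r ^ n" if "Gs \<in> set (insertions K Hs)" for Gs
    proof -
      have "norm (word n Gs A) \<le> B0 * (K0 * (norm A + (1 + (\<Sum>H\<leftarrow>Hs. norm H)))) ^ n"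
        using b[of n Gs A] sum_list_norm_insertions[OF that] K by simp
      also have "\<dots> \<le> B0 * r ^ n"
        using A K0 hs by (intro mult_left_mono power_mono) (auto simp: r_def S_def)
      finally show ?thesis .
    qed
    have "norm (\<Sum>Gs\<leftarrow>insertions K Hs. word n Gs A) \<le> (\<Sum>Gs\<leftarrow>insertions K Hs. norm (word n Gs A))"
      by (rule norm_sum_list_le)
    also have "\<dots> \<le> (\<Sum>Gs\<leftarrow>insertions K Hs. B0 * r ^ n)"
      by (rule sum_list_mono) (rule w)
    also have "\<dots> = m * B0 * r ^ n"
      by (simp add: m_def sum_list_triv length_insertions)
    finally have "norm (\<Sum>Gs\<leftarrow>insertions K Hs. word n Gs A) / fact n \<le> m * B0 * r ^ n / fact n"
      by (intro divide_right_mono) auto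
    then show ?thesis
      unfolding f'_def c_def norm_divide_fact by simp
  qed
  \<comment> \<open>By homogeneity in \<open>K\<close> the bound for unit directions
    suffices.\<close>
  have bound: "norm (f' n A K) \<le> c n * norm K" if A: "A \<in> S" for n A K
  proof (cases "K = 0")
    case True
    then show ?thesis using has_derivative_linear[OF der[of n A]] by (simp add: linear_0)
  next
    case False
    have "f' n A K = norm K *\<^sub>R f' n A (K /\<^sub>R norm K)"
      using has_derivative_linear[OF der[of n A]] False by (simp add: linear_scale)
    then show ?thesis using bound1[OF A, of "K /\<^sub>R norm K" n] False
      by (simp add: mult.commute mult_left_mono)
  qed
  have sc: "summable c" unfolding c_def by (rule summable_exp_bound)
  have "\<exists>g. \<forall>x\<in>S. (\<lambda>n. word n Hs x /\<^sub>R fact n) sums (g x) \<and> (g has_derivative g' x) (at x within S)"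
  proof (rule has_derivative_series[where f' = f'])
    show "convex S" by (simp add: S_def)
    show "((\<lambda>A. word n Hs A /\<^sub>R fact n) has_derivative f' n x) (at x within S)" for n x
      using der has_derivative_at_withinI by blast
    show "0 \<in> S" by (simp add: S_def R_def add_nonneg_pos)
    show "(\<lambda>n. word n Hs 0 /\<^sub>R fact n) sums word_series Hs 0" by (rule word_series_sums)
    fix e :: real assume e: "e > 0"
    have "(\<lambda>n. \<Sum>i. c (i + n)) \<longlonglongrightarrow> 0"
      by (rule suminf_exist_split2[OF sc])
    then have "\<forall>\<^sub>F n in sequentially. (\<Sum>i. c (i + n)) < e"
      using e order_tendstoD(2) by blast
    then show "\<forall>\<^sub>F n in sequentially. \<forall>x\<in>S. \<forall>h. norm (sum (\<lambda>i. f' i x h) {..<n} - g' x h) \<le> e * norm h"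
    proof (eventually_elim, intro ballI allI)
      fix n x and h :: "real^'n^'n" assume n: "(\<Sum>i. c (i + n)) < e" and x: "x \<in> S"
      have sc': "summable (\<lambda>i. c (i + n) * norm h)"
        by (intro summable_mult2) (simp add: summable_iff_shift sc)
      have "g' x h - sum (\<lambda>i. f' i x h) {..<n} = (\<Sum>i. f' (i + n) x h)"
        using suminf_minus_initial_segment[OF sums_summable[OF f'_sums], of n x h] sums_unique[OF f'_sums, of x h]
        by simp
      also have "norm \<dots> \<le> (\<Sum>i. c (i + n) * norm h)"
        by (rule norm_suminf_le[OF _ sc']) (rule bound[OF x])
      also have "\<dots> = (\<Sum>i. c (i + n)) * norm h"
        by (intro suminf_mult2[symmetric]) (simp add: summable_iff_shift sc)
      also have "\<dots> \<le> e * norm h" using n by (intro mult_right_mono) auto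
      finally show "norm (sum (\<lambda>i. f' i x h) {..<n} - g' x h) \<le> e * norm h"
        by (simp add: norm_minus_commute)
    qed
  qed
  then obtain g where g: "\<And>x. x \<in> S \<Longrightarrow> (\<lambda>n. word n Hs x /\<^sub>R fact n) sums (g x)"
    "\<And>x. x \<in> S \<Longrightarrow> (g has_derivative g' x) (at x within S)" by blast
  have S: "open S" "A \<in> S" by (simp_all add: S_def R_def)
  have "(g has_derivative g' A) (at A)"
    using g(2)[OF S(2)] unfolding at_within_open[OF S(2,1)] .
  then have "(word_series Hs has_derivative g' A) (at A)"
    by (rule has_derivative_transform_within_open[OF _ S])
      (rule sums_unique2[OF g(1) word_series_sums], assumption)
  then show ?thesis by (simp add: g'_def[abs_def])
qed

text \<open>Up to finite sums, the family of all word series is closed under directional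
  derivatives, so the induction on \<open>k\<close> runs over all \<open>Hs\<close> at once.\<close>

lemma smooth_word_series: "smooth_on UNIV (word_series Hs)"
proof -
  have sl: "Ck_on k UNIV (\<lambda>x. \<Sum>y\<leftarrow>ys. f y x)" if "\<And>y. Ck_on k UNIV (f y)"
    for k ys and f :: "'b \<Rightarrow> real^'n^'n \<Rightarrow> real^'n^'n"
    by (induction ys) (auto intro!: Ck_on_add Ck_on_const that)
  have "Ck_on k UNIV (word_series Hs)" for k
  proof (induction k arbitrary: Hs)
    case 0
    show ?case
      using has_derivative_continuous[OF has_derivative_word_series]
      by (auto intro!: continuous_at_imp_continuous_on)
  next
    case (Suc k)
    show ?case
      by (rule Ck_on_SucI[OF _ has_derivative_word_series]) (auto intro!: sl Suc.IH)
  qed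
  then show ?thesis by (simp add: smooth_on_def)
qed

section \<open>The exponential as a one-parameter group\<close>

definition mexp :: "real^'n^'n \<Rightarrow> real^'n^'n" where
  "mexp = word_series []"

lemma smooth_mexp: "smooth_on UNIV mexp"
  by (simp add: mexp_def smooth_word_series)

lemma mexp_sums: "(\<lambda>n. word n [] A /\<^sub>R fact n) sums mexp A"
  by (simp add: mexp_def word_series_sums)

lemma mexp_0: "mexp 0 = (mat 1 :: real^'n^'n)"
proof -
  have "(\<lambda>n. word n [] (0 :: real^'n^'n) /\<^sub>R fact n) = (\<lambda>n. if n = 0 then mat 1 else 0)"
    by (rule ext, case_tac n) (auto simp: matmul.zero_left)
  then have "(\<lambda>n. word n [] (0 :: real^'n^'n) /\<^sub>R fact n) sums mat 1"
    using sums_single[of 0 "\<lambda>_. mat 1 :: real^'n^'n"] by (simp only:)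
  then show ?thesis using mexp_sums sums_unique2 by blast
qed

lemma word_commute:
  assumes "B ** A = A ** B"
  shows "B ** word n [] A = word n [] A ** B"
proof (induction n)
  case (Suc n)
  have "B ** (A ** word n [] A) = A ** (B ** word n [] A)"
    by (simp add: matrix_mul_assoc assms)
  then show ?case by (simp add: Suc matrix_mul_assoc)
qed simp

lemma mexp_commute:
  assumes "B ** A = A ** B"
  shows "B ** mexp A = mexp A ** B"
proof -
  have "(\<lambda>n. B ** (word n [] A /\<^sub>R fact n)) sums (B ** mexp A)"
    by (rule bounded_linear.sums[OF matmul.bounded_linear_right mexp_sums])
  moreover have "(\<lambda>n. (word n [] A /\<^sub>R fact n) ** B) sums (mexp A ** B)"
    by (rule bounded_linear.sums[OF matmul.bounded_linear_left mexp_sums])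
  ultimately show ?thesis
    using word_commute[OF assms] sums_unique2 by (fastforce simp: mat_simps)
qed

text \<open>Transposition reverses the order of the factors, which is harmless for powers of a
  single matrix.\<close>

lemma transpose_mexp: "transpose (mexp A) = mexp (transpose A)"
proof -
  have w: "transpose (word n [] A) = word n [] (transpose A)" for n
  proof (induction n)
    case (Suc n)
    then show ?case
      using word_commute[of "transpose A" "transpose A"] by (simp add: transpose_simps)
  qed simp
  have "(\<lambda>n. transpose (word n [] A /\<^sub>R fact n)) sums transpose (mexp A)"
    by (rule bounded_linear.sums[OF bounded_linear_transpose mexp_sums])
  then have "(\<lambda>n. word n [] (transpose A) /\<^sub>R fact n) sums transpose (mexp A)"
    by (simp add: transpose_simps w)
  then show ?thesis using mexp_sums sums_unique2 by blast
qed

text \<open>The derivative in the direction \<open>A\<close> is the word series with the single mark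
  \<open>A\<close>. At \<open>t *\<^sub>R A\<close> the mark commutes with all other factors, so its
  \<open>n\<close> positions give equal words and the factorial drops by one.\<close>

lemma has_vector_derivative_mexp:
  "((\<lambda>t. mexp (t *\<^sub>R A)) has_vector_derivative A ** mexp (t *\<^sub>R A)) (at t)"
proof -
  have w: "word (Suc n) [A] (t *\<^sub>R A) = real (Suc n) *\<^sub>R (A ** word n [] (t *\<^sub>R A))" for n
  proof (induction n)
    case (Suc n)
    have "word (Suc (Suc n)) [A] (t *\<^sub>R A) =
        (t *\<^sub>R A) ** (real (Suc n) *\<^sub>R (A ** word n [] (t *\<^sub>R A))) + A ** word (Suc n) [] (t *\<^sub>R A)"
      using Suc by simp
    also have "\<dots> = (t * real (Suc n) + t) *\<^sub>R (A ** (A ** word n [] (t *\<^sub>R A)))"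
      by (simp add: mat_simps scaleR_left_distrib del: of_nat_Suc)
    also have "t * real (Suc n) + t = real (Suc (Suc n)) * t"
      by (simp add: algebra_simps)
    also have "(real (Suc (Suc n)) * t) *\<^sub>R (A ** (A ** word n [] (t *\<^sub>R A)))
        = real (Suc (Suc n)) *\<^sub>R (A ** word (Suc n) [] (t *\<^sub>R A))"
      by (simp add: mat_simps del: of_nat_Suc)
    finally show ?case .
  qed simp
  have "(\<lambda>n. A ** (word n [] (t *\<^sub>R A) /\<^sub>R fact n)) sums (A ** mexp (t *\<^sub>R A))"
    by (rule bounded_linear.sums[OF matmul.bounded_linear_right mexp_sums])
  also have "(\<lambda>n. A ** (word n [] (t *\<^sub>R A) /\<^sub>R fact n)) = (\<lambda>n. word (Suc n) [A] (t *\<^sub>R A) /\<^sub>R fact (Suc n))"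
    unfolding w by (simp add: mat_simps fun_eq_iff field_simps del: of_nat_Suc)
  \<comment> \<open>The term of index \<open>0\<close> vanishes, since an empty word cannot carry
    the mark; so the index shift does not change the sum.\<close>
  finally have "(\<lambda>n. word n [A] (t *\<^sub>R A) /\<^sub>R fact n) sums (A ** mexp (t *\<^sub>R A))"
    using sums_Suc_iff[of "\<lambda>n. word n [A] (t *\<^sub>R A) /\<^sub>R fact n"]
    by (simp del: word.simps(4) fact_Suc)
  then have *: "word_series [A] (t *\<^sub>R A) = A ** mexp (t *\<^sub>R A)"
    using word_series_sums sums_unique2 by blast
  have lin: "linear (\<lambda>K. word_series [K] (t *\<^sub>R A))"
    using has_derivative_linear[OF has_derivative_word_series[of "[]" "t *\<^sub>R A"]] by simp
  have "((\<lambda>t. mexp (t *\<^sub>R A)) has_derivative (\<lambda>u. word_series [u *\<^sub>R A] (t *\<^sub>R A))) (at t)"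
    using has_derivative_compose[where f = "\<lambda>t. t *\<^sub>R A" and f' = "\<lambda>u. u *\<^sub>R A" and s = UNIV,
      OF _ has_derivative_word_series[of "[]" "t *\<^sub>R A"]]
    unfolding mexp_def by (simp add: has_derivative_scaleR_left)
  then show ?thesis
    using linear_scale[OF lin] by (simp add: has_vector_derivative_def *)
qed

lemma constant_of_derivative_zero:
  fixes f :: "real \<Rightarrow> 'a::real_normed_vector"
  assumes "\<And>t. (f has_vector_derivative 0) (at t)"
  shows "f s = f t"
  using has_vector_derivative_zero_constant[of UNIV f] assms by (metis UNIV_I convex_UNIV)

lemmas has_vector_derivative_matmul = matmul.has_vector_derivative

lemma has_vector_derivative_mexp_minus:
  "((\<lambda>t. mexp (- (t *\<^sub>R A))) has_vector_derivative - (mexp (- (t *\<^sub>R A)) ** A)) (at t)"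
proof -
  have "A ** mexp (- (t *\<^sub>R A)) = mexp (- (t *\<^sub>R A)) ** A"
    by (rule mexp_commute) (simp add: mat_simps)
  then show ?thesis
    using has_vector_derivative_mexp[of "- A" t] by (simp add: mat_simps)
qed

lemma mexp_inverse: "mexp A ** mexp (- A) = mat 1" "mexp (- A) ** mexp A = mat 1"
proof -
  have "((\<lambda>t. mexp (t *\<^sub>R A) ** mexp (- (t *\<^sub>R A))) has_vector_derivative 0) (at t)" for t
  proof (rule has_vector_derivative_eq_rhs[OF
      has_vector_derivative_matmul[OF has_vector_derivative_mexp has_vector_derivative_mexp_minus]])
    have "A ** mexp (t *\<^sub>R A) = mexp (t *\<^sub>R A) ** A" "A ** mexp (- (t *\<^sub>R A)) = mexp (- (t *\<^sub>R A)) ** A"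
      by (rule mexp_commute; simp add: mat_simps)+
    then show "mexp (t *\<^sub>R A) ** - (mexp (- (t *\<^sub>R A)) ** A) + A ** mexp (t *\<^sub>R A) ** mexp (- (t *\<^sub>R A)) = 0"
      by (simp add: mat_simps)
  qed
  from constant_of_derivative_zero[OF this, of 1 0] show "mexp A ** mexp (- A) = mat 1"
    by (simp add: mexp_0)
  then show "mexp (- A) ** mexp A = mat 1"
    using matrix_left_right_inverse by blast
qed

section \<open>Tangent projection and directional derivatives\<close>

lemma GrD:
  assumes "P \<in> Gr p"
  shows "transpose P = P" "P ** P = P" "P ** (P ** X) = P ** X" "rank P = p"
  using assms by (auto simp: Gr_def matrix_mul_assoc)

text \<open>The tangency equation is oriented so as to move \<open>P\<close> to the left of tangent
  matrices. Together with \<open>P ** P = P\<close> this gives normal forms, by which the simplifier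
  decides the later identities between \<open>P\<close> and tangent matrices.\<close>

lemma TGrD:
  assumes "D \<in> TGr P"
  shows "transpose D = D" "D ** P = D - P ** D" "D ** (P ** X) = D ** X - P ** (D ** X)"
proof -
  show "transpose D = D" using assms by (simp add: TGr_def)
  have e: "D ** P + P ** D = D" using assms by (simp add: TGr_def)
  show 1: "D ** P = D - P ** D" using e by (simp add: eq_diff_eq)
  show "D ** (P ** X) = D ** X - P ** (D ** X)"
    by (simp add: matrix_mul_assoc 1 matmul.diff_left)
qed

text \<open>On symmetric \<open>Z\<close> this is the orthogonal projection onto the tangent space:
  it keeps the off-diagonal blocks \<open>P ** Z ** (mat 1 - P)\<close> and
  \<open>(mat 1 - P) ** Z ** P\<close>.\<close>

definition tproj :: "real^'n^'n \<Rightarrow> real^'n^'n \<Rightarrow> real^'n^'n" where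
  "tproj P Z = P ** Z + Z ** P - (P ** (Z ** P) + P ** (Z ** P))"

lemma tproj_in_TGr:
  assumes "P \<in> Gr p" "transpose Z = Z"
  shows "tproj P Z \<in> TGr P"
  unfolding TGr_def tproj_def
  by (simp add: mat_simps transpose_simps GrD[OF assms(1)] assms(2))

lemma tproj_tangent: "P \<in> Gr p \<Longrightarrow> D \<in> TGr P \<Longrightarrow> tproj P D = D"
  unfolding tproj_def by (simp add: mat_simps GrD TGrD)

lemma linear_tproj: "linear (tproj P)"
  by (rule linearI) (simp_all add: tproj_def mat_simps scaleR_right_diff_distrib scaleR_right_distrib)

lemma bounded_linear_tproj: "bounded_linear (tproj P)"
  using linear_tproj linear_conv_bounded_linear by blast

lemma TGr_subspace:
  "0 \<in> TGr P" "x \<in> TGr P \<Longrightarrow> y \<in> TGr P \<Longrightarrow> x + y \<in> TGr P" "x \<in> TGr P \<Longrightarrow> a *\<^sub>R x \<in> TGr P"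
  "x \<in> TGr P \<Longrightarrow> - x \<in> TGr P" "x \<in> TGr P \<Longrightarrow> y \<in> TGr P \<Longrightarrow> x - y \<in> TGr P"
  by (auto simp: TGr_def mat_simps transpose_simps algebra_simps simp flip: scaleR_right_distrib)

lemma TGr_lincomb:
  "x \<in> TGr P \<Longrightarrow> y \<in> TGr P \<Longrightarrow> a *\<^sub>R x + b *\<^sub>R y \<in> TGr P"
  by (intro TGr_subspace)

section \<open>The metric as a trace form\<close>

lemma trace_mult_transpose: "trace (A ** transpose B) = A \<bullet> B" for A B :: "real^'n^'n"
  by (simp add: trace_def matrix_matrix_mult_def transpose_def inner_vec_def)

lemma trace_uminus: "trace (- A) = - trace A" for A :: "real^'n^'n"
  by (simp add: trace_def sum_negf)

lemma trace_numeral: "trace (numeral k * A) = numeral k * trace A" for A :: "real^'n^'n"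
  by (simp add: trace_def sum_distrib_left)

lemma trace_scaleR: "trace (a *\<^sub>R A) = a * trace A" for A :: "real^'n^'n"
  by (simp add: trace_def sum_distrib_left)

lemma gmetric_inner: "transpose Y = Y \<Longrightarrow> gmetric X Y = (X \<bullet> Y) / 2"
  unfolding gmetric_def using trace_mult_transpose[of X Y] by simp

text \<open>Cyclicity of the trace moves the projection to the tangent factor \<open>Z\<close>,
  whose diagonal block \<open>P ** Z ** P\<close> is zero.\<close>

lemma gmetric_tproj:
  fixes P Z M :: "real^'n^'n"
  assumes "P \<in> Gr p" "Z \<in> TGr P"
  shows "gmetric (tproj P M) Z = gmetric M Z"
proof -
  have 1: "trace (P ** (M ** Z)) = trace (M ** (Z ** P))"
    using trace_mul_sym[of P "M ** Z"] by (simp add: mat_simps)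
  have 2: "trace (P ** (M ** (P ** Z))) = trace (M ** (P ** (Z ** P)))"
    using trace_mul_sym[of P "M ** (P ** Z)"] by (simp add: mat_simps)
  have 3: "P ** (Z ** P) = 0" by (simp add: mat_simps GrD[OF assms(1)] TGrD[OF assms(2)])
  have "M ** Z = M ** (Z ** P) + M ** (P ** Z)"
    using assms(2) by (simp add: TGr_def flip: matmul.add_right)
  then have 4: "trace (M ** Z) = trace (M ** (Z ** P)) + trace (M ** (P ** Z))"
    by (simp add: trace_add)
  have 5: "trace (0 :: real^'n^'n) = 0" by (simp add: trace_def)
  show ?thesis
    unfolding gmetric_def tproj_def 4
    by (simp add: mat_simps trace_add trace_sub 1 2 3 5 trace_numeral)
qed

lemma gmetric_nondegenerate:
  assumes "D \<in> TGr P" "gmetric D D = 0"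
  shows "D = 0"
  using assms by (simp add: gmetric_inner TGrD(1))

lemma gmetric_diff_left: "gmetric (X - Y) Z = gmetric X Z - gmetric Y Z"
  by (simp add: gmetric_def mat_simps trace_sub diff_divide_distrib)

lemma gmetric_sym: "gmetric X Y = gmetric Y X"
  by (simp only: gmetric_def trace_mul_sym[of X Y])

lemma bounded_bilinear_gmetric: "bounded_bilinear (gmetric :: real^'n^'n \<Rightarrow> _)"
  unfolding bilinear_conv_bounded_bilinear[symmetric] bilinear_def gmetric_def
  by (auto intro!: linearI simp: mat_simps trace_add trace_scaleR add_divide_distrib)

section \<open>Curves of projections by orthogonal conjugation\<close>

lemma rank_conj:
  fixes E F X :: "real^'n^'n"
  assumes "E ** F = mat 1" "F ** E = mat 1"
  shows "rank (E ** (X ** F)) = rank X"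
proof (rule antisym)
  have le: "rank (A ** (B ** C)) \<le> rank B" for A B C :: "real^'n^'n"
    by (rule order_trans[OF rank_mul_le_right rank_mul_le_left])
  show "rank (E ** (X ** F)) \<le> rank X" by (rule le)
  have "X = F ** ((E ** (X ** F)) ** E)"
  proof -
    have "F ** ((E ** (X ** F)) ** E) = (F ** E) ** (X ** (F ** E))"
      by (simp only: matrix_mul_assoc)
    then show ?thesis by (simp add: assms)
  qed
  then show "rank X \<le> rank (E ** (X ** F))"
    using le[of F "E ** (X ** F)" E] by simp
qed

lemma conj_in_Gr:
  fixes E F P :: "real^'n^'n"
  assumes "E ** F = mat 1" "F ** E = mat 1" "transpose E = F" "P \<in> Gr p"
  shows "E ** (P ** F) \<in> Gr p"
proof -
  have FE: "F ** (E ** X) = X" for X using assms(2) by (simp add: matrix_mul_assoc)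
  have "transpose F = E" using assms(3) by auto
  then show ?thesis
    using GrD(4)[OF assms(4)]
    by (simp add: Gr_def transpose_simps mat_simps rank_conj assms(1,2,3) FE GrD(1-3)[OF assms(4)])
qed

definition comm :: "real^'n^'n \<Rightarrow> real^'n^'n \<Rightarrow> real^'n^'n" where
  "comm A B = A ** B - B ** A"

lemma transpose_comm: "P \<in> Gr p \<Longrightarrow> D \<in> TGr P \<Longrightarrow> transpose (comm D P) = - comm D P"
  by (simp add: comm_def transpose_simps GrD(1) TGrD(1))

text \<open>Bracketing with \<open>P\<close> changes the sign of one off-diagonal block, so doing it
  twice restores a tangent matrix. Hence conjugation generated by \<open>comm D P\<close> moves
  \<open>P\<close> with velocity \<open>D\<close>.\<close>

lemma comm_comm_tangent: "P \<in> Gr p \<Longrightarrow> D \<in> TGr P \<Longrightarrow> comm (comm D P) P = D"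
  unfolding comm_def by (simp add: mat_simps GrD TGrD)

definition geo :: "real^'n^'n \<Rightarrow> real^'n^'n \<Rightarrow> real \<Rightarrow> real^'n^'n" where
  "geo P D t = mexp (t *\<^sub>R comm D P) ** (P ** mexp (- (t *\<^sub>R comm D P)))"

lemma geo_in_Gr:
  assumes "P \<in> Gr p" "D \<in> TGr P"
  shows "geo P D t \<in> Gr p"
  unfolding geo_def
  by (rule conj_in_Gr)
    (simp_all add: mexp_inverse transpose_mexp transpose_simps transpose_comm[OF assms] assms)

lemma geo_0: "geo P D 0 = P"
  by (simp add: geo_def mexp_0)

text \<open>\<open>A\<close> commutes with its exponentials, so the derivatives of both outer
  factors collect into one bracket inside the conjugation.\<close>

lemma has_vector_derivative_conj_mexp:
  assumes "(k has_vector_derivative k') (at t)"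
  shows "((\<lambda>t. mexp (t *\<^sub>R A) ** (k t ** mexp (- (t *\<^sub>R A)))) has_vector_derivative
    mexp (t *\<^sub>R A) ** ((k' + comm A (k t)) ** mexp (- (t *\<^sub>R A)))) (at t)"
proof (rule has_vector_derivative_eq_rhs[OF has_vector_derivative_matmul[OF has_vector_derivative_mexp
    has_vector_derivative_matmul[OF assms has_vector_derivative_mexp_minus]]])
  have 1: "A ** mexp (t *\<^sub>R A) = mexp (t *\<^sub>R A) ** A" "mexp (- (t *\<^sub>R A)) ** A = A ** mexp (- (t *\<^sub>R A))"
    by (rule mexp_commute mexp_commute[symmetric]; simp add: mat_simps)+
  have "A ** mexp (t *\<^sub>R A) ** X = mexp (t *\<^sub>R A) ** (A ** X)" for X
    using 1 by (simp add: matrix_mul_assoc)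
  then show "mexp (t *\<^sub>R A) ** (k t ** - (mexp (- (t *\<^sub>R A)) ** A) + k' ** mexp (- (t *\<^sub>R A))) +
      A ** mexp (t *\<^sub>R A) ** (k t ** mexp (- (t *\<^sub>R A))) =
      mexp (t *\<^sub>R A) ** ((k' + comm A (k t)) ** mexp (- (t *\<^sub>R A)))"
    using 1 by (simp add: mat_simps comm_def)
qed

lemma has_vector_derivative_geo:
  "(geo P D has_vector_derivative
    mexp (t *\<^sub>R comm D P) ** (comm (comm D P) P ** mexp (- (t *\<^sub>R comm D P)))) (at t)"
  using has_vector_derivative_conj_mexp[of "\<lambda>_. P" 0 t "comm D P"]
  by (simp add: geo_def[abs_def])

lemma has_vector_derivative_geo_0:
  assumes "P \<in> Gr p" "D \<in> TGr P"
  shows "(geo P D has_vector_derivative D) (at 0)"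
  using has_vector_derivative_geo[of P D 0] by (simp add: mexp_0 comm_comm_tangent[OF assms])

section \<open>Derivatives along curves in the Grassmannian\<close>

lemma curve_tangent:
  assumes c: "\<And>t. c t \<in> Gr p" and d: "(c has_vector_derivative v) (at t)"
  shows "v \<in> TGr (c t)"
proof -
  have "((\<lambda>t. c t ** c t) has_vector_derivative c t ** v + v ** c t) (at t)"
    by (rule has_vector_derivative_matmul[OF d d])
  moreover have "(\<lambda>t. c t ** c t) = c" by (simp add: GrD(2)[OF c])
  ultimately have 1: "c t ** v + v ** c t = v" using d vector_derivative_unique_at by metis
  have "((\<lambda>t. transpose (c t)) has_vector_derivative transpose v) (at t)"
    by (rule bounded_linear.has_vector_derivative[OF bounded_linear_transpose d])
  moreover have "(\<lambda>t. transpose (c t)) = c" by (simp add: GrD(1)[OF c])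
  ultimately have "transpose v = v" using d vector_derivative_unique_at by metis
  then show ?thesis using 1 by (simp add: TGr_def add.commute)
qed

text \<open>Values of \<open>f\<close> off the manifold are arbitrary, but the curve stays in
  \<open>Gr p\<close> and, by continuity, in \<open>W\<close> for times near \<open>t\<close>; there
  \<open>f\<close> may be replaced by \<open>F\<close>.\<close>

lemma extension_has_vector_derivative:
  assumes F: "smooth_on W F" "c t \<in> W" "\<And>A. A \<in> W \<inter> Gr p \<Longrightarrow> F A = f A"
    and c: "\<And>t. c t \<in> Gr p" and d: "(c has_vector_derivative v) (at t)"
  shows "((\<lambda>t. f (c t)) has_vector_derivative frechet_derivative F (at (c t)) v) (at t)"
proof -
  have "((\<lambda>u. F (c u)) has_derivative (\<lambda>u. frechet_derivative F (at (c t)) (u *\<^sub>R v))) (at t)"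
    using d unfolding has_vector_derivative_def
    by (rule has_derivative_compose) (rule smooth_on_has_derivative[OF F(1,2)])
  moreover have "\<forall>\<^sub>F u in at t. F (c u) = f (c u)"
  proof -
    have "(c \<longlongrightarrow> c t) (at t)"
      using has_vector_derivative_continuous[OF d] by (simp add: continuous_within)
    then have "\<forall>\<^sub>F u in at t. c u \<in> W"
      by (rule topological_tendstoD) (use F smooth_on_open in auto)
    then show ?thesis by eventually_elim (use F c in auto)
  qed
  ultimately have "((\<lambda>u. f (c u)) has_derivative (\<lambda>u. frechet_derivative F (at (c t)) (u *\<^sub>R v))) (at t)"
    by (rule has_derivative_transform_eventually) (use F c in auto)
  then show ?thesis
    unfolding has_vector_derivative_def
    using linear_scale[OF smooth_on_linear_frechet[OF F(1,2)]] by simp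
qed

text \<open>The definite description needs a curve with the given velocity, as otherwise every value
  would satisfy it. \<open>geo P v\<close> is one, and it makes the value unique.\<close>

lemma dir_deriv_eqI:
  assumes P: "P \<in> Gr p" "v \<in> TGr P"
    and d: "\<And>c. \<lbrakk>\<And>t. c t \<in> Gr p; c 0 = P; (c has_vector_derivative v) (at 0)\<rbrakk> \<Longrightarrow>
      ((\<lambda>t. f (c t)) has_vector_derivative d) (at 0)"
  shows "dir_deriv p f P v = d"
  unfolding dir_deriv_def
proof (rule the_equality)
  show "\<forall>c. (\<forall>t. c t \<in> Gr p) \<and> c 0 = P \<and> (c has_vector_derivative v) (at 0) \<longrightarrow>
      ((\<lambda>t. f (c t)) has_vector_derivative d) (at 0)"
    using d by blast
  fix d' assume "\<forall>c. (\<forall>t. c t \<in> Gr p) \<and> c 0 = P \<and> (c has_vector_derivative v) (at 0) \<longrightarrow>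
      ((\<lambda>t. f (c t)) has_vector_derivative d') (at 0)"
  then have "((\<lambda>t. f (geo P v t)) has_vector_derivative d') (at 0)"
    using geo_in_Gr[OF P] geo_0 has_vector_derivative_geo_0[OF P] by blast
  moreover have "((\<lambda>t. f (geo P v t)) has_vector_derivative d) (at 0)"
    by (rule d) (use geo_in_Gr[OF P] geo_0 has_vector_derivative_geo_0[OF P] in auto)
  ultimately show "d' = d" using vector_derivative_unique_at by blast
qed

lemma dir_deriv_extension:
  assumes "P \<in> Gr p" "v \<in> TGr P" "smooth_on W F" "P \<in> W" "\<And>A. A \<in> W \<inter> Gr p \<Longrightarrow> F A = f A"
  shows "dir_deriv p f P v = frechet_derivative F (at P) v"
proof (rule dir_deriv_eqI[OF assms(1,2)])
  fix c assume c: "\<And>t. c t \<in> Gr p" "c 0 = P" "(c has_vector_derivative v) (at 0)"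
  show "((\<lambda>t. f (c t)) has_vector_derivative frechet_derivative F (at P) v) (at 0)"
    using extension_has_vector_derivative[OF assms(3) _ assms(5) c(1,3)] assms(4) c(2) by simp
qed

lemma smooth_on_GrE:
  assumes "smooth_on_Gr p f" "P \<in> Gr p"
  obtains W F where "P \<in> W" "smooth_on W F" "\<And>A. A \<in> W \<inter> Gr p \<Longrightarrow> F A = f A"
proof -
  obtain W F where "P \<in> W" "smooth_on W F" "\<forall>P'\<in>W \<inter> Gr p. F P' = f P'"
    using bspec[OF assms(1)[unfolded smooth_on_Gr_def] assms(2)] by auto
  then show ?thesis by (intro that[of W F]) auto
qed

lemma has_dir_deriv:
  assumes f: "smooth_on_Gr p f" and c: "\<And>t. c t \<in> Gr p" and d: "(c has_vector_derivative v) (at t)"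
  shows "((\<lambda>t. f (c t)) has_vector_derivative dir_deriv p f (c t) v) (at t)"
proof -
  obtain W F where F: "c t \<in> W" "smooth_on W F" "\<And>A. A \<in> W \<inter> Gr p \<Longrightarrow> F A = f A"
    using smooth_on_GrE[OF f c] by metis
  show ?thesis
    using extension_has_vector_derivative[OF F(2,1,3) c d]
      dir_deriv_extension[OF c curve_tangent[OF c d] F(2,1,3)] by simp
qed

lemma linear_dir_deriv:
  assumes f: "smooth_on_Gr p f" and P: "P \<in> Gr p" "v \<in> TGr P" "w \<in> TGr P"
  shows "dir_deriv p f P (a *\<^sub>R v + b *\<^sub>R w) = a *\<^sub>R dir_deriv p f P v + b *\<^sub>R dir_deriv p f P w"
proof -
  obtain W F where F: "P \<in> W" "smooth_on W F" "\<And>A. A \<in> W \<inter> Gr p \<Longrightarrow> F A = f A"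
    using smooth_on_GrE[OF f P(1)] by metis
  have e: "dir_deriv p f P u = frechet_derivative F (at P) u" if "u \<in> TGr P" for u
    by (rule dir_deriv_extension[OF P(1) that F(2,1,3)])
  show ?thesis
    using smooth_on_linear_frechet[OF F(2,1)]
    by (simp add: e[OF TGr_lincomb[OF P(2,3)]] e[OF P(2)] e[OF P(3)] linear_add linear_scale)
qed

section \<open>Smooth maps and vector fields on the Grassmannian\<close>

lemma smooth_on_Gr_cong:
  "smooth_on_Gr p f \<Longrightarrow> (\<And>A. A \<in> Gr p \<Longrightarrow> f A = g A) \<Longrightarrow> smooth_on_Gr p g"
  unfolding smooth_on_Gr_def by (metis IntD2)

lemma smooth_on_Gr_global: "smooth_on UNIV f \<Longrightarrow> smooth_on_Gr p f"
  unfolding smooth_on_Gr_def by blast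

lemma smooth_on_Gr_bilinear:
  fixes f g :: "real^'n^'n \<Rightarrow> _"
  assumes h: "bounded_bilinear h" and f: "smooth_on_Gr p f" and g: "smooth_on_Gr p g"
  shows "smooth_on_Gr p (\<lambda>A. h (f A) (g A))"
  unfolding smooth_on_Gr_def
proof
  fix P :: "real^'n^'n" assume P: "P \<in> Gr p"
  obtain W F where F: "P \<in> W" "smooth_on W F" "\<And>A. A \<in> W \<inter> Gr p \<Longrightarrow> F A = f A"
    using smooth_on_GrE[OF f P] by metis
  obtain W' G where G: "P \<in> W'" "smooth_on W' G" "\<And>A. A \<in> W' \<inter> Gr p \<Longrightarrow> G A = g A"
    using smooth_on_GrE[OF g P] by metis
  have o: "open (W \<inter> W')" by (rule open_Int[OF smooth_on_open[OF F(2)] smooth_on_open[OF G(2)]])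
  have "smooth_on (W \<inter> W') (\<lambda>A. h (F A) (G A))"
    by (intro smooth_on_bilinear[OF h] smooth_on_subset[OF F(2) o] smooth_on_subset[OF G(2) o]) auto
  then show "\<exists>W F. P \<in> W \<and> smooth_on W F \<and> (\<forall>P'\<in>W \<inter> Gr p. F P' = h (f P') (g P'))"
    using F G by (intro exI[of _ "W \<inter> W'"] exI[of _ "\<lambda>A. h (F A) (G A)"]) auto
qed

lemma smooth_on_Gr_const: "smooth_on_Gr p (\<lambda>_. c)"
  by (rule smooth_on_Gr_global[OF smooth_on_const[OF open_UNIV]])

lemma smooth_on_Gr_ident: "smooth_on_Gr p (\<lambda>A. A)"
  by (rule smooth_on_Gr_global[OF smooth_on_ident[OF open_UNIV]])

lemma smooth_on_Gr_lincomb: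
  fixes f g :: "real^'n^'n \<Rightarrow> _"
  assumes f: "smooth_on_Gr p f" and g: "smooth_on_Gr p g"
  shows "smooth_on_Gr p (\<lambda>A. a *\<^sub>R f A + b *\<^sub>R g A)"
  unfolding smooth_on_Gr_def
proof
  fix P :: "real^'n^'n" assume P: "P \<in> Gr p"
  obtain W F where F: "P \<in> W" "smooth_on W F" "\<And>A. A \<in> W \<inter> Gr p \<Longrightarrow> F A = f A"
    using smooth_on_GrE[OF f P] by metis
  obtain W' G where G: "P \<in> W'" "smooth_on W' G" "\<And>A. A \<in> W' \<inter> Gr p \<Longrightarrow> G A = g A"
    using smooth_on_GrE[OF g P] by metis
  have o: "open (W \<inter> W')" by (rule open_Int[OF smooth_on_open[OF F(2)] smooth_on_open[OF G(2)]])
  have "smooth_on (W \<inter> W') (\<lambda>A. a *\<^sub>R F A + b *\<^sub>R G A)"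
    by (intro smooth_on_add smooth_on_scaleR_const smooth_on_subset[OF F(2) o] smooth_on_subset[OF G(2) o]) auto
  then show "\<exists>W F. P \<in> W \<and> smooth_on W F \<and> (\<forall>P'\<in>W \<inter> Gr p. F P' = a *\<^sub>R f P' + b *\<^sub>R g P')"
    using F G by (intro exI[of _ "W \<inter> W'"] exI[of _ "\<lambda>A. a *\<^sub>R F A + b *\<^sub>R G A"]) auto
qed

lemma smooth_on_Gr_add: "smooth_on_Gr p f \<Longrightarrow> smooth_on_Gr p g \<Longrightarrow> smooth_on_Gr p (\<lambda>A. f A + g A)"
  using smooth_on_Gr_lincomb[of p f g 1 1] by simp

lemma smooth_on_Gr_diff: "smooth_on_Gr p f \<Longrightarrow> smooth_on_Gr p g \<Longrightarrow> smooth_on_Gr p (\<lambda>A. f A - g A)"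
  using smooth_on_Gr_lincomb[of p f g 1 "-1"] by simp

lemma smooth_on_Gr_tproj: "smooth_on_Gr p f \<Longrightarrow> smooth_on_Gr p (\<lambda>A. tproj A (f A))"
  unfolding tproj_def
  by (intro smooth_on_Gr_diff smooth_on_Gr_add smooth_on_Gr_bilinear[OF bounded_bilinear_matrix_mult] smooth_on_Gr_ident)

lemma smooth_on_tproj: "smooth_on S f \<Longrightarrow> smooth_on S g \<Longrightarrow> smooth_on S (\<lambda>x. tproj (f x) (g x))"
  unfolding tproj_def
  by (intro smooth_on_diff smooth_on_add smooth_on_bilinear[OF bounded_bilinear_matrix_mult])

lemma vfieldD: "vfield p X \<Longrightarrow> smooth_on_Gr p X" "vfield p X \<Longrightarrow> P \<in> Gr p \<Longrightarrow> X P \<in> TGr P"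
  by (auto simp: vfield_def)

lemma smooth_on_Gr_dir_deriv:
  fixes f :: "real^'n^'n \<Rightarrow> 'b::euclidean_space"
  assumes f: "smooth_on_Gr p f" and X: "vfield p X"
  shows "smooth_on_Gr p (\<lambda>A. dir_deriv p f A (X A))"
  unfolding smooth_on_Gr_def
proof
  fix P :: "real^'n^'n" assume P: "P \<in> Gr p"
  obtain W F where F: "P \<in> W" "smooth_on W F" "\<And>A. A \<in> W \<inter> Gr p \<Longrightarrow> F A = f A"
    using smooth_on_GrE[OF f P] by metis
  obtain W' G where G: "P \<in> W'" "smooth_on W' G" "\<And>A. A \<in> W' \<inter> Gr p \<Longrightarrow> G A = X A"
    using smooth_on_GrE[OF vfieldD(1)[OF X] P] by metis
  have o: "open (W \<inter> W')" by (rule open_Int[OF smooth_on_open[OF F(2)] smooth_on_open[OF G(2)]])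
  have "smooth_on (W \<inter> W') (\<lambda>A. frechet_derivative F (at A) (G A))"
    by (intro smooth_on_frechet_apply smooth_on_subset[OF F(2) o] smooth_on_subset[OF G(2) o]) auto
  moreover have "frechet_derivative F (at A) (G A) = dir_deriv p f A (X A)" if "A \<in> (W \<inter> W') \<inter> Gr p" for A
    using dir_deriv_extension[OF _ vfieldD(2)[OF X] F(2) _ F(3)] G(3) that by auto
  ultimately show "\<exists>W F. P \<in> W \<and> smooth_on W F \<and> (\<forall>P'\<in>W \<inter> Gr p. F P' = dir_deriv p f P' (X P'))"
    using F(1) G(1) by (intro exI[of _ "W \<inter> W'"] exI[of _ "\<lambda>A. frechet_derivative F (at A) (G A)"]) auto
qed

text \<open>Extends tangent vectors: if \<open>x\<close> is tangent at \<open>P\<close>, the field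
  takes the value \<open>x\<close> there.\<close>

lemma vfield_const_proj:
  assumes "transpose x = x"
  shows "vfield p (\<lambda>A. tproj A x)"
  using assms tproj_in_TGr by (auto simp: vfield_def intro: smooth_on_Gr_tproj smooth_on_Gr_const)

section \<open>Levi-Civita connection and curvature\<close>

text \<open>The derivative of \<open>tproj P M\<close> with respect to \<open>P\<close> in the
  direction \<open>v\<close>, with \<open>M\<close> kept fixed.\<close>

definition dproj :: "real^'n^'n \<Rightarrow> real^'n^'n \<Rightarrow> real^'n^'n \<Rightarrow> real^'n^'n" where
  "dproj P v M = v ** M + M ** v - ((v ** (M ** P) + P ** (M ** v)) + (v ** (M ** P) + P ** (M ** v)))"

text \<open>For tangent \<open>v\<close> and \<open>w\<close> this is the second fundamental form of
  the Grassmannian inside the symmetric matrices.\<close>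

definition second_form :: "real^'n^'n \<Rightarrow> real^'n^'n \<Rightarrow> real^'n^'n \<Rightarrow> real^'n^'n" where
  "second_form P v w = (v ** w + w ** v) - ((v ** w + w ** v) ** P + (v ** w + w ** v) ** P)"

lemma second_form_sym: "second_form P v w = second_form P w v"
  by (simp add: second_form_def add.commute)

lemma dproj_tangent:
  assumes "P \<in> Gr p" "v \<in> TGr P" "w \<in> TGr P"
  shows "dproj P v w = second_form P v w"
  unfolding dproj_def second_form_def
  by (simp add: mat_simps GrD[OF assms(1)] TGrD[OF assms(2)] TGrD[OF assms(3)])

lemma tproj_dproj_tangent:
  assumes "P \<in> Gr p" "v \<in> TGr P" "w \<in> TGr P"
  shows "tproj P (dproj P v w) = 0"
  unfolding dproj_def tproj_def
  by (simp add: mat_simps GrD[OF assms(1)] TGrD[OF assms(2)] TGrD[OF assms(3)])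

text \<open>The Weingarten map of the normal matrix \<open>second_form P y z\<close>, applied to
  \<open>x\<close>: differentiating \<open>tproj P N = 0\<close> for a normal field \<open>N\<close>
  shows that the left-hand side is minus the tangential part of the derivative of
  \<open>N\<close>.\<close>

lemma tproj_dproj_second_form:
  assumes "P \<in> Gr p" "x \<in> TGr P" "y \<in> TGr P" "z \<in> TGr P"
  shows "tproj P (dproj P x (second_form P y z)) = x ** (y ** z + z ** y) + (y ** z + z ** y) ** x"
  unfolding dproj_def tproj_def second_form_def
  by (simp add: mat_simps GrD[OF assms(1)] TGrD[OF assms(2)] TGrD[OF assms(3)] TGrD[OF assms(4)])

lemma tproj_idem: "P \<in> Gr p \<Longrightarrow> tproj P (tproj P M) = tproj P M"
  unfolding tproj_def by (simp add: mat_simps GrD)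

lemma dproj_add: "dproj P v (M + N) = dproj P v M + dproj P v N"
  by (simp add: dproj_def mat_simps)

lemma has_vector_derivative_tproj:
  assumes c: "(c has_vector_derivative v) (at t)" and g: "(g has_vector_derivative d) (at t)"
  shows "((\<lambda>t. tproj (c t) (g t)) has_vector_derivative (tproj (c t) d + dproj (c t) v (g t))) (at t)"
  unfolding tproj_def
  by (rule has_vector_derivative_eq_rhs[OF has_vector_derivative_diff[OF
        has_vector_derivative_add[OF has_vector_derivative_matmul[OF c g] has_vector_derivative_matmul[OF g c]]
        has_vector_derivative_add[OF has_vector_derivative_matmul[OF c has_vector_derivative_matmul[OF g c]]
          has_vector_derivative_matmul[OF c has_vector_derivative_matmul[OF g c]]]]])
    (simp add: dproj_def mat_simps)

lemma dir_deriv_curve: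
  assumes "smooth_on_Gr p f" "P \<in> Gr p" "v \<in> TGr P"
  shows "((\<lambda>t. f (geo P v t)) has_vector_derivative dir_deriv p f P v) (at 0)"
  using has_dir_deriv[OF assms(1) geo_in_Gr[OF assms(2,3)] has_vector_derivative_geo_0[OF assms(2,3)]]
  by (simp add: geo_0)

text \<open>The Gauss formula: \<open>Y\<close> equals its own projection along
  \<open>geo P v\<close>, and differentiating the moving projection produces the normal
  part.\<close>

lemma dir_deriv_vfield:
  assumes Y: "vfield p Y" and P: "P \<in> Gr p" and v: "v \<in> TGr P"
  shows "dir_deriv p Y P v = tproj P (dir_deriv p Y P v) + second_form P v (Y P)"
    and "transpose (dir_deriv p Y P v) = dir_deriv p Y P v"
proof -
  let ?c = "geo P v" and ?d = "dir_deriv p Y P v"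
  note cGr = geo_in_Gr[OF P v]
  have d: "((\<lambda>t. Y (?c t)) has_vector_derivative ?d) (at 0)"
    by (rule dir_deriv_curve[OF vfieldD(1)[OF Y] P v])
  have tan: "Y (?c t) \<in> TGr (?c t)" for t using vfieldD(2)[OF Y cGr] .
  have "((\<lambda>t. tproj (?c t) (Y (?c t))) has_vector_derivative tproj P ?d + dproj P v (Y P)) (at 0)"
    using has_vector_derivative_tproj[OF has_vector_derivative_geo_0[OF P v] d] by (simp add: geo_0)
  then have "((\<lambda>t. Y (?c t)) has_vector_derivative tproj P ?d + second_form P v (Y P)) (at 0)"
    using dproj_tangent[OF P v vfieldD(2)[OF Y P]] by (simp add: tproj_tangent[OF cGr tan])
  then show "?d = tproj P ?d + second_form P v (Y P)"
    using d vector_derivative_unique_at by blast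
  have "((\<lambda>t. transpose (Y (?c t))) has_vector_derivative transpose ?d) (at 0)"
    by (rule bounded_linear.has_vector_derivative[OF bounded_linear_transpose d])
  then have "((\<lambda>t. Y (?c t)) has_vector_derivative transpose ?d) (at 0)"
    by (simp add: TGrD(1)[OF tan])
  then show "transpose ?d = ?d"
    using d vector_derivative_unique_at by blast
qed

section \<open>The Levi-Civita connection\<close>

definition lc_connection :: "nat \<Rightarrow> 'n::finite connection" where
  "lc_connection p X Y P = tproj P (dir_deriv p Y P (X P))"

lemma lc_connection_tangent: "vfield p X \<Longrightarrow> vfield p Y \<Longrightarrow> P \<in> Gr p \<Longrightarrow> lc_connection p X Y P \<in> TGr P"
  unfolding lc_connection_def by (intro tproj_in_TGr dir_deriv_vfield(2) vfieldD(2))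

lemma vfield_lc_connection:
  assumes "vfield p X" "vfield p Y"
  shows "vfield p (lc_connection p X Y)"
proof -
  have "smooth_on_Gr p (\<lambda>P. tproj P (dir_deriv p Y P (X P)))"
    by (intro smooth_on_Gr_tproj smooth_on_Gr_dir_deriv vfieldD(1) assms)
  then show ?thesis
    using lc_connection_tangent[OF assms] unfolding vfield_def lc_connection_def[abs_def] by blast
qed

text \<open>The normal parts in the Gauss formula cancel by symmetry of the second fundamental form.
  Besides freeness of torsion this yields tangency and smoothness of the bracket.\<close>

lemma lie_bracket_lc_connection:
  assumes "vfield p X" "vfield p Y" "P \<in> Gr p"
  shows "lie_bracket p X Y P = lc_connection p X Y P - lc_connection p Y X P"
proof -
  note x = vfieldD(2)[OF assms(1,3)] and y = vfieldD(2)[OF assms(2,3)]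
  have "lie_bracket p X Y P = (tproj P (dir_deriv p Y P (X P)) + second_form P (X P) (Y P))
      - (tproj P (dir_deriv p X P (Y P)) + second_form P (Y P) (X P))"
    unfolding lie_bracket_def
    using dir_deriv_vfield(1)[OF assms(2,3) x] dir_deriv_vfield(1)[OF assms(1,3) y] by simp
  then show ?thesis by (simp add: lc_connection_def second_form_sym)
qed

lemma vfield_diff: "vfield p X \<Longrightarrow> vfield p Y \<Longrightarrow> vfield p (\<lambda>A. X A - Y A)"
  by (simp add: vfield_def smooth_on_Gr_diff TGr_subspace)

lemma vfield_cong: "vfield p X \<Longrightarrow> (\<And>A. A \<in> Gr p \<Longrightarrow> X A = Y A) \<Longrightarrow> vfield p Y"
  using smooth_on_Gr_cong[of p X Y] by (simp add: vfield_def)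

lemma vfield_lie_bracket:
  assumes "vfield p X" "vfield p Y"
  shows "vfield p (lie_bracket p X Y)"
  by (rule vfield_cong[OF vfield_diff[OF vfield_lc_connection[OF assms] vfield_lc_connection[OF assms(2,1)]]])
    (simp add: lie_bracket_lc_connection assms)

text \<open>The witness behind the choice in \<open>nabla\<close>. Compatibility with the metric is
  the product rule, since the normal part of a derivative is invisible when paired with a tangent
  vector.\<close>

lemma is_levi_civita_lc_connection: "is_levi_civita p (lc_connection p)"
  unfolding is_levi_civita_def affine_connection_def
proof (intro conjI allI impI ballI; elim conjE)
  fix X Y :: "real^'a^'a \<Rightarrow> real^'a^'a" assume X: "vfield p X" and Y: "vfield p Y"
  then show "vfield p (lc_connection p X Y)" by (rule vfield_lc_connection)
next
  fix X X' Y :: "real^'a^'a \<Rightarrow> real^'a^'a" and f f' :: "real^'a^'a \<Rightarrow> real" and P :: "real^'a^'a"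
  assume X: "vfield p X" "vfield p X'" and Y: "vfield p Y" and P: "P \<in> Gr p"
  show "lc_connection p (\<lambda>A. f A *\<^sub>R X A + f' A *\<^sub>R X' A) Y P = f P *\<^sub>R lc_connection p X Y P + f' P *\<^sub>R lc_connection p X' Y P"
    unfolding lc_connection_def
    by (simp add: linear_dir_deriv[OF vfieldD(1)[OF Y] P vfieldD(2)[OF X(1) P] vfieldD(2)[OF X(2) P]]
        linear_add[OF linear_tproj] linear_scale[OF linear_tproj])
next
  fix X Y Y' :: "real^'a^'a \<Rightarrow> real^'a^'a" and a b :: real and P :: "real^'a^'a"
  assume X: "vfield p X" and Y: "vfield p Y" "vfield p Y'" and P: "P \<in> Gr p"
  have "dir_deriv p (\<lambda>A. a *\<^sub>R Y A + b *\<^sub>R Y' A) P (X P) =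
      a *\<^sub>R dir_deriv p Y P (X P) + b *\<^sub>R dir_deriv p Y' P (X P)"
  proof (rule dir_deriv_eqI[OF P vfieldD(2)[OF X P]])
    fix c assume c: "\<And>t. c t \<in> Gr p" "c 0 = P" "(c has_vector_derivative X P) (at 0)"
    show "((\<lambda>t. a *\<^sub>R Y (c t) + b *\<^sub>R Y' (c t)) has_vector_derivative
        a *\<^sub>R dir_deriv p Y P (X P) + b *\<^sub>R dir_deriv p Y' P (X P)) (at 0)"
      using has_dir_deriv[OF vfieldD(1)[OF Y(1)] c(1,3)] has_dir_deriv[OF vfieldD(1)[OF Y(2)] c(1,3)]
      unfolding c(2)
      by (intro has_vector_derivative_add bounded_linear.has_vector_derivative[OF bounded_linear_scaleR_right])
  qed
  then show "lc_connection p X (\<lambda>A. a *\<^sub>R Y A + b *\<^sub>R Y' A) P = a *\<^sub>R lc_connection p X Y P + b *\<^sub>R lc_connection p X Y' P"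
    unfolding lc_connection_def by (simp add: linear_add[OF linear_tproj] linear_scale[OF linear_tproj])
next
  fix X Y :: "real^'a^'a \<Rightarrow> real^'a^'a" and f :: "real^'a^'a \<Rightarrow> real" and P :: "real^'a^'a"
  assume X: "vfield p X" and Y: "vfield p Y" and f: "smooth_on_Gr p f" and P: "P \<in> Gr p"
  have "dir_deriv p (\<lambda>A. f A *\<^sub>R Y A) P (X P) =
      f P *\<^sub>R dir_deriv p Y P (X P) + dir_deriv p f P (X P) *\<^sub>R Y P"
  proof (rule dir_deriv_eqI[OF P vfieldD(2)[OF X P]])
    fix c assume c: "\<And>t. c t \<in> Gr p" "c 0 = P" "(c has_vector_derivative X P) (at 0)"
    show "((\<lambda>t. f (c t) *\<^sub>R Y (c t)) has_vector_derivative
        f P *\<^sub>R dir_deriv p Y P (X P) + dir_deriv p f P (X P) *\<^sub>R Y P) (at 0)"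
      using bounded_bilinear.has_vector_derivative[OF bounded_bilinear_scaleR
          has_dir_deriv[OF f c(1,3)] has_dir_deriv[OF vfieldD(1)[OF Y] c(1,3)]]
      by (simp add: c(2))
  qed
  then show "lc_connection p X (\<lambda>A. f A *\<^sub>R Y A) P = f P *\<^sub>R lc_connection p X Y P + dir_deriv p f P (X P) *\<^sub>R Y P"
    unfolding lc_connection_def
    by (simp add: linear_add[OF linear_tproj] linear_scale[OF linear_tproj]
        tproj_tangent[OF P vfieldD(2)[OF Y P]])
next
  fix X Y :: "real^'a^'a \<Rightarrow> real^'a^'a" and P :: "real^'a^'a"
  assume "vfield p X" "vfield p Y" "P \<in> Gr p"
  then show "lc_connection p X Y P - lc_connection p Y X P = lie_bracket p X Y P" by (simp add: lie_bracket_lc_connection)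
next
  fix X Y Z :: "real^'a^'a \<Rightarrow> real^'a^'a" and P :: "real^'a^'a"
  assume X: "vfield p X" and Y: "vfield p Y" and Z: "vfield p Z" and P: "P \<in> Gr p"
  have "dir_deriv p (\<lambda>A. gmetric (Y A) (Z A)) P (X P) =
      gmetric (Y P) (dir_deriv p Z P (X P)) + gmetric (dir_deriv p Y P (X P)) (Z P)"
  proof (rule dir_deriv_eqI[OF P vfieldD(2)[OF X P]])
    fix c assume c: "\<And>t. c t \<in> Gr p" "c 0 = P" "(c has_vector_derivative X P) (at 0)"
    show "((\<lambda>t. gmetric (Y (c t)) (Z (c t))) has_vector_derivative
        gmetric (Y P) (dir_deriv p Z P (X P)) + gmetric (dir_deriv p Y P (X P)) (Z P)) (at 0)"
      using bounded_bilinear.has_vector_derivative[OF bounded_bilinear_gmetric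
          has_dir_deriv[OF vfieldD(1)[OF Y] c(1,3)] has_dir_deriv[OF vfieldD(1)[OF Z] c(1,3)]]
      by (simp add: c(2))
  qed
  then show "dir_deriv p (\<lambda>A. gmetric (Y A) (Z A)) P (X P) =
      gmetric (lc_connection p X Y P) (Z P) + gmetric (Y P) (lc_connection p X Z P)"
    using gmetric_tproj[OF P vfieldD(2)[OF Z P], of "dir_deriv p Y P (X P)"]
      gmetric_tproj[OF P vfieldD(2)[OF Y P], of "dir_deriv p Z P (X P)"]
      gmetric_sym[of "Y P"]
    by (simp add: lc_connection_def)
qed

text \<open>The difference \<open>S\<close> of two such connections is symmetric by freeness of
  torsion, while its pairing with a third field is skew by compatibility with the metric.\<close>

lemma levi_civita_unique:
  fixes D D' :: "'n::finite connection"
  assumes D: "is_levi_civita p D" and D': "is_levi_civita p D'"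
    and X: "vfield p X" and Y: "vfield p Y" and P: "P \<in> Gr p"
  shows "D X Y P = D' X Y P"
proof -
  define S where "S X Y = D X Y P - D' X Y P" for X Y
  have sym: "S X Y = S Y X" if "vfield p X" "vfield p Y" for X Y
  proof -
    have "D X Y P - D Y X P = D' X Y P - D' Y X P"
      using D D' that P by (simp add: is_levi_civita_def)
    then show ?thesis by (simp add: S_def algebra_simps)
  qed
  have skew: "gmetric (S X Y) (Z P) = - gmetric (S X Z) (Y P)" if "vfield p X" "vfield p Y" "vfield p Z" for X Y Z
  proof -
    have "gmetric (D X Y P) (Z P) + gmetric (Y P) (D X Z P) = gmetric (D' X Y P) (Z P) + gmetric (Y P) (D' X Z P)"
    proof -
      have "dir_deriv p (\<lambda>A. gmetric (Y A) (Z A)) P (X P) = gmetric (D X Y P) (Z P) + gmetric (Y P) (D X Z P)"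
        using D that P by (simp add: is_levi_civita_def)
      moreover have "dir_deriv p (\<lambda>A. gmetric (Y A) (Z A)) P (X P) = gmetric (D' X Y P) (Z P) + gmetric (Y P) (D' X Z P)"
        using D' that P by (simp add: is_levi_civita_def)
      ultimately show ?thesis by simp
    qed
    then show ?thesis
      by (simp add: S_def gmetric_diff_left gmetric_sym[of "Y P"])
  qed
  \<comment> \<open>Symmetry in the first two slots and skewness in the last two force zero: a
    passage through the cyclic permutations returns the expression with the opposite sign.\<close>
  have zero: "gmetric (S X Y) (Z P) = 0" if "vfield p X" "vfield p Y" "vfield p Z" for X Y Z
    using skew[OF that] skew[OF that(3,1,2)] skew[OF that(2,3,1)]
    unfolding sym[OF that(3,1)] sym[OF that(3,2)] sym[OF that(2,1)] by linarith
  have tan: "S X Y \<in> TGr P"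
    using D D' X Y P unfolding S_def is_levi_civita_def affine_connection_def
    by (intro TGr_subspace vfieldD(2)) auto
  \<comment> \<open>The vector \<open>S X Y\<close> is itself extended to a field and used as the
    test vector.\<close>
  have "gmetric (S X Y) (S X Y) = 0"
    using zero[OF X Y vfield_const_proj[OF TGrD(1)[OF tan]]] tproj_tangent[OF P tan] by simp
  then have "S X Y = 0" by (rule gmetric_nondegenerate[OF tan])
  then show ?thesis by (simp add: S_def)
qed

lemma is_levi_civita_nabla: "is_levi_civita p (nabla p)"
  unfolding nabla_def by (rule someI[of "is_levi_civita p", OF is_levi_civita_lc_connection])

lemma nabla_eq_lc_connection: "vfield p X \<Longrightarrow> vfield p Y \<Longrightarrow> P \<in> Gr p \<Longrightarrow> nabla p X Y P = lc_connection p X Y P"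
  by (rule levi_civita_unique[OF is_levi_civita_nabla is_levi_civita_lc_connection])

lemma vfield_levi_civita: "is_levi_civita p D \<Longrightarrow> vfield p X \<Longrightarrow> vfield p Y \<Longrightarrow> vfield p (D X Y)"
  by (simp add: is_levi_civita_def affine_connection_def)

lemma vfield_nabla: "vfield p X \<Longrightarrow> vfield p Y \<Longrightarrow> vfield p (nabla p X Y)"
  by (rule vfield_levi_civita[OF is_levi_civita_nabla])

section \<open>Second derivatives and curvature\<close>

text \<open>Derivatives are controlled in fixed directions, so the moving direction
  \<open>G A\<close> is expanded in the basis, differentiated by the product rule, and the two sums
  are put together again.\<close>

lemma has_derivative_frechet_apply:
  fixes F :: "'a::euclidean_space \<Rightarrow> 'b::euclidean_space" and G :: "'a \<Rightarrow> 'a"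
  assumes F: "smooth_on W F" and G: "smooth_on W G" and P: "P \<in> W"
  shows "((\<lambda>A. frechet_derivative F (at A) (G A)) has_derivative
    (\<lambda>v. frechet_derivative (\<lambda>A. frechet_derivative F (at A) (G P)) (at P) v +
         frechet_derivative F (at P) (frechet_derivative G (at P) v))) (at P)"
proof -
  let ?Fb = "\<lambda>b A. frechet_derivative F (at A) b"
  have dF: "(?Fb b has_derivative frechet_derivative (?Fb b) (at P)) (at P)" for b
    by (rule smooth_on_has_derivative[OF smooth_on_frechet[OF F] P])
  have W: "open W" using smooth_on_open[OF F] .
  have dG: "((\<lambda>A. G A \<bullet> b) has_derivative (\<lambda>v. frechet_derivative G (at P) v \<bullet> b)) (at P)" for b
    by (rule bounded_linear.has_derivative[OF bounded_linear_inner_left smooth_on_has_derivative[OF G P]])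
  have "((\<lambda>A. \<Sum>b\<in>Basis. (G A \<bullet> b) *\<^sub>R ?Fb b A) has_derivative
      (\<lambda>v. \<Sum>b\<in>Basis. (G P \<bullet> b) *\<^sub>R frechet_derivative (?Fb b) (at P) v
        + (frechet_derivative G (at P) v \<bullet> b) *\<^sub>R ?Fb b P)) (at P)"
    by (intro has_derivative_sum bounded_bilinear.FDERIV[OF bounded_bilinear_scaleR dG dF])
  then have 1: "((\<lambda>A. frechet_derivative F (at A) (G A)) has_derivative
      (\<lambda>v. \<Sum>b\<in>Basis. (G P \<bullet> b) *\<^sub>R frechet_derivative (?Fb b) (at P) v
        + (frechet_derivative G (at P) v \<bullet> b) *\<^sub>R ?Fb b P)) (at P)"
    by (rule has_derivative_transform_within_open[OF _ W P])
      (use linear_basis_expansion[OF smooth_on_linear_frechet[OF F]] in simp)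
  have "((\<lambda>A. \<Sum>b\<in>Basis. (G P \<bullet> b) *\<^sub>R ?Fb b A) has_derivative
      (\<lambda>v. \<Sum>b\<in>Basis. (G P \<bullet> b) *\<^sub>R frechet_derivative (?Fb b) (at P) v)) (at P)"
    by (intro has_derivative_sum bounded_linear.has_derivative[OF bounded_linear_scaleR_right dF])
  then have "(?Fb (G P) has_derivative
      (\<lambda>v. \<Sum>b\<in>Basis. (G P \<bullet> b) *\<^sub>R frechet_derivative (?Fb b) (at P) v)) (at P)"
    by (rule has_derivative_transform_within_open[OF _ W P])
      (use linear_basis_expansion[OF smooth_on_linear_frechet[OF F]] in simp)
  from frechet_derivative_at[OF this]
  have 2: "(\<Sum>b\<in>Basis. (G P \<bullet> b) *\<^sub>R frechet_derivative (?Fb b) (at P) v) =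
      frechet_derivative (?Fb (G P)) (at P) v" for v by (rule fun_cong)
  have 3: "(\<Sum>b\<in>Basis. (frechet_derivative G (at P) v \<bullet> b) *\<^sub>R ?Fb b P) =
      frechet_derivative F (at P) (frechet_derivative G (at P) v)" for v
    by (rule linear_basis_expansion[OF smooth_on_linear_frechet[OF F P], symmetric])
  show ?thesis using 1 by (simp add: sum.distrib 2 3)
qed

text \<open>In terms of local extensions both iterated derivatives contain the second derivative of
  \<open>F\<close>, which cancels by symmetry; what remains is the derivative of \<open>F\<close>
  along the bracket.\<close>

lemma dir_deriv_commutator:
  fixes X Y :: "real^'n^'n \<Rightarrow> real^'n^'n" and f :: "real^'n^'n \<Rightarrow> 'b::euclidean_space"
  assumes f: "smooth_on_Gr p f" and X: "vfield p X" and Y: "vfield p Y" and P: "P \<in> Gr p"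
  shows "dir_deriv p (\<lambda>A. dir_deriv p f A (Y A)) P (X P) - dir_deriv p (\<lambda>A. dir_deriv p f A (X A)) P (Y P)
    = dir_deriv p f P (lie_bracket p X Y P)"
proof -
  obtain W0 F where F0: "P \<in> W0" "smooth_on W0 F" "\<And>A. A \<in> W0 \<inter> Gr p \<Longrightarrow> F A = f A"
    using smooth_on_GrE[OF f P] by metis
  obtain W1 G where G0: "P \<in> W1" "smooth_on W1 G" "\<And>A. A \<in> W1 \<inter> Gr p \<Longrightarrow> G A = Y A"
    using smooth_on_GrE[OF vfieldD(1)[OF Y] P] by metis
  obtain W2 H where H0: "P \<in> W2" "smooth_on W2 H" "\<And>A. A \<in> W2 \<inter> Gr p \<Longrightarrow> H A = X A"
    using smooth_on_GrE[OF vfieldD(1)[OF X] P] by metis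
  define W where "W = W0 \<inter> (W1 \<inter> W2)"
  have oW: "open W" unfolding W_def using F0(2) G0(2) H0(2) by (intro open_Int smooth_on_open)
  have PW: "P \<in> W" using F0 G0 H0 by (simp add: W_def)
  have F: "smooth_on W F" and G: "smooth_on W G" and H: "smooth_on W H"
    using smooth_on_subset[OF F0(2) oW] smooth_on_subset[OF G0(2) oW] smooth_on_subset[OF H0(2) oW]
    by (auto simp: W_def)
  have eq: "F A = f A" "G A = Y A" "H A = X A" if "A \<in> W \<inter> Gr p" for A
    using that F0(3) G0(3) H0(3) by (auto simp: W_def)
  have x: "X P \<in> TGr P" and y: "Y P \<in> TGr P" using X Y P by (auto simp: vfield_def)
  have second: "dir_deriv p (\<lambda>A. dir_deriv p f A (V A)) P v =
      frechet_derivative (\<lambda>A. frechet_derivative F (at A) (V P)) (at P) v +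
      frechet_derivative F (at P) (dir_deriv p V P v)"
    if V: "vfield p V" and K: "smooth_on W K" "\<And>A. A \<in> W \<inter> Gr p \<Longrightarrow> K A = V A" and v: "v \<in> TGr P" for V K v
  proof -
    have "dir_deriv p (\<lambda>A. dir_deriv p f A (V A)) P v =
        frechet_derivative (\<lambda>A. frechet_derivative F (at A) (K A)) (at P) v"
    proof (rule dir_deriv_extension[OF P v smooth_on_frechet_apply[OF F K(1)] PW])
      fix A assume A: "A \<in> W \<inter> Gr p"
      then have "dir_deriv p f A (V A) = frechet_derivative F (at A) (V A)"
        using dir_deriv_extension[OF _ vfieldD(2)[OF V] F _ eq(1)] by blast
      then show "frechet_derivative F (at A) (K A) = dir_deriv p f A (V A)"
        using K(2)[OF A] by simp
    qed
    moreover have "dir_deriv p V P v = frechet_derivative K (at P) v"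
      by (rule dir_deriv_extension[OF P v K(1) PW K(2)])
    ultimately show ?thesis
      using fun_cong[OF frechet_derivative_at[OF has_derivative_frechet_apply[OF F K(1) PW]], of v] K(2)[of P] PW P
      by simp
  qed
  have lin: "linear (frechet_derivative F (at P))" by (rule smooth_on_linear_frechet[OF F PW])
  have "lie_bracket p X Y P \<in> TGr P"
    by (rule vfieldD(2)[OF vfield_lie_bracket[OF X Y] P])
  then have "dir_deriv p f P (lie_bracket p X Y P) = frechet_derivative F (at P) (lie_bracket p X Y P)"
    by (rule dir_deriv_extension[OF P _ F PW eq(1)])
  also have "\<dots> = frechet_derivative F (at P) (dir_deriv p Y P (X P)) - frechet_derivative F (at P) (dir_deriv p X P (Y P))"
    by (simp add: lie_bracket_def linear_diff[OF lin])
  finally show ?thesis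
    using second[OF Y G eq(2) x] second[OF X H eq(3) y] second_derivative_symmetric[OF F PW, of "Y P" "X P"]
    by simp
qed

text \<open>The outer derivative also acts on the inner projection. Its effect on the tangential
  part of the inner derivative is normal and is projected away; its effect on the normal part is the
  Weingarten term.\<close>

lemma nabla_nabla:
  assumes X: "vfield p X" and Y: "vfield p Y" and Z: "vfield p Z" and P: "P \<in> Gr p"
  shows "nabla p X (nabla p Y Z) P = tproj P (dir_deriv p (\<lambda>A. dir_deriv p Z A (Y A)) P (X P)) +
    (X P ** (Y P ** Z P + Z P ** Y P) + (Y P ** Z P + Z P ** Y P) ** X P)"
proof -
  note x = vfieldD(2)[OF X P] and y = vfieldD(2)[OF Y P] and z = vfieldD(2)[OF Z P]
  let ?g = "\<lambda>A. dir_deriv p Z A (Y A)"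
  have g: "smooth_on_Gr p ?g" by (rule smooth_on_Gr_dir_deriv[OF vfieldD(1)[OF Z] Y])
  have "dir_deriv p (nabla p Y Z) P (X P) = tproj P (dir_deriv p ?g P (X P)) + dproj P (X P) (?g P)"
  proof (rule dir_deriv_eqI[OF P x])
    fix c assume c: "\<And>t. c t \<in> Gr p" "c 0 = P" "(c has_vector_derivative X P) (at 0)"
    have "nabla p Y Z (c t) = tproj (c t) (?g (c t))" for t
      using nabla_eq_lc_connection[OF Y Z c(1)] by (simp add: lc_connection_def)
    then show "((\<lambda>t. nabla p Y Z (c t)) has_vector_derivative
        tproj P (dir_deriv p ?g P (X P)) + dproj P (X P) (?g P)) (at 0)"
      using has_vector_derivative_tproj[OF c(3) has_dir_deriv[OF g c(1,3)]] by (simp add: c(2))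
  qed
  also have "?g P = tproj P (?g P) + second_form P (Y P) (Z P)"
    by (rule dir_deriv_vfield(1)[OF Z P y])
  finally have "dir_deriv p (nabla p Y Z) P (X P) =
      tproj P (dir_deriv p ?g P (X P)) + (dproj P (X P) (tproj P (?g P)) + dproj P (X P) (second_form P (Y P) (Z P)))"
    by (simp add: dproj_add)
  then have "nabla p X (nabla p Y Z) P = tproj P (tproj P (dir_deriv p ?g P (X P)) +
      (dproj P (X P) (tproj P (?g P)) + dproj P (X P) (second_form P (Y P) (Z P))))"
    using nabla_eq_lc_connection[OF X vfield_nabla[OF Y Z] P] by (simp add: lc_connection_def)
  also have "\<dots> = tproj P (dir_deriv p ?g P (X P)) + tproj P (dproj P (X P) (second_form P (Y P) (Z P)))"
    using lc_connection_tangent[OF Y Z P] unfolding lc_connection_def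
    by (simp add: linear_add[OF linear_tproj] tproj_idem[OF P] tproj_dproj_tangent[OF P x])
  finally show ?thesis by (simp add: tproj_dproj_second_form[OF P x y z])
qed

text \<open>The Gauss equation for a flat ambient space: second derivatives cancel against the
  bracket term, and the two Weingarten terms combine to a double bracket.\<close>

lemma curvature_eq:
  assumes X: "vfield p X" and Y: "vfield p Y" and Z: "vfield p Z" and P: "P \<in> Gr p"
  shows "curvature p X Y Z P = comm (comm (X P) (Y P)) (Z P)"
proof -
  have "nabla p (lie_bracket p X Y) Z P = tproj P (dir_deriv p Z P (lie_bracket p X Y P))"
    using nabla_eq_lc_connection[OF vfield_lie_bracket[OF X Y] Z P] by (simp add: lc_connection_def)
  also have "\<dots> = tproj P (dir_deriv p (\<lambda>A. dir_deriv p Z A (Y A)) P (X P))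
      - tproj P (dir_deriv p (\<lambda>A. dir_deriv p Z A (X A)) P (Y P))"
    using dir_deriv_commutator[OF vfieldD(1)[OF Z] X Y P] by (simp flip: linear_diff[OF linear_tproj])
  finally show ?thesis
    unfolding curvature_def nabla_nabla[OF X Y Z P] nabla_nabla[OF Y X Z P]
    by (simp add: comm_def mat_simps)
qed

text \<open>Projected constants extend the three vectors to vector fields, so the description has an
  instance; \<open>curvature_eq\<close> shows that only the values at \<open>P\<close>
  matter.\<close>

lemma riemann_eq:
  assumes P: "P \<in> Gr p" and x: "x \<in> TGr P" and y: "y \<in> TGr P" and z: "z \<in> TGr P"
  shows "riemann p P x y z = comm (comm x y) z"
  unfolding riemann_def
proof (rule the_equality)
  show "\<forall>X Y Z. vfield p X \<and> vfield p Y \<and> vfield p Z \<and> X P = x \<and> Y P = y \<and> Z P = z \<longrightarrow>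
      curvature p X Y Z P = comm (comm x y) z"
    using curvature_eq[OF _ _ _ P] by blast
  fix r assume r: "\<forall>X Y Z. vfield p X \<and> vfield p Y \<and> vfield p Z \<and> X P = x \<and> Y P = y \<and> Z P = z \<longrightarrow>
      curvature p X Y Z P = r"
  have v: "vfield p (\<lambda>A. tproj A v)" "tproj P v = v" if "v \<in> TGr P" for v
    using vfield_const_proj[OF TGrD(1)[OF that]] tproj_tangent[OF P that] by auto
  have "curvature p (\<lambda>A. tproj A x) (\<lambda>A. tproj A y) (\<lambda>A. tproj A z) P = r"
    by (rule r[rule_format]) (simp add: v x y z)
  then show "r = comm (comm x y) z"
    using curvature_eq[OF v(1)[OF x] v(1)[OF y] v(1)[OF z] P] by (simp add: v(2) x y z)
qed

section \<open>Covariant derivative along curves and geodesics\<close>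

lemma smooth_curveD:
  assumes "smooth_curve p c"
  shows "smooth_on UNIV c" "c t \<in> Gr p" "(c has_vector_derivative velocity c t) (at t)"
    "velocity c t \<in> TGr (c t)" "smooth_on UNIV (velocity c)"
proof -
  show c: "smooth_on UNIV c" and Gr: "c t \<in> Gr p" for t
    using assms by (auto simp: smooth_curve_def)
  show d: "(c has_vector_derivative velocity c t) (at t)"
    unfolding velocity_def by (rule smooth_on_vector_derivative(1)[OF c])
  show "velocity c t \<in> TGr (c t)" by (rule curve_tangent[OF Gr d])
  show "smooth_on UNIV (velocity c)"
    unfolding velocity_def[abs_def] by (rule smooth_on_vector_derivative(2)[OF c])
qed

lemma velocity_eqI: "(c has_vector_derivative v) (at t) \<Longrightarrow> velocity c t = v"
  by (simp add: velocity_def vector_derivative_at)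

lemma field_alongD:
  assumes "field_along c V"
  shows "smooth_on UNIV V" "V t \<in> TGr (c t)" "(V has_vector_derivative vector_derivative V (at t)) (at t)"
    "transpose (vector_derivative V (at t)) = vector_derivative V (at t)"
proof -
  show s: "smooth_on UNIV V" and tan: "V t \<in> TGr (c t)" for t
    using assms by (auto simp: field_along_def)
  show d: "(V has_vector_derivative vector_derivative V (at t)) (at t)"
    by (rule smooth_on_vector_derivative(1)[OF s])
  have "((\<lambda>t. transpose (V t)) has_vector_derivative transpose (vector_derivative V (at t))) (at t)"
    by (rule bounded_linear.has_vector_derivative[OF bounded_linear_transpose d])
  then have "(V has_vector_derivative transpose (vector_derivative V (at t))) (at t)"
    by (simp only: TGrD(1)[OF tan])
  then show "transpose (vector_derivative V (at t)) = vector_derivative V (at t)"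
    using d vector_derivative_unique_at by blast
qed

definition proj_deriv :: "(real \<Rightarrow> real^'n^'n) \<Rightarrow> (real \<Rightarrow> real^'n^'n) \<Rightarrow> real \<Rightarrow> real^'n^'n" where
  "proj_deriv c V t = tproj (c t) (vector_derivative V (at t))"

lemma field_along_proj_deriv:
  assumes c: "smooth_curve p c" and V: "field_along c V"
  shows "field_along c (proj_deriv c V)"
  unfolding field_along_def proj_deriv_def[abs_def]
  using smooth_on_tproj[OF smooth_curveD(1)[OF c] smooth_on_vector_derivative(2)[OF field_alongD(1)[OF V]]]
    tproj_in_TGr[OF smooth_curveD(2)[OF c] field_alongD(4)[OF V]] by blast

text \<open>The witness behind the choice in \<open>cov_deriv\<close>. The clause on restricted
  fields holds because \<open>lc_connection\<close> is also a projected derivative.\<close>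

lemma is_cov_deriv_proj_deriv:
  fixes c :: "real \<Rightarrow> real^'n^'n"
  assumes c: "smooth_curve p c"
  shows "is_cov_deriv p c (proj_deriv c)"
  unfolding is_cov_deriv_def
proof (intro conjI allI impI; (elim conjE)?)
  fix V assume "field_along c V"
  then show "field_along c (proj_deriv c V)" by (rule field_along_proj_deriv[OF c])
next
  fix V V' :: "real \<Rightarrow> real^'n^'n" and a b t :: real
  assume V: "field_along c V" and V': "field_along c V'"
  have "((\<lambda>u. a *\<^sub>R V u + b *\<^sub>R V' u) has_vector_derivative
      a *\<^sub>R vector_derivative V (at t) + b *\<^sub>R vector_derivative V' (at t)) (at t)"
    by (intro has_vector_derivative_add field_alongD(3)[OF V] field_alongD(3)[OF V']
        bounded_linear.has_vector_derivative[OF bounded_linear_scaleR_right])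
  then show "proj_deriv c (\<lambda>u. a *\<^sub>R V u + b *\<^sub>R V' u) t = a *\<^sub>R proj_deriv c V t + b *\<^sub>R proj_deriv c V' t"
    by (simp add: proj_deriv_def vector_derivative_at linear_add[OF linear_tproj] linear_scale[OF linear_tproj])
next
  fix V :: "real \<Rightarrow> real^'n^'n" and f :: "real \<Rightarrow> real" and t :: real
  assume V: "field_along c V" and f: "smooth_on UNIV f"
  have "((\<lambda>u. f u *\<^sub>R V u) has_vector_derivative
      f t *\<^sub>R vector_derivative V (at t) + vector_derivative f (at t) *\<^sub>R V t) (at t)"
    by (rule bounded_bilinear.has_vector_derivative[OF bounded_bilinear_scaleR
        smooth_on_vector_derivative(1)[OF f] field_alongD(3)[OF V]])
  then show "proj_deriv c (\<lambda>u. f u *\<^sub>R V u) t = vector_derivative f (at t) *\<^sub>R V t + f t *\<^sub>R proj_deriv c V t"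
    using tproj_tangent[OF smooth_curveD(2)[OF c] field_alongD(2)[OF V], of t]
    by (simp add: proj_deriv_def vector_derivative_at linear_add[OF linear_tproj] linear_scale[OF linear_tproj])
next
  fix X W :: "real^'n^'n \<Rightarrow> real^'n^'n" and t :: real
  assume X: "vfield p X" and W: "vfield p W" and Wc: "W (c t) = velocity c t"
  have "((\<lambda>u. X (c u)) has_vector_derivative dir_deriv p X (c t) (velocity c t)) (at t)"
    by (rule has_dir_deriv[OF vfieldD(1)[OF X] smooth_curveD(2,3)[OF c]])
  then show "proj_deriv c (\<lambda>u. X (c u)) t = nabla p W X (c t)"
    using nabla_eq_lc_connection[OF W X smooth_curveD(2)[OF c]] Wc
    by (simp add: proj_deriv_def vector_derivative_at lc_connection_def)
qed

lemma field_along_lincomb: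
  "field_along c V \<Longrightarrow> field_along c V' \<Longrightarrow> field_along c (\<lambda>u. a *\<^sub>R V u + b *\<^sub>R V' u)"
  unfolding field_along_def by (auto intro!: smooth_on_add smooth_on_scaleR_const TGr_lincomb)

lemma field_along_zero: "field_along c (\<lambda>_. 0)"
  unfolding field_along_def by (auto intro!: smooth_on_const TGr_subspace)

text \<open>The axioms give linearity for two fields; induction extends it to finite sums, in the
  form needed to compare two operators.\<close>

lemma cov_deriv_agree_sum:
  assumes D: "is_cov_deriv p c D" and D': "is_cov_deriv p c D'"
    and "finite I" "\<And>i. i \<in> I \<Longrightarrow> field_along c (V i)" "\<And>i. i \<in> I \<Longrightarrow> D (V i) t = D' (V i) t"
  shows "field_along c (\<lambda>u. \<Sum>i\<in>I. V i u) \<and> D (\<lambda>u. \<Sum>i\<in>I. V i u) t = D' (\<lambda>u. \<Sum>i\<in>I. V i u) t"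
  using assms(3-5)
proof (induction I)
  case empty
  \<comment> \<open>The zero field is a combination with zero coefficients, so linearity sends it to
    \<open>0\<close>.\<close>
  have "D (\<lambda>u. 0 *\<^sub>R 0 + 0 *\<^sub>R 0) t = 0 *\<^sub>R D (\<lambda>_. 0) t + 0 *\<^sub>R D (\<lambda>_. 0) t" if "is_cov_deriv p c D" for D
    using that field_along_zero unfolding is_cov_deriv_def by blast
  then have z: "D (\<lambda>_. 0) t = 0" if "is_cov_deriv p c D" for D using that by simp
  show ?case by (simp add: field_along_zero z[OF D] z[OF D'])
next
  case (insert i I)
  have V: "field_along c (V i)" and S: "field_along c (\<lambda>u. \<Sum>i\<in>I. V i u)"
    using insert by auto
  have "D (\<lambda>u. 1 *\<^sub>R V i u + 1 *\<^sub>R (\<Sum>i\<in>I. V i u)) t = 1 *\<^sub>R D (V i) t + 1 *\<^sub>R D (\<lambda>u. \<Sum>i\<in>I. V i u) t"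
    if "is_cov_deriv p c D" for D
    using that V S unfolding is_cov_deriv_def by blast
  then have s: "D (\<lambda>u. V i u + (\<Sum>i\<in>I. V i u)) t = D (V i) t + D (\<lambda>u. \<Sum>i\<in>I. V i u) t"
    if "is_cov_deriv p c D" for D using that by simp
  have "field_along c (\<lambda>u. V i u + (\<Sum>i\<in>I. V i u))"
    using field_along_lincomb[OF V S, of 1 1] by simp
  then show ?case using s[OF D] s[OF D'] insert by simp
qed

text \<open>The fields \<open>tproj A ((b + transpose b)/2)\<close>, with \<open>b\<close> running through the standard basis
  of the matrix space, span all tangent spaces, so every field along \<open>c\<close> is a combination of them
  with smooth coefficients.\<close>

lemma is_cov_deriv_unique:
  fixes c :: "real \<Rightarrow> real^'n^'n"
  assumes c: "smooth_curve p c" and D: "is_cov_deriv p c D" and D': "is_cov_deriv p c D'"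
    and V: "field_along c V"
  shows "D V t = D' V t"
proof -
  \<comment> \<open>Basis matrices need not be symmetric, while \<open>tproj\<close> yields tangent
    vectors on symmetric arguments; hence the symmetrization.\<close>
  define L where "L A M = tproj A ((1/2) *\<^sub>R (M + transpose M))" for A M :: "real^'n^'n"
  have vf: "vfield p (\<lambda>A. L A b)" for b
    unfolding L_def by (rule vfield_const_proj) (simp add: transpose_simps add.commute)
  have lin: "linear (L A)" for A
    unfolding L_def
    by (rule linearI) (simp_all add: transpose_simps linear_add[OF linear_tproj] linear_scale[OF linear_tproj]
        scaleR_right_distrib ac_simps)
  have rep: "V u = (\<Sum>b\<in>Basis. (V u \<bullet> b) *\<^sub>R L (c u) b)" for u
  proof -
    have "L (c u) (V u) = V u"
      using tproj_tangent[OF smooth_curveD(2)[OF c] field_alongD(2)[OF V]] TGrD(1)[OF field_alongD(2)[OF V]]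
      by (simp add: L_def linear_scale[OF linear_tproj] linear_add[OF linear_tproj] flip: scaleR_2)
    then show ?thesis using linear_basis_expansion[OF lin, of "c u" "V u"] by simp
  qed
  have f: "smooth_on UNIV (\<lambda>u. V u \<bullet> b)" for b
    by (rule smooth_on_bounded_linear[OF bounded_linear_inner_left field_alongD(1)[OF V]])
  have Lc: "field_along c (\<lambda>u. L (c u) b)" for b
    unfolding field_along_def
    using smooth_on_tproj[OF smooth_curveD(1)[OF c] smooth_on_const[OF open_UNIV, of "(1/2) *\<^sub>R (b + transpose b)"]]
      vfieldD(2)[OF vf smooth_curveD(2)[OF c]]
    by (simp add: L_def)
  have fa: "field_along c (\<lambda>u. (V u \<bullet> b) *\<^sub>R L (c u) b)" for b
    using smooth_on_bilinear[OF bounded_bilinear_scaleR f field_alongD(1)[OF Lc]] field_alongD(2)[OF Lc]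
    by (simp add: field_along_def TGr_subspace)
  define W where "W A = tproj A (velocity c t)" for A
  have W: "vfield p W" "W (c t) = velocity c t"
    unfolding W_def using vfield_const_proj[OF TGrD(1)[OF smooth_curveD(4)[OF c]]]
      tproj_tangent[OF smooth_curveD(2,4)[OF c]] by auto
  \<comment> \<open>The axioms determine the operator on a smooth multiple of a restricted vector
    field: the right-hand side does not mention \<open>D\<close>.\<close>
  have val: "D (\<lambda>u. (V u \<bullet> b) *\<^sub>R L (c u) b) t =
      vector_derivative (\<lambda>u. V u \<bullet> b) (at t) *\<^sub>R L (c t) b + (V t \<bullet> b) *\<^sub>R nabla p W (\<lambda>A. L A b) (c t)"
    if D: "is_cov_deriv p c D" for D b
  proof -
    have "D (\<lambda>u. (V u \<bullet> b) *\<^sub>R L (c u) b) t =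
        vector_derivative (\<lambda>u. V u \<bullet> b) (at t) *\<^sub>R L (c t) b + (V t \<bullet> b) *\<^sub>R D (\<lambda>u. L (c u) b) t"
      using D f[of b] Lc[of b] unfolding is_cov_deriv_def by blast
    moreover have "\<forall>X W t. vfield p X \<and> vfield p W \<and> W (c t) = velocity c t \<longrightarrow> D (\<lambda>u. X (c u)) t = nabla p W X (c t)"
      using D unfolding is_cov_deriv_def by blast
    then have "D (\<lambda>u. L (c u) b) t = nabla p W (\<lambda>A. L A b) (c t)"
      using vf[of b] W by blast
    ultimately show ?thesis by simp
  qed
  have "D (\<lambda>u. \<Sum>b\<in>Basis. (V u \<bullet> b) *\<^sub>R L (c u) b) t = D' (\<lambda>u. \<Sum>b\<in>Basis. (V u \<bullet> b) *\<^sub>R L (c u) b) t"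
    by (rule cov_deriv_agree_sum[OF D D' finite_Basis, THEN conjunct2]) (use fa val[OF D] val[OF D'] in auto)
  then show ?thesis by (simp flip: rep)
qed

lemma is_cov_deriv_cov_deriv: "smooth_curve p c \<Longrightarrow> is_cov_deriv p c (cov_deriv p c)"
  unfolding cov_deriv_def by (rule someI[of "is_cov_deriv p c", OF is_cov_deriv_proj_deriv])

lemma cov_deriv_eq:
  assumes "smooth_curve p c" "field_along c V"
  shows "cov_deriv p c V = proj_deriv c V"
  using is_cov_deriv_unique[OF assms(1) is_cov_deriv_cov_deriv is_cov_deriv_proj_deriv assms(2)] assms(1) by blast

section \<open>Conjugation by the exponential as parallel transport\<close>

definition conj_exp :: "real^'n^'n \<Rightarrow> real \<Rightarrow> real^'n^'n \<Rightarrow> real^'n^'n" where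
  "conj_exp A t X = mexp (t *\<^sub>R A) ** (X ** mexp (- (t *\<^sub>R A)))"

lemma conj_exp_inverse: "conj_exp (- A) t (conj_exp A t X) = X" "conj_exp A t (conj_exp (- A) t X) = X"
  by (simp_all add: conj_exp_def mexp_inverse matrix_mul_assoc)
    (simp_all add: mexp_inverse flip: matrix_mul_assoc)

text \<open>Being an algebra automorphism, conjugation carries along all that is built from sums and
  products, such as \<open>tproj\<close>, \<open>comm\<close> and, for skew \<open>A\<close>,
  tangency.\<close>

lemma conj_exp_mult: "conj_exp A t (X ** Y) = conj_exp A t X ** conj_exp A t Y"
proof -
  have inv: "mexp (- (t *\<^sub>R A)) ** (mexp (t *\<^sub>R A) ** Z) = Z" for Z
    by (simp add: matrix_mul_assoc mexp_inverse)
  show ?thesis by (simp add: conj_exp_def mat_simps inv)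
qed

lemma conj_exp_linear: "conj_exp A t (X + Y) = conj_exp A t X + conj_exp A t Y" "conj_exp A t (X - Y) = conj_exp A t X - conj_exp A t Y"
  "conj_exp A t 0 = 0" "conj_exp A t (- X) = - conj_exp A t X"
  by (simp_all add: conj_exp_def mat_simps)

lemma conj_exp_tproj: "conj_exp A t (tproj P X) = tproj (conj_exp A t P) (conj_exp A t X)"
  by (simp only: tproj_def conj_exp_mult conj_exp_linear)

lemma conj_exp_comm: "conj_exp A t (comm X Y) = comm (conj_exp A t X) (conj_exp A t Y)"
  by (simp add: comm_def conj_exp_mult conj_exp_linear)

lemma conj_exp_0: "conj_exp A 0 X = X"
  by (simp add: conj_exp_def mexp_0)

lemma geo_conj_exp: "geo P D t = conj_exp (comm D P) t P"
  by (simp add: geo_def conj_exp_def)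

lemma transpose_conj_exp: "transpose A = - A \<Longrightarrow> transpose (conj_exp A t X) = conj_exp A t (transpose X)"
  by (simp add: conj_exp_def transpose_simps transpose_mexp matrix_mul_assoc)

lemma conj_exp_TGr:
  assumes "transpose A = - A" "X \<in> TGr P"
  shows "conj_exp A t X \<in> TGr (conj_exp A t P)"
  using assms by (simp add: TGr_def transpose_conj_exp flip: conj_exp_mult conj_exp_linear)

lemma has_vector_derivative_conj_exp:
  "(k has_vector_derivative k') (at t) \<Longrightarrow>
    ((\<lambda>t. conj_exp A t (k t)) has_vector_derivative conj_exp A t (k' + comm A (k t))) (at t)"
  unfolding conj_exp_def by (rule has_vector_derivative_conj_mexp)

lemma smooth_conj_exp:
  assumes "smooth_on UNIV k"
  shows "smooth_on UNIV (\<lambda>t. conj_exp A t (k t))"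
proof -
  have e: "smooth_on UNIV (\<lambda>t. mexp (t *\<^sub>R B))" for B :: "real^'a^'a"
    by (rule smooth_on_compose[OF smooth_mexp])
      (auto intro!: smooth_on_bounded_linear[OF bounded_linear_scaleR_left] smooth_on_ident)
  have "smooth_on UNIV (\<lambda>t. mexp (- (t *\<^sub>R A)))" using e[of "- A"] by simp
  then show ?thesis
    unfolding conj_exp_def by (intro smooth_on_bilinear[OF bounded_bilinear_matrix_mult] e assms)
qed

lemma smooth_curve_geo:
  assumes "P \<in> Gr p" "D \<in> TGr P"
  shows "smooth_curve p (geo P D)"
  using geo_in_Gr[OF assms] smooth_conj_exp[OF smooth_on_const[OF open_UNIV, of P], of "comm D P"]
  unfolding smooth_curve_def geo_conj_exp[abs_def] by auto

text \<open>Both arguments of the outer bracket are off-diagonal, so it is block diagonal, that is,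
  normal. Hence conjugation adds nothing to the covariant derivative.\<close>

lemma tproj_comm_tangent: "P \<in> Gr p \<Longrightarrow> D \<in> TGr P \<Longrightarrow> k \<in> TGr P \<Longrightarrow> tproj P (comm (comm D P) k) = 0"
  unfolding tproj_def comm_def by (simp add: mat_simps GrD TGrD)

text \<open>Tangency at a fixed \<open>P\<close> is a linear condition with constant coefficients
  and passes to derivatives.\<close>

lemma constant_TGr_derivative:
  assumes k: "\<And>t. k t \<in> TGr P" and d: "(k has_vector_derivative k') (at t)"
  shows "k' \<in> TGr P"
proof -
  have "((\<lambda>t. k t ** P + P ** k t) has_vector_derivative k' ** P + P ** k') (at t)"
    by (intro has_vector_derivative_add bounded_linear.has_vector_derivative[OF matmul.bounded_linear_left d]
        bounded_linear.has_vector_derivative[OF matmul.bounded_linear_right d])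
  moreover have "(\<lambda>t. k t ** P + P ** k t) = k" using k by (simp add: TGr_def)
  ultimately have 1: "k' ** P + P ** k' = k'" using d vector_derivative_unique_at by metis
  have "((\<lambda>t. transpose (k t)) has_vector_derivative transpose k') (at t)"
    by (rule bounded_linear.has_vector_derivative[OF bounded_linear_transpose d])
  moreover have "(\<lambda>t. transpose (k t)) = k" using k by (simp add: TGr_def)
  ultimately have "transpose k' = k'" using d vector_derivative_unique_at by metis
  with 1 show ?thesis by (simp add: TGr_def)
qed

text \<open>Conjugation with \<open>mexp (t *\<^sub>R comm D P)\<close> is parallel transport along the geodesic.\<close>

lemma proj_deriv_conj_exp:
  assumes P: "P \<in> Gr p" and D: "D \<in> TGr P"
    and k: "\<And>t. k t \<in> TGr P" and d: "\<And>t. (k has_vector_derivative k' t) (at t)"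
  shows "proj_deriv (geo P D) (\<lambda>t. conj_exp (comm D P) t (k t)) = (\<lambda>t. conj_exp (comm D P) t (k' t))"
proof
  fix t
  let ?A = "comm D P"
  have "k' t \<in> TGr P" by (rule constant_TGr_derivative[OF k d])
  then have "tproj P (k' t + comm ?A (k t)) = k' t"
    by (simp add: linear_add[OF linear_tproj] tproj_tangent[OF P] tproj_comm_tangent[OF P D k])
  then show "proj_deriv (geo P D) (\<lambda>t. conj_exp ?A t (k t)) t = conj_exp ?A t (k' t)"
    unfolding proj_deriv_def vector_derivative_at[OF has_vector_derivative_conj_exp[OF d]] geo_conj_exp
    by (simp flip: conj_exp_tproj)
qed

lemma field_along_conj_exp:
  assumes P: "P \<in> Gr p" and D: "D \<in> TGr P" and k: "\<And>t. k t \<in> TGr P" and s: "smooth_on UNIV k"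
  shows "field_along (geo P D) (\<lambda>t. conj_exp (comm D P) t (k t))"
  using conj_exp_TGr[OF transpose_comm[OF P D] k] smooth_conj_exp[OF s]
  unfolding field_along_def geo_conj_exp by blast

lemma velocity_geo:
  assumes P: "P \<in> Gr p" and D: "D \<in> TGr P"
  shows "velocity (geo P D) = (\<lambda>t. conj_exp (comm D P) t D)"
proof
  fix t
  show "velocity (geo P D) t = conj_exp (comm D P) t D"
    using has_vector_derivative_geo[of P D t]
    by (intro velocity_eqI) (simp add: conj_exp_def comm_comm_tangent[OF P D])
qed

lemma geodesic_geo:
  assumes P: "P \<in> Gr p" and D: "D \<in> TGr P"
  shows "geodesic p (geo P D)"
proof -
  have "field_along (geo P D) (velocity (geo P D))"
    unfolding velocity_geo[OF P D]
    by (rule field_along_conj_exp[OF P D D smooth_on_const[OF open_UNIV]])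
  then have "cov_deriv p (geo P D) (velocity (geo P D)) = proj_deriv (geo P D) (velocity (geo P D))"
    by (rule cov_deriv_eq[OF smooth_curve_geo[OF P D]])
  also have "\<dots> = (\<lambda>t. 0)"
    unfolding velocity_geo[OF P D]
    by (simp add: proj_deriv_conj_exp[OF P D D has_vector_derivative_const] conj_exp_linear)
  finally show ?thesis
    unfolding geodesic_def using smooth_curve_geo[OF P D] by simp
qed

section \<open>Uniqueness of geodesics and the exponential map\<close>

text \<open>A vanishing projection removes the off-diagonal blocks; multiplying the equation by
  \<open>P\<close> on either side isolates them.\<close>

lemma comm_eq_0_of_tproj:
  assumes P: "P \<in> Gr p" and "tproj P Z = 0"
  shows "comm Z P = 0"
proof -
  have e: "P ** Z + Z ** P = P ** (Z ** P) + P ** (Z ** P)" using assms(2) by (simp add: tproj_def)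
  have "P ** (P ** Z + Z ** P) = P ** (P ** (Z ** P) + P ** (Z ** P))" unfolding e ..
  then have 1: "P ** Z = P ** (Z ** P)" by (simp add: mat_simps GrD[OF P])
  have "(P ** Z + Z ** P) ** P = (P ** (Z ** P) + P ** (Z ** P)) ** P" unfolding e ..
  then have "Z ** P = P ** (Z ** P)" by (simp add: mat_simps GrD[OF P])
  with 1 show ?thesis by (simp add: comm_def)
qed

text \<open>Conjugating back by the flow turns any solution into a constant.\<close>

lemma commutator_flow_unique:
  assumes d: "\<And>t. (c has_vector_derivative comm A (c t)) (at t)"
  shows "c t = conj_exp A t (c 0)"
proof -
  have "((\<lambda>t. conj_exp (- A) t (c t)) has_vector_derivative 0) (at t)" for t
    using has_vector_derivative_conj_exp[OF d[of t], of "- A"]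
    by (simp add: comm_def mat_simps conj_exp_linear)
  then have "conj_exp (- A) t (c t) = c 0"
    using constant_of_derivative_zero[of "\<lambda>t. conj_exp (- A) t (c t)" t 0] by (simp add: conj_exp_0)
  then show ?thesis using conj_exp_inverse(2)[of A t "c t"] by simp
qed

text \<open>For a geodesic \<open>c\<close> the matrix \<open>comm c' c\<close> is constant, so \<open>c\<close> solves a linear equation.\<close>

lemma geodesic_unique:
  assumes g: "geodesic p c" and "c 0 = P" "velocity c 0 = D"
  shows "c = geo P D"
proof
  fix t
  have c: "smooth_curve p c" using g by (simp add: geodesic_def)
  let ?v = "velocity c"
  have va: "field_along c ?v"
    using smooth_curveD(4,5)[OF c] by (simp add: field_along_def)
  have dv: "(?v has_vector_derivative vector_derivative ?v (at t)) (at t)" for t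
    by (rule field_alongD(3)[OF va])
  have acc: "comm (vector_derivative ?v (at t)) (c t) = 0" for t
    using g cov_deriv_eq[OF c va] comm_eq_0_of_tproj[OF smooth_curveD(2)[OF c]]
    by (simp add: geodesic_def proj_deriv_def)
  \<comment> \<open>The derivative is \<open>comm v' c + comm v v\<close>; the first term vanishes
    along a geodesic, the second is zero.\<close>
  have "((\<lambda>t. comm (?v t) (c t)) has_vector_derivative 0) (at t)" for t
    unfolding comm_def
    by (rule has_vector_derivative_eq_rhs[OF has_vector_derivative_diff[OF
          has_vector_derivative_matmul[OF dv smooth_curveD(3)[OF c]]
          has_vector_derivative_matmul[OF smooth_curveD(3)[OF c] dv]]])
      (use acc[of t] in \<open>simp add: comm_def\<close>)
  then have A: "comm (?v t) (c t) = comm D P" for t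
    using constant_of_derivative_zero[of "\<lambda>t. comm (?v t) (c t)" t 0] assms(2,3) by simp
  \<comment> \<open>A tangent vector is recovered from its bracket with the base point, and that
    bracket is constant.\<close>
  have "?v t = comm (comm D P) (c t)" for t
    using comm_comm_tangent[OF smooth_curveD(2)[OF c, of t] smooth_curveD(4)[OF c, of t]] by (simp add: A)
  then have d: "(c has_vector_derivative comm (comm D P) (c t)) (at t)" for t
    using smooth_curveD(3)[OF c, of t] by simp
  show "c t = geo P D t"
    unfolding geo_conj_exp using commutator_flow_unique[OF d, of t] by (simp add: assms(2))
qed

lemma Exp_Gr_eq:
  assumes P: "P \<in> Gr p" and D: "D \<in> TGr P"
  shows "Exp_Gr p P D = geo P D 1"
  unfolding Exp_Gr_def
proof (rule the_equality)
  show "\<exists>c. geodesic p c \<and> c 0 = P \<and> velocity c 0 = D \<and> geo P D 1 = c 1"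
    using geodesic_geo[OF P D] velocity_geo[OF P D] by (intro exI[of _ "geo P D"]) (simp add: geo_0 conj_exp_0)
  fix q assume "\<exists>c. geodesic p c \<and> c 0 = P \<and> velocity c 0 = D \<and> q = c 1"
  then obtain c where c: "geodesic p c" "c 0 = P" "velocity c 0 = D" "q = c 1" by blast
  show "q = geo P D 1" unfolding c(4) geodesic_unique[OF c(1-3)] ..
qed

lemma Exp_Gr_scaleR:
  assumes P: "P \<in> Gr p" and D: "D \<in> TGr P"
  shows "Exp_Gr p P (t *\<^sub>R D) = geo P D t"
  using Exp_Gr_eq[OF P TGr_subspace(3)[OF D]]
  by (simp add: geo_def comm_def mat_simps scaleR_right_diff_distrib)

section \<open>Jacobi fields\<close>

text \<open>In the parallel frame given by conjugation, the Jacobi equation has constant coefficients.\<close>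

lemma jacobi_conj_exp:
  assumes P: "P \<in> Gr p" and D: "D \<in> TGr P"
    and k: "\<And>t. k t \<in> TGr P" and s: "smooth_on UNIV k"
    and d: "\<And>t. (k has_vector_derivative k' t) (at t)"
    and d': "\<And>t. (k' has_vector_derivative k'' t) (at t)"
  defines "K \<equiv> \<lambda>t. conj_exp (comm D P) t (k t)"
  shows "jacobi_field p (geo P D) K \<longleftrightarrow> (\<forall>t. k'' t = - comm (comm (k t) D) D)"
    and "cov_deriv p (geo P D) K t = conj_exp (comm D P) t (k' t)"
proof -
  let ?A = "comm D P" and ?c = "geo P D"
  note c = smooth_curve_geo[OF P D]
  have K: "field_along ?c K" unfolding K_def by (rule field_along_conj_exp[OF P D k s])
  have k': "k' t \<in> TGr P" for t by (rule constant_TGr_derivative[OF k d])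
  have "smooth_on UNIV (\<lambda>t. vector_derivative k (at t))" by (rule smooth_on_vector_derivative(2)[OF s])
  then have s': "smooth_on UNIV k'" using vector_derivative_at[OF d] by simp
  have cK: "cov_deriv p ?c K = (\<lambda>t. conj_exp ?A t (k' t))"
    unfolding cov_deriv_eq[OF c K] unfolding K_def by (rule proj_deriv_conj_exp[OF P D k d])
  then show "cov_deriv p ?c K t = conj_exp ?A t (k' t)" by simp
  have ccK: "cov_deriv p ?c (cov_deriv p ?c K) = (\<lambda>t. conj_exp ?A t (k'' t))"
    unfolding cK cov_deriv_eq[OF c field_along_conj_exp[OF P D k' s']] by (rule proj_deriv_conj_exp[OF P D k' d'])
  \<comment> \<open>In the transported frame the velocity is the constant \<open>D\<close>, and
    conjugation commutes with brackets.\<close>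
  have R: "riemann p (?c t) (K t) (velocity ?c t) (velocity ?c t) = conj_exp ?A t (comm (comm (k t) D) D)" for t
    using riemann_eq[OF smooth_curveD(2)[OF c] field_alongD(2)[OF K] smooth_curveD(4,4)[OF c], of t]
    by (simp add: velocity_geo[OF P D] K_def conj_exp_comm)
  have "conj_exp ?A t (k'' t) + conj_exp ?A t (comm (comm (k t) D) D) = 0 \<longleftrightarrow> k'' t = - comm (comm (k t) D) D" for t
  proof -
    have "conj_exp ?A t (k'' t) + conj_exp ?A t (comm (comm (k t) D) D) = conj_exp ?A t (k'' t + comm (comm (k t) D) D)"
      by (simp add: conj_exp_linear)
    moreover have "conj_exp ?A t Z = 0 \<longleftrightarrow> Z = 0" for Z
      using conj_exp_inverse(1)[of ?A t Z] conj_exp_linear(3) by metis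
    ultimately show ?thesis by (simp add: eq_neg_iff_add_eq_0)
  qed
  then show "jacobi_field p ?c K \<longleftrightarrow> (\<forall>t. k'' t = - comm (comm (k t) D) D)"
    using K unfolding jacobi_field_def ccK R by blast
qed

text \<open>Transporting back turns a field along the geodesic into a curve in the fixed space
  \<open>TGr P\<close>, where field equations become ordinary differential equations.\<close>

lemma field_along_geo_frame:
  assumes P: "P \<in> Gr p" and D: "D \<in> TGr P" and K: "field_along (geo P D) K"
  defines "k \<equiv> \<lambda>t. conj_exp (- comm D P) t (K t)"
  shows "k t \<in> TGr P" "smooth_on UNIV k" "K t = conj_exp (comm D P) t (k t)"
proof -
  have "transpose (- comm D P) = - (- comm D P)"
    by (simp add: transpose_comm[OF P D] transpose_simps)
  from conj_exp_TGr[OF this field_alongD(2)[OF K, of t], of t] show "k t \<in> TGr P"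
    by (simp add: k_def geo_conj_exp conj_exp_inverse)
  show "smooth_on UNIV k" unfolding k_def by (rule smooth_conj_exp[OF field_alongD(1)[OF K]])
  show "K t = conj_exp (comm D P) t (k t)" by (simp add: k_def conj_exp_inverse)
qed

section \<open>Uniqueness of Jacobi fields\<close>

text \<open>Bracketing with a symmetric \<open>D\<close> is self-adjoint for the Frobenius inner
  product; this makes the energy below constant.\<close>

lemma inner_comm_swap:
  fixes x D N :: "real^'n^'n"
  assumes "transpose x = x" "transpose D = D" "transpose N = - N"
  shows "x \<bullet> comm N D = N \<bullet> comm x D"
proof -
  have 1: "trace (N ** (D ** x)) = trace (x ** (N ** D))"
    using trace_mul_sym[of "N ** D" x] by (simp add: mat_simps)
  have 2: "trace (N ** (x ** D)) = trace (x ** (D ** N))"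
    using trace_mul_sym[of N "x ** D"] by (simp add: mat_simps)
  show ?thesis
    unfolding trace_mult_transpose[symmetric]
    by (simp add: comm_def transpose_simps assms mat_simps trace_sub trace_add trace_uminus 1 2)
qed

text \<open>Nonnegativity of the curvature makes both terms of the conserved energy nonnegative.\<close>

lemma jacobi_ode_zero:
  fixes d d' :: "real \<Rightarrow> real^'n^'n"
  assumes D: "transpose D = D" and sym: "\<And>t. transpose (d t) = d t"
    and d1: "\<And>t. (d has_vector_derivative d' t) (at t)"
    and d2: "\<And>t. (d' has_vector_derivative - comm (comm (d t) D) D) (at t)"
    and ini: "d 0 = 0" "d' 0 = 0"
  shows "d t = 0"
proof -
  let ?N = "\<lambda>t. comm (d t) D"
  have dN: "(?N has_vector_derivative comm (d' t) D) (at t)" for t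
    unfolding comm_def
    by (intro has_vector_derivative_diff bounded_linear.has_vector_derivative[OF matmul.bounded_linear_left d1]
        bounded_linear.has_vector_derivative[OF matmul.bounded_linear_right d1])
  have sym': "transpose (d' t) = d' t" for t
  proof -
    have "((\<lambda>t. transpose (d t)) has_vector_derivative transpose (d' t)) (at t)"
      by (rule bounded_linear.has_vector_derivative[OF bounded_linear_transpose d1])
    then show ?thesis using d1[of t] vector_derivative_unique_at unfolding sym by blast
  qed
  have skew: "transpose (?N t) = - ?N t" for t
    by (simp add: comm_def transpose_simps D sym)
  \<comment> \<open>The second term is the curvature term, the inner product of \<open>d\<close>
    with \<open>comm (comm d D) D\<close>, written as a square by self-adjointness.\<close>
  have "((\<lambda>t. d' t \<bullet> d' t + ?N t \<bullet> ?N t) has_vector_derivative 0) (at t)" for t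
    by (rule has_vector_derivative_eq_rhs[OF has_vector_derivative_add[OF
          bounded_bilinear.has_vector_derivative[OF bounded_bilinear_inner d2 d2]
          bounded_bilinear.has_vector_derivative[OF bounded_bilinear_inner dN dN]]])
      (use inner_comm_swap[OF sym'[of t] D skew[of t]] in \<open>simp add: inner_commute\<close>)
  then have "d' t \<bullet> d' t + ?N t \<bullet> ?N t = d' 0 \<bullet> d' 0 + ?N 0 \<bullet> ?N 0" for t
    by (rule constant_of_derivative_zero)
  then have "d' t \<bullet> d' t + ?N t \<bullet> ?N t = 0" for t
    by (simp add: ini comm_def mat_simps)
  then have "d' t = 0" for t
    by (metis add_nonneg_eq_0_iff inner_ge_zero inner_eq_zero_iff)
  then have "(d has_vector_derivative 0) (at t)" for t using d1[of t] by simp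
  from constant_of_derivative_zero[OF this, of t 0] show ?thesis by (simp add: ini)
qed

text \<open>In the frame both fields solve the same linear equation, so their difference is a
  solution with zero initial data.\<close>

lemma jacobi_field_unique:
  assumes P: "P \<in> Gr p" and D: "D \<in> TGr P"
    and K: "jacobi_field p (geo P D) K" and L: "jacobi_field p (geo P D) L"
    and ini: "K 0 = L 0" "cov_deriv p (geo P D) K 0 = cov_deriv p (geo P D) L 0"
  shows "K = L"
proof
  fix t
  let ?A = "comm D P" and ?c = "geo P D"
  define k where "k t = conj_exp (- ?A) t (K t)" for t
  define l where "l t = conj_exp (- ?A) t (L t)" for t
  let ?d1 = "\<lambda>f t. vector_derivative f (at t)"
  have fK: "field_along ?c K" and fL: "field_along ?c L"
    using K L by (auto simp: jacobi_field_def)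
  note k = field_along_geo_frame[OF P D fK, folded k_def]
  note l = field_along_geo_frame[OF P D fL, folded l_def]
  have smk: "smooth_on UNIV k" and sml: "smooth_on UNIV l"
    using k(2) l(2) by (simp_all add: k_def[abs_def] l_def[abs_def])
  note dk = smooth_on_vector_derivative[OF smk] and dl = smooth_on_vector_derivative[OF sml]
  note dk' = smooth_on_vector_derivative(1)[OF dk(2)] and dl' = smooth_on_vector_derivative(1)[OF dl(2)]
  have Kk: "K = (\<lambda>t. conj_exp ?A t (k t))" and Ll: "L = (\<lambda>t. conj_exp ?A t (l t))"
    using k(3) l(3) by auto
  note jk = jacobi_conj_exp[OF P D k(1) smk dk(1) dk', folded Kk]
  note jl = jacobi_conj_exp[OF P D l(1) sml dl(1) dl', folded Ll]
  have "k t - l t = 0"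
  proof (rule jacobi_ode_zero[where d' = "\<lambda>t. ?d1 k t - ?d1 l t"])
    show "transpose D = D" by (rule TGrD(1)[OF D])
    show "transpose (k t - l t) = k t - l t" for t
      by (simp add: transpose_simps TGrD(1)[OF k(1)] TGrD(1)[OF l(1)])
    show "((\<lambda>t. k t - l t) has_vector_derivative ?d1 k t - ?d1 l t) (at t)" for t
      by (intro has_vector_derivative_diff dk dl)
    have "((\<lambda>t. ?d1 k t - ?d1 l t) has_vector_derivative
        - comm (comm (k t) D) D - - comm (comm (l t) D) D) (at t)" for t
      using has_vector_derivative_diff[OF dk'[of t] dl'[of t]] jk(1) jl(1) K L by simp
    then show "((\<lambda>t. ?d1 k t - ?d1 l t) has_vector_derivative - comm (comm (k t - l t) D) D) (at t)" for t
      by (rule has_vector_derivative_eq_rhs) (simp add: comm_def mat_simps)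
    show "k 0 - l 0 = 0" using ini(1) by (simp add: k_def l_def)
    show "?d1 k 0 - ?d1 l 0 = 0"
      using ini(2) jk(2)[of 0] jl(2)[of 0] by (simp add: conj_exp_0)
  qed
  then show "K t = L t" by (simp add: Kk Ll)
qed

lemma conj_exp_self: "conj_exp A t A = A"
proof -
  have "A ** mexp (- (t *\<^sub>R A)) = mexp (- (t *\<^sub>R A)) ** A"
    by (rule mexp_commute) (simp add: mat_simps)
  then show ?thesis by (simp add: conj_exp_def matrix_mul_assoc mexp_inverse)
qed

section \<open>Variation fields of geodesic variations\<close>

text \<open>The generator is fixed by its own flow, so the geodesic solves a linear equation whose
  coefficient is linear in the initial velocity.\<close>

lemma has_vector_derivative_geo_comm:
  "(geo P D has_vector_derivative comm (comm D P) (geo P D t)) (at t)"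
  using has_vector_derivative_conj_exp[of "\<lambda>_. P" 0 t "comm D P"]
  by (simp add: geo_conj_exp[abs_def] conj_exp_comm conj_exp_self)

lemma smooth_geo_variation:
  fixes P D1 D2 :: "real^'n^'n"
  shows "smooth_on UNIV (\<lambda>(s, t). geo P (D1 + s *\<^sub>R D2) t)"
proof -
  have m: "smooth_on UNIV (\<lambda>x :: real \<times> real. snd x *\<^sub>R (A + fst x *\<^sub>R B))" for A B :: "real^'n^'n"
    by (intro smooth_on_bilinear[OF bounded_bilinear_scaleR] smooth_on_add smooth_on_const open_UNIV
        smooth_on_bounded_linear[OF bounded_linear_fst] smooth_on_bounded_linear[OF bounded_linear_snd] smooth_on_ident)
  have e: "smooth_on UNIV (\<lambda>x :: real \<times> real. mexp (snd x *\<^sub>R (A + fst x *\<^sub>R B)))" for A B :: "real^'n^'n"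
    by (rule smooth_on_compose[OF smooth_mexp m]) simp
  \<comment> \<open>The generator is affine in \<open>s\<close>; the sign of the inverse factor is
    moved into the coefficients so that \<open>e\<close> covers both exponentials.\<close>
  have "smooth_on UNIV (\<lambda>x :: real \<times> real.
      mexp (snd x *\<^sub>R (comm D1 P + fst x *\<^sub>R comm D2 P)) **
      (P ** mexp (snd x *\<^sub>R (- comm D1 P + fst x *\<^sub>R (- comm D2 P)))))"
    by (intro smooth_on_bilinear[OF bounded_bilinear_matrix_mult] e smooth_on_const open_UNIV)
  then show ?thesis
    by (rule smooth_on_cong)
      (simp add: geo_def case_prod_unfold comm_def mat_simps scaleR_right_diff_distrib scaleR_right_distrib algebra_simps)
qed

lemma geodesic_variation_geo:
  assumes P: "P \<in> Gr p" and D: "D1 \<in> TGr P" "D2 \<in> TGr P"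
  shows "geodesic_variation p (geo P D1) (\<lambda>s. geo P (D1 + s *\<^sub>R D2))"
  using smooth_geo_variation geodesic_geo[OF P TGr_lincomb[OF D, of 1]]
  by (simp add: geodesic_variation_def)

lemma tproj_eq_comm: "P \<in> Gr p \<Longrightarrow> tproj P X = comm (comm X P) P"
  unfolding tproj_def comm_def by (simp add: mat_simps GrD)

text \<open>Bracketing with the off-diagonal \<open>comm D P\<close> exchanges block diagonal and
  off-diagonal parts.\<close>

lemma tproj_comm_normal:
  assumes "P \<in> Gr p" "D \<in> TGr P"
  shows "tproj P (comm (X - tproj P X) (comm D P)) = comm (X - tproj P X) (comm D P)"
    and "tproj P (comm (tproj P X) (comm D P)) = 0"
    and "comm (comm (tproj P X) (comm D P)) P = 0"
  unfolding tproj_def comm_def by (simp_all add: mat_simps GrD[OF assms(1)] TGrD[OF assms(2)])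

text \<open>With \<open>R = 2 P - 1\<close>, tangent matrices \<open>x\<close> anticommute with
  \<open>R\<close>, and \<open>comm x P = x ** R\<close>. Since \<open>R ** R = 1\<close>, the
  bracket of \<open>comm j P\<close> with \<open>comm D P\<close> is \<open>- comm j D\<close>; the
  remaining brackets follow the same rule.\<close>

lemma curvature_operator_frame:
  assumes "P \<in> Gr p" "D \<in> TGr P" "j \<in> TGr P"
  shows "comm (comm (comm (comm j P) (comm D P)) (comm D P)) P = - comm (comm j D) D"
  unfolding comm_def
  by (simp add: mat_simps GrD[OF assms(1)] TGrD[OF assms(2)] TGrD[OF assms(3)])

text \<open>In \<open>t\<close> the variation solves \<open>F' = comm (A + s B) F\<close> with
  \<open>A = comm D1 P\<close> and \<open>B = comm D2 P\<close>. Differentiation in \<open>s\<close>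
  gives a first order equation for \<open>J\<close> with source \<open>comm B c\<close>; in the
  parallel frame it reads \<open>j' = comm b P\<close>, where \<open>b\<close> is \<open>B\<close>
  transported back.\<close>

lemma geo_variation_jacobi:
  fixes P D1 D2 :: "real^'n^'n"
  assumes P: "P \<in> Gr p" and D1: "D1 \<in> TGr P" and D2: "D2 \<in> TGr P"
    and J: "\<And>t. ((\<lambda>s. geo P (D1 + s *\<^sub>R D2) t) has_vector_derivative J t) (at 0)"
  shows "jacobi_field p (geo P D1) J" "J 0 = 0" "cov_deriv p (geo P D1) J 0 = D2"
proof -
  let ?A = "comm D1 P" and ?B = "comm D2 P" and ?c = "geo P D1"
  define F where "F = (\<lambda>(s, t). geo P (D1 + s *\<^sub>R D2) t)"
  have sF: "smooth_on UNIV F" unfolding F_def by (rule smooth_geo_variation)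
  note dF = smooth_on_has_derivative[OF sF UNIV_I]
  have dF2: "((\<lambda>x. frechet_derivative F (at x) v) has_derivative
      frechet_derivative (\<lambda>x. frechet_derivative F (at x) v) (at y)) (at y)" for v y
    by (rule smooth_on_has_derivative[OF smooth_on_frechet[OF sF] UNIV_I])
  \<comment> \<open>Partial derivatives are expressed by the total derivative in the directions
    \<open>(1, 0)\<close> and \<open>(0, 1)\<close>, to which symmetry of second derivatives
    applies.\<close>
  have horizontal: "((\<lambda>s. G (s, t)) has_vector_derivative G' (1, 0)) (at a)"
    if "(G has_derivative G') (at (a, t))" for G :: "real \<times> real \<Rightarrow> real^'n^'n" and G' a t
  proof -
    have "((\<lambda>s. (s, t)) has_derivative (\<lambda>u. (u, 0))) (at a)"
      by (auto intro!: derivative_eq_intros)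
    from has_derivative_compose[OF this that]
    have "((\<lambda>s. G (s, t)) has_derivative (\<lambda>u. G' (u *\<^sub>R (1, 0)))) (at a)" by simp
    then show ?thesis
      using linear_scale[OF has_derivative_linear[OF that]]
      by (simp only: has_vector_derivative_def)
  qed
  have vertical: "((\<lambda>t. G (a, t)) has_vector_derivative G' (0, 1)) (at t)"
    if "(G has_derivative G') (at (a, t))" for G :: "real \<times> real \<Rightarrow> real^'n^'n" and G' a t
  proof -
    have "((\<lambda>t. (a, t)) has_derivative (\<lambda>u. (0, u))) (at t)"
      by (auto intro!: derivative_eq_intros)
    from has_derivative_compose[OF this that]
    have "((\<lambda>t. G (a, t)) has_derivative (\<lambda>u. G' (u *\<^sub>R (0, 1)))) (at t)" by simp
    then show ?thesis
      using linear_scale[OF has_derivative_linear[OF that]]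
      by (simp only: has_vector_derivative_def)
  qed
  have JF: "J t = frechet_derivative F (at (0, t)) (1, 0)" for t
    using vector_derivative_unique_at[OF J] horizontal[where a = 0 and t = t, OF dF] by (simp add: F_def)
  have sJ: "smooth_on UNIV J"
  proof -
    have "smooth_on UNIV (\<lambda>t :: real. (0 :: real, t))"
      by (rule smooth_on_bounded_linear[OF _ smooth_on_ident[OF open_UNIV]])
        (simp add: bounded_linear_Pair bounded_linear_zero bounded_linear_ident)
    from smooth_on_compose[OF smooth_on_frechet[OF sF, of "(1, 0)"] this] show ?thesis
      by (simp add: JF[abs_def])
  qed
  have velF: "frechet_derivative F (at (s, t)) (0, 1) = comm (?A + s *\<^sub>R ?B) (F (s, t))" for s t
  proof -
    have "((\<lambda>t. F (s, t)) has_vector_derivative comm (comm (D1 + s *\<^sub>R D2) P) (F (s, t))) (at t)"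
      using has_vector_derivative_geo_comm by (simp add: F_def)
    moreover have "comm (D1 + s *\<^sub>R D2) P = ?A + s *\<^sub>R ?B"
      by (simp add: comm_def mat_simps algebra_simps)
    ultimately show ?thesis
      using vertical[where a = s and t = t, OF dF] vector_derivative_unique_at by metis
  qed
  have dJ: "(J has_vector_derivative comm ?A (J t) + comm ?B (?c t)) (at t)" for t
  proof -
    have "(J has_vector_derivative frechet_derivative (\<lambda>x. frechet_derivative F (at x) (1, 0)) (at (0, t)) (0, 1)) (at t)"
      using vertical[where a = 0 and t = t, OF dF2[where v = "(1, 0)"]] by (simp add: JF[abs_def])
    \<comment> \<open>The mixed derivative in the other order comes from the equation in
      \<open>t\<close>, which holds for every \<open>s\<close>.\<close>
    moreover have "frechet_derivative (\<lambda>x. frechet_derivative F (at x) (0, 1)) (at (0, t)) (1, 0) =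
        comm ?A (J t) + comm ?B (?c t)"
    proof -
      have "((\<lambda>s. comm (?A + s *\<^sub>R ?B) (F (s, t))) has_vector_derivative comm ?A (J t) + comm ?B (F (0, t))) (at 0)"
      proof -
        have l: "((\<lambda>s. ?A + s *\<^sub>R ?B) has_vector_derivative ?B) (at 0)"
          by (auto intro!: derivative_eq_intros simp: has_vector_derivative_def)
        have r: "((\<lambda>s. F (s, t)) has_vector_derivative J t) (at 0)"
          using J by (simp add: F_def)
        show ?thesis
          unfolding comm_def[of "_ + _"]
          by (rule has_vector_derivative_eq_rhs[OF has_vector_derivative_diff[OF
                has_vector_derivative_matmul[OF l r] has_vector_derivative_matmul[OF r l]]])
            (simp add: comm_def)
      qed
      moreover have "((\<lambda>s. comm (?A + s *\<^sub>R ?B) (F (s, t))) has_vector_derivative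
          frechet_derivative (\<lambda>x. frechet_derivative F (at x) (0, 1)) (at (0, t)) (1, 0)) (at 0)"
        using horizontal[where a = 0 and t = t, OF dF2[where v = "(0, 1)"]] by (simp only: velF)
      ultimately show ?thesis
        using vector_derivative_unique_at by (fastforce simp: F_def)
    qed
    ultimately show ?thesis
      using second_derivative_symmetric[OF sF UNIV_I, of "(1, 0)" "(0, t)" "(0, 1)"] by simp
  qed
  have "((\<lambda>s. P) has_vector_derivative J 0) (at 0)"
    using J[of 0] by (simp add: geo_0)
  then show J0: "J 0 = 0"
    using vector_derivative_unique_at has_vector_derivative_const by blast
  have fJ: "field_along ?c J"
  proof -
    have "geo P (D1 + s *\<^sub>R D2) t \<in> Gr p" for s t
      by (intro geo_in_Gr P TGr_subspace D1 D2)
    from curve_tangent[OF this J] have "J t \<in> TGr (?c t)" for t by simp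
    then show ?thesis by (simp add: field_along_def sJ)
  qed
  define j where "j t = conj_exp (- ?A) t (J t)" for t
  define b where "b t = conj_exp (- ?A) t ?B" for t
  note jf = field_along_geo_frame[OF P D1 fJ, folded j_def]
  have sj: "smooth_on UNIV j" using jf(2) by (simp add: j_def[abs_def])
  have Jj: "J = (\<lambda>t. conj_exp ?A t (j t))" using jf(3) by auto
  have j': "(j has_vector_derivative comm (b t) P) (at t)" for t
    unfolding j_def[abs_def]
    by (rule has_vector_derivative_eq_rhs[OF has_vector_derivative_conj_exp[OF dJ]])
      (simp add: b_def conj_exp_comm conj_exp_linear geo_conj_exp conj_exp_inverse comm_def[of "- comm D1 P"] comm_def[of "comm D1 P"]
        mat_simps)
  have b': "(b has_vector_derivative comm (b t) ?A) (at t)" for t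
    unfolding b_def[abs_def]
    by (rule has_vector_derivative_eq_rhs[OF has_vector_derivative_conj_exp[OF has_vector_derivative_const]])
      (use conj_exp_self[of "- ?A" t] in \<open>simp add: conj_exp_comm, simp add: comm_def mat_simps conj_exp_linear\<close>)
  have comm_r: "((\<lambda>t. comm (f t) X) has_vector_derivative comm f' X) (at t)"
    if "(f has_vector_derivative f') (at t)" for f f' X t
    unfolding comm_def
    by (intro has_vector_derivative_diff bounded_linear.has_vector_derivative[OF matmul.bounded_linear_left that]
        bounded_linear.has_vector_derivative[OF matmul.bounded_linear_right that])
  have j'': "((\<lambda>t. comm (b t) P) has_vector_derivative comm (comm (b t) ?A) P) (at t)" for t
    by (rule comm_r[OF b'])
  have comm_diff: "comm (X - Z) W = comm X W - comm Z W" for X Z W :: "real^'n^'n"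
    by (simp add: comm_def mat_simps)
  txt \<open>The parallel-transported equation is \<open>j'' = [[b, A], P]\<close>; only the part of \<open>b\<close> commuting with
    \<open>P\<close> contributes, and that part is expressed by \<open>j\<close>.\<close>
  have normal: "b t - tproj P (b t) = comm (comm (j t) P) ?A" for t
  proof -
    let ?h = "\<lambda>t. b t - tproj P (b t) - comm (comm (j t) P) ?A"
    have "(?h has_vector_derivative comm (b t) ?A - tproj P (comm (b t) ?A) - comm (comm (comm (b t) P) P) ?A) (at t)" for t
      by (intro has_vector_derivative_diff b' comm_r j' bounded_linear.has_vector_derivative[OF bounded_linear_tproj])
    \<comment> \<open>By the grading, the normal part of \<open>b\<close> and the double bracket of
      \<open>j\<close> have the same derivative, the bracket of \<open>tproj P (b t)\<close> with
      \<open>A\<close>.\<close>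
    moreover have "comm (b t) ?A - tproj P (comm (b t) ?A) - comm (comm (comm (b t) P) P) ?A = 0" for t
    proof -
      have e: "comm (b t) ?A = comm (b t - tproj P (b t)) ?A + comm (tproj P (b t)) ?A"
        by (simp add: comm_diff)
      have "tproj P (comm (b t) ?A) = comm (b t - tproj P (b t)) ?A"
        unfolding e by (simp add: linear_add[OF linear_tproj] tproj_comm_normal[OF P D1])
      then show ?thesis by (simp add: comm_diff flip: tproj_eq_comm[OF P])
    qed
    ultimately have "(?h has_vector_derivative 0) (at t)" for t by (simp only:)
    from constant_of_derivative_zero[OF this, of t 0]
    have "?h t = ?h 0" .
    \<comment> \<open>At time \<open>0\<close> the matrix \<open>comm D2 P\<close> is its own
      projection, and \<open>j\<close> vanishes.\<close>
    also have "\<dots> = 0"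
      by (simp add: b_def j_def conj_exp_0 J0 tproj_eq_comm[OF P] comm_comm_tangent[OF P D2]) (simp add: comm_def mat_simps)
    finally show ?thesis by simp
  qed
  have "comm (comm (b t) ?A) P = - comm (comm (j t) D1) D1" for t
  proof -
    have "comm (comm (b t) ?A) P = comm (comm (b t - tproj P (b t)) ?A) P + comm (comm (tproj P (b t)) ?A) P"
      by (simp add: comm_diff)
    also have "\<dots> = comm (comm (comm (comm (j t) P) ?A) ?A) P"
      by (simp add: tproj_comm_normal[OF P D1] normal)
    finally show ?thesis by (simp add: curvature_operator_frame[OF P D1 jf(1)])
  qed
  then show "jacobi_field p ?c J"
    using jacobi_conj_exp(1)[OF P D1 jf(1) sj j' j'', folded Jj] by simp
  show "cov_deriv p ?c J 0 = D2"
    using jacobi_conj_exp(2)[OF P D1 jf(1) sj j' j'', folded Jj, of 0]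
    by (simp add: conj_exp_0 b_def comm_comm_tangent[OF P D2])
qed

section \<open>Geodesics and Jacobi fields through the singular value decomposition\<close>

definition diag_mat :: "('p \<Rightarrow> real) \<Rightarrow> real^'p^'p" where
  "diag_mat v = (\<chi> i j. if i = j then v i else 0)"

lemma diag_mat_mult: "diag_mat v ** diag_mat w = diag_mat (\<lambda>i. v i * w i)"
proof -
  have "(\<Sum>k\<in>UNIV. (if i = k then v i else 0) * (if k = j then w k else 0)) =
      (\<Sum>k\<in>UNIV. if k = i then (if i = j then v i * w i else 0) else 0)" for i j :: 'a
    by (rule sum.cong) auto
  then show ?thesis by (simp add: diag_mat_def matrix_matrix_mult_def vec_eq_iff)
qed

lemma diag_mat_add: "diag_mat v + diag_mat w = diag_mat (\<lambda>i. v i + w i)"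
  by (simp add: diag_mat_def vec_eq_iff)

lemma transpose_diag_mat: "transpose (diag_mat v) = diag_mat v"
  by (simp add: diag_mat_def transpose_def vec_eq_iff)

lemma diag_mat_1: "diag_mat (\<lambda>_. 1) = mat 1"
  by (simp add: diag_mat_def mat_def)

lemma diag_mat_0: "diag_mat (\<lambda>_. 0) = 0"
  by (simp add: diag_mat_def vec_eq_iff)

lemma diag_mat_uminus: "- diag_mat v = diag_mat (\<lambda>i. - v i)"
  by (simp add: diag_mat_def vec_eq_iff)

lemma diag_mat_scaleR: "a *\<^sub>R diag_mat v = diag_mat (\<lambda>i. a * v i)"
  by (simp add: diag_mat_def vec_eq_iff)

lemma diag_fun_diag_mat: "diag_fun f (t *\<^sub>R S) = diag_mat (\<lambda>i. f (t * S $ i $ i))"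
  by (simp add: diag_fun_def diag_mat_def vec_eq_iff)

lemma diag_mat_diag: "(\<And>i j. i \<noteq> j \<Longrightarrow> S $ i $ j = 0) \<Longrightarrow> S = diag_mat (\<lambda>i. S $ i $ i)"
  by (simp add: diag_mat_def vec_eq_iff)

text \<open>Expresses a diagonal matrix by constant matrices, so that it can be differentiated entry
  by entry.\<close>

lemma diag_mat_basis: "diag_mat v = (\<Sum>i\<in>UNIV. v i *\<^sub>R diag_mat (\<lambda>j. if i = j then 1 else 0))"
proof -
  have "(\<Sum>i\<in>UNIV. v i * (if a = b then if i = a then 1 else 0 else 0)) =
      (\<Sum>i\<in>UNIV. if i = a then (if a = b then v i else 0) else 0)" for a b :: 'a
    by (rule sum.cong) auto
  then show ?thesis by (simp add: diag_mat_def vec_eq_iff)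
qed

lemma has_vector_derivative_diag_mat:
  assumes "\<And>i. ((\<lambda>t. v t i) has_vector_derivative v' i) (at t)"
  shows "((\<lambda>t. diag_mat (v t)) has_vector_derivative diag_mat v') (at t)"
  unfolding diag_mat_basis[of "v _"] diag_mat_basis[of v']
  by (intro has_vector_derivative_sum bounded_linear.has_vector_derivative[OF bounded_linear_scaleR_left] assms)

lemma has_vector_derivative_eventually:
  assumes "(f has_vector_derivative d) (at x)" "\<forall>\<^sub>F y in nhds x. f y = g y"
  shows "(g has_vector_derivative d) (at x)"
proof -
  have "\<forall>\<^sub>F y in at x. f y = g y" using assms(2) unfolding eventually_at_filter by (rule eventually_mono) simp
  moreover have "f x = g x" using eventually_nhds_x_imp_x[OF assms(2)] .
  ultimately show ?thesis
    using has_derivative_transform_eventually[OF assms(1)[unfolded has_vector_derivative_def]]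
    unfolding has_vector_derivative_def by blast
qed

section \<open>Orthonormal frames of geodesics\<close>

text \<open>The projection factors through \<open>CARD('p)\<close> dimensions, which bounds its rank
  above, and the identity of that size factors through the projection, which bounds it
  below.\<close>

lemma stiefel_Gr:
  fixes U :: "real^'p^'n"
  assumes U: "U \<in> St"
  shows "U ** transpose U \<in> Gr CARD('p)"
proof -
  have UU: "transpose U ** U = mat 1" using U by (simp add: St_def)
  have UUX: "transpose U ** (U ** X) = X" for X
    by (simp add: matrix_mul_assoc UU)
  have "rank (U ** transpose U) \<le> CARD('p)"
    using rank_mul_le_left[of U "transpose U"] rank_bound[of U] by simp
  moreover have "CARD('p) \<le> rank (U ** transpose U)"
  proof -
    have "mat 1 = transpose U ** ((U ** transpose U) ** U)"
      by (simp add: mat_simps UUX UU)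
    then have "rank (mat 1 :: real^'p^'p) \<le> rank (U ** transpose U)"
      by (metis order_trans rank_mul_le_left rank_mul_le_right)
    then show ?thesis by (simp add: rank_I)
  qed
  ultimately show ?thesis
    by (simp add: Gr_def transpose_simps mat_simps UUX)
qed

text \<open>The frame \<open>Y\<close> solves \<open>Y' = comm D P ** Y\<close>. Invertibility of \<open>S\<close> enters through
  \<open>transpose U ** Q = 0\<close>.\<close>

lemma svd_geodesic:
  fixes U Q :: "real^'p^'n" and D :: "real^'n^'n" and S V :: "real^'p^'p"
  assumes U: "U \<in> St" and P: "P = U ** transpose U" and D: "D \<in> TGr P"
    and svd: "compact_svd (hor_lift U D) Q S V" and nz: "\<And>i. S $ i $ i \<noteq> 0"
  defines "Y \<equiv> \<lambda>t. U ** V ** diag_fun cos (t *\<^sub>R S) + Q ** diag_fun sin (t *\<^sub>R S)"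
  shows "Y t \<in> St" and "geo P D t = Y t ** transpose (Y t)"
proof -
  define \<sigma> where "\<sigma> i = S $ i $ i" for i
  have S: "S = diag_mat \<sigma>" and nz': "\<sigma> i \<noteq> 0" for i
    using svd nz unfolding compact_svd_def \<sigma>_def by (auto intro!: diag_mat_diag)
  have Y: "Y t = U ** (V ** diag_mat (\<lambda>i. cos (t * \<sigma> i))) + Q ** diag_mat (\<lambda>i. sin (t * \<sigma> i))" for t
    unfolding Y_def diag_fun_diag_mat \<sigma>_def by (simp add: mat_simps)
  have UU: "transpose U ** U = mat 1" using U by (simp add: St_def)
  have UUX: "transpose U ** (U ** X) = X" for X :: "real^'b::finite^'p" by (simp add: matrix_mul_assoc UU)
  have QQ: "transpose Q ** Q = mat 1" using svd by (simp add: compact_svd_def St_def)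
  have QQX: "transpose Q ** (Q ** X) = X" for X :: "real^'b::finite^'p" by (simp add: matrix_mul_assoc QQ)
  have VV: "transpose V ** V = mat 1" "V ** transpose V = mat 1"
    using svd by (auto simp: compact_svd_def orthogonal_matrix_def)
  have VVX: "transpose V ** (V ** X) = X" for X :: "real^'b::finite^'p" by (simp add: matrix_mul_assoc VV)
  have DU: "D ** U = Q ** (diag_mat \<sigma> ** transpose V)"
    using svd S by (simp add: compact_svd_def hor_lift_def mat_simps)
  have PGr: "P \<in> Gr CARD('p)" unfolding P by (rule stiefel_Gr[OF U])
  have Dsym: "transpose D = D" by (rule TGrD(1)[OF D])
  \<comment> \<open>Sandwiching the tangency equation between \<open>transpose U\<close> and
    \<open>U\<close> gives \<open>X + X = X\<close>.\<close>
  have hor: "transpose U ** (D ** U) = 0"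
  proof -
    have "transpose U ** ((D ** P + P ** D) ** U) = transpose U ** (D ** U)"
      using D by (simp add: TGr_def)
    then have "transpose U ** (D ** U) + transpose U ** (D ** U) = transpose U ** (D ** U)"
      by (simp only: P mat_simps UU UUX matrix_mul_rid)
    then show ?thesis by (metis add_left_imp_eq add_0_right)
  qed
  have UQ: "transpose U ** Q = 0"
  proof -
    \<comment> \<open>Solves the decomposition for \<open>Q\<close>, multiplying
      \<open>D ** U\<close> on the right by \<open>V\<close> and the inverse of
      \<open>S\<close>.\<close>
    have "transpose U ** Q = (transpose U ** (D ** U)) ** (V ** diag_mat (\<lambda>i. 1 / \<sigma> i))"
      unfolding DU by (simp add: mat_simps VVX diag_mat_mult nz' diag_mat_1)
    then show ?thesis by (simp add: hor matmul.zero_left)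
  qed
  have UQX: "transpose U ** (Q ** X) = 0" for X :: "real^'b::finite^'p"
    by (simp add: matrix_mul_assoc UQ matmul.zero_left)
  have QU: "transpose Q ** U = 0"
    using arg_cong[OF UQ, of transpose] by (simp add: transpose_simps)
  have QUX: "transpose Q ** (U ** X) = 0" for X :: "real^'b::finite^'p"
    by (simp add: matrix_mul_assoc QU matmul.zero_left)
  show "Y t \<in> St"
    unfolding St_def Y
    by (simp add: mat_simps transpose_simps transpose_diag_mat UUX QQX VVX UQX QUX diag_mat_mult diag_mat_add diag_mat_1
        flip: power2_eq_square)
  let ?A = "comm D P"
  have UtD: "transpose U ** D = V ** (diag_mat \<sigma> ** transpose Q)"
    using arg_cong[OF DU, of transpose] by (simp add: transpose_simps transpose_diag_mat Dsym mat_simps)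
  have UtDX: "transpose U ** (D ** X) = V ** (diag_mat \<sigma> ** (transpose Q ** X))" for X :: "real^'b::finite^'n"
    using UtD by (simp add: matrix_mul_assoc)
  have DUX: "D ** (U ** X) = Q ** (diag_mat \<sigma> ** (transpose V ** X))" for X :: "real^'b::finite^'p"
    using DU by (simp add: matrix_mul_assoc)
  \<comment> \<open>The generator is an infinitesimal rotation: it sends \<open>U ** V\<close> to
    \<open>Q ** S\<close> and \<open>Q\<close> to \<open>- (U ** V ** S)\<close>, whence the cosine
    and sine.\<close>
  have AY: "?A ** Y t = Q ** diag_mat (\<lambda>i. \<sigma> i * cos (t * \<sigma> i)) - U ** (V ** diag_mat (\<lambda>i. \<sigma> i * sin (t * \<sigma> i)))" for t
    unfolding comm_def P Y
    by (simp add: mat_simps UUX QQX VVX UQX QUX UtDX DUX diag_mat_mult)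
  have dcos: "((\<lambda>t. diag_mat (\<lambda>i. cos (t * \<sigma> i))) has_vector_derivative diag_mat (\<lambda>i. - (\<sigma> i * sin (t * \<sigma> i)))) (at t)"
    and dsin: "((\<lambda>t. diag_mat (\<lambda>i. sin (t * \<sigma> i))) has_vector_derivative diag_mat (\<lambda>i. \<sigma> i * cos (t * \<sigma> i))) (at t)" for t
    by (rule has_vector_derivative_diag_mat;
        auto intro!: derivative_eq_intros simp flip: has_real_derivative_iff_has_vector_derivative)+
  have dY: "(Y has_vector_derivative ?A ** Y t) (at t)" for t
    unfolding AY unfolding Y[abs_def]
    by (rule has_vector_derivative_eq_rhs[OF has_vector_derivative_add[OF
          bounded_linear.has_vector_derivative[OF matmul.bounded_linear_right
            bounded_linear.has_vector_derivative[OF matmul.bounded_linear_right dcos]]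
          bounded_linear.has_vector_derivative[OF matmul.bounded_linear_right dsin]]])
      (simp add: mat_simps flip: diag_mat_uminus)
  have "((\<lambda>t. Y t ** transpose (Y t)) has_vector_derivative comm ?A (Y t ** transpose (Y t))) (at t)" for t
    by (rule has_vector_derivative_eq_rhs[OF has_vector_derivative_matmul[OF dY
          bounded_linear.has_vector_derivative[OF bounded_linear_transpose dY]]])
      (simp add: comm_def[of ?A] transpose_simps transpose_comm[OF PGr D] mat_simps)
  then have "Y t ** transpose (Y t) = conj_exp ?A t (Y 0 ** transpose (Y 0))"
    by (rule commutator_flow_unique)
  also have "Y 0 ** transpose (Y 0) = P"
  proof -
    have "V ** (transpose V ** X) = X" for X :: "real^'n^'p" by (simp add: matrix_mul_assoc VV)
    then show ?thesis by (simp add: Y diag_mat_1 diag_mat_0 mat_simps transpose_simps P)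
  qed
  finally show "geo P D t = Y t ** transpose (Y t)" by (simp add: geo_conj_exp)
qed

theorem proposition7p1:
  fixes U :: "real^'p^'n"
    and P \<Delta>1 \<Delta>2 :: "real^'n^'n"
    and Q :: "real \<Rightarrow> real^'p^'n"
    and \<Sigma> V :: "real \<Rightarrow> real^'p^'p"
  assumes "CARD('p) \<le> CARD('n)"
    and "U \<in> St"
    and "P = U ** transpose U"
    and "\<Delta>1 \<in> TGr P" and "\<Delta>2 \<in> TGr P"
    and svd: "\<forall>\<^sub>F s in nhds 0.
          compact_svd (hor_lift U (\<Delta>1 + s *\<^sub>R \<Delta>2)) (Q s) (\<Sigma> s) (V s) \<and>
          Q differentiable (at s) \<and> \<Sigma> differentiable (at s) \<and> V differentiable (at s)"
    and distinct_singular_values: "inj (\<lambda>i. \<Sigma> 0 $ i $ i)"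
    and nonzero_singular_values: "\<forall>i. \<Sigma> 0 $ i $ i \<noteq> 0"
  defines "dQ \<equiv> vector_derivative Q (at 0)"
    and "d\<Sigma> \<equiv> vector_derivative \<Sigma> (at 0)"
    and "dV \<equiv> vector_derivative V (at 0)"
  defines "\<gamma> \<equiv> \<lambda>t. Exp_Gr CARD('p) P (t *\<^sub>R \<Delta>1)"
    and "\<Xi> \<equiv> \<lambda>s t. Exp_Gr CARD('p) P (t *\<^sub>R (\<Delta>1 + s *\<^sub>R \<Delta>2))"
  defines "Y \<equiv> \<lambda>t. U ** V 0 ** diag_fun cos (t *\<^sub>R \<Sigma> 0) + Q 0 ** diag_fun sin (t *\<^sub>R \<Sigma> 0)"
    and "\<Gamma> \<equiv> \<lambda>t. U ** dV ** diag_fun cos (t *\<^sub>R \<Sigma> 0)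
                 - t *\<^sub>R (U ** V 0 ** diag_fun sin (t *\<^sub>R \<Sigma> 0) ** d\<Sigma>)
                 + dQ ** diag_fun sin (t *\<^sub>R \<Sigma> 0)
                 + t *\<^sub>R (Q 0 ** diag_fun cos (t *\<^sub>R \<Sigma> 0) ** d\<Sigma>)"
  defines "J \<equiv> \<lambda>t. \<Gamma> t ** transpose (Y t) + Y t ** transpose (\<Gamma> t)"
  shows "(geodesic CARD('p) \<gamma>) \<and>
         (\<forall>t. Y t \<in> St \<and> \<gamma> t = Y t ** transpose (Y t) \<and> \<Gamma> t \<in> TSt (Y t) \<and> J t \<in> TGr (\<gamma> t)) \<and>
         (\<forall>K. jacobi_field CARD('p) \<gamma> K \<and> K 0 = 0 \<and> cov_deriv CARD('p) \<gamma> K 0 = \<Delta>2 \<longleftrightarrow> K = J) \<and>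
         (\<forall>t. hor_lift (Y t) (J t) = \<Gamma> t + Y t ** transpose (\<Gamma> t) ** Y t \<and>
             \<Gamma> t + Y t ** transpose (\<Gamma> t) ** Y t = (mat 1 - Y t ** transpose (Y t)) ** \<Gamma> t) \<and>
         (geodesic_variation CARD('p) \<gamma> \<Xi>) \<and>
         (\<forall>t. ((\<lambda>s. \<Xi> s t) has_vector_derivative J t) (at 0))"
proof -
  note U = assms(2) and P = assms(3) and D1 = assms(4) and D2 = assms(5)
  have PGr: "P \<in> Gr CARD('p)" unfolding P by (rule stiefel_Gr[OF U])
  have D12: "\<Delta>1 + s *\<^sub>R \<Delta>2 \<in> TGr P" for s by (intro TGr_subspace D1 D2)
  have \<gamma>: "\<gamma> = geo P \<Delta>1" unfolding \<gamma>_def by (rule ext) (rule Exp_Gr_scaleR[OF PGr D1])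
  have \<Xi>: "\<Xi> = (\<lambda>s. geo P (\<Delta>1 + s *\<^sub>R \<Delta>2))"
    unfolding \<Xi>_def by (intro ext) (rule Exp_Gr_scaleR[OF PGr D12])
  \<comment> \<open>The frame for every \<open>s\<close>: \<open>Y\<close> is its value and
    \<open>\<Gamma>\<close> its derivative at \<open>s = 0\<close>.\<close>
  define Ys where "Ys s t = U ** V s ** diag_fun cos (t *\<^sub>R \<Sigma> s) + Q s ** diag_fun sin (t *\<^sub>R \<Sigma> s)" for s t
  have Y: "Y t = Ys 0 t" for t by (simp add: Y_def Ys_def)
  have dif: "Q differentiable (at 0)" "\<Sigma> differentiable (at 0)" "V differentiable (at 0)"
    using eventually_nhds_x_imp_x[OF svd] by auto
  have dQ: "(Q has_vector_derivative dQ) (at 0)" and d\<Sigma>: "(\<Sigma> has_vector_derivative d\<Sigma>) (at 0)"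
    and dV: "(V has_vector_derivative dV) (at 0)"
    using dif unfolding dQ_def d\<Sigma>_def dV_def by (simp_all add: vector_derivative_works)
  have entry: "((\<lambda>s. \<Sigma> s $ i $ j) has_vector_derivative d\<Sigma> $ i $ j) (at 0)" for i j
    by (intro bounded_linear.has_vector_derivative[OF bounded_linear_vec_nth] d\<Sigma>)
  \<comment> \<open>Being nonzero is an open condition, so \<open>svd_geodesic\<close> applies to
    all \<open>s\<close> near \<open>0\<close>.\<close>
  have nz: "\<forall>\<^sub>F s in nhds 0. \<forall>i. \<Sigma> s $ i $ i \<noteq> 0"
  proof -
    have "\<forall>\<^sub>F s in nhds 0. \<Sigma> s $ i $ i \<noteq> 0" for i
    proof -
      have "((\<lambda>s. \<Sigma> s $ i $ i) \<longlongrightarrow> \<Sigma> 0 $ i $ i) (nhds 0)"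
        using has_vector_derivative_continuous[OF entry] by (simp add: isCont_def tendsto_nhds_iff)
      then show ?thesis
        using nonzero_singular_values by (auto dest: tendsto_imp_eventually_ne)
    qed
    then show ?thesis by (simp add: eventually_all_finite)
  qed
  have ev: "\<forall>\<^sub>F s in nhds 0. (\<forall>t. Ys s t \<in> St \<and> \<Xi> s t = Ys s t ** transpose (Ys s t)) \<and>
      (\<forall>i j. i \<noteq> j \<longrightarrow> \<Sigma> s $ i $ j = 0)"
    using svd nz
  proof eventually_elim
    case (elim s)
    then have "compact_svd (hor_lift U (\<Delta>1 + s *\<^sub>R \<Delta>2)) (Q s) (\<Sigma> s) (V s)" "\<And>i. \<Sigma> s $ i $ i \<noteq> 0" by auto
    from svd_geodesic[OF U P D12 this] this(1) show ?case
      by (auto simp: \<Xi> Ys_def compact_svd_def)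
  qed
  \<comment> \<open>Off-diagonal entries of \<open>\<Sigma> s\<close> vanish for all
    \<open>s\<close> near \<open>0\<close>, so the derivative is diagonal and the chain rule for
    cosine and sine becomes a matrix product with \<open>d\<Sigma>\<close>.\<close>
  have diag: "d\<Sigma> $ i $ j = 0" if "i \<noteq> j" for i j
  proof -
    have "((\<lambda>_. 0) has_vector_derivative d\<Sigma> $ i $ j) (at 0)"
      by (rule has_vector_derivative_eventually[OF entry]) (use ev that in \<open>auto elim: eventually_mono\<close>)
    then show ?thesis using vector_derivative_unique_at has_vector_derivative_const by blast
  qed
  define \<sigma> where "\<sigma> i = d\<Sigma> $ i $ i" for i
  have d\<Sigma>_diag_mat: "d\<Sigma> = diag_mat \<sigma>" unfolding \<sigma>_def[abs_def] by (rule diag_mat_diag) (rule diag)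
  have entry': "((\<lambda>s. \<Sigma> s $ i $ i) has_real_derivative \<sigma> i) (at 0)" for i
    using entry by (simp add: has_real_derivative_iff_has_vector_derivative \<sigma>_def)
  have dcos: "((\<lambda>s. diag_fun cos (t *\<^sub>R \<Sigma> s)) has_vector_derivative - (t *\<^sub>R (diag_fun sin (t *\<^sub>R \<Sigma> 0) ** d\<Sigma>))) (at 0)"
    and dsin: "((\<lambda>s. diag_fun sin (t *\<^sub>R \<Sigma> s)) has_vector_derivative t *\<^sub>R (diag_fun cos (t *\<^sub>R \<Sigma> 0) ** d\<Sigma>)) (at 0)" for t
    unfolding diag_fun_diag_mat d\<Sigma>_diag_mat diag_mat_mult diag_mat_scaleR diag_mat_uminus
    by (rule has_vector_derivative_diag_mat;
        auto intro!: derivative_eq_intros entry' simp flip: has_real_derivative_iff_has_vector_derivative)+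
  have dYs: "((\<lambda>s. Ys s t) has_vector_derivative \<Gamma> t) (at 0)" for t
    unfolding Ys_def
    by (rule has_vector_derivative_eq_rhs[OF has_vector_derivative_add[OF
          has_vector_derivative_matmul[OF bounded_linear.has_vector_derivative[OF matmul.bounded_linear_right dV] dcos]
          has_vector_derivative_matmul[OF dQ dsin]]])
      (simp add: \<Gamma>_def mat_simps)
  have dYst: "((\<lambda>s. transpose (Ys s t)) has_vector_derivative transpose (\<Gamma> t)) (at 0)" for t
    by (rule bounded_linear.has_vector_derivative[OF bounded_linear_transpose dYs])
  \<comment> \<open>The geodesics are known to be \<open>Ys s t ** transpose (Ys s t)\<close> near
    \<open>s = 0\<close>, which suffices for the derivative there.\<close>
  have d\<Xi>: "((\<lambda>s. \<Xi> s t) has_vector_derivative J t) (at 0)" for t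
  proof (rule has_vector_derivative_eventually)
    show "((\<lambda>s. Ys s t ** transpose (Ys s t)) has_vector_derivative J t) (at 0)"
      using has_vector_derivative_matmul[OF dYs dYst, of t t] by (simp add: J_def Y add.commute)
    show "\<forall>\<^sub>F s in nhds 0. Ys s t ** transpose (Ys s t) = \<Xi> s t"
      using ev by (auto elim: eventually_mono)
  qed
  have Y0: "Y t \<in> St" "\<gamma> t = Y t ** transpose (Y t)" for t
    using eventually_nhds_x_imp_x[OF ev] by (simp_all add: Y \<gamma> \<Xi>)
  have YY: "transpose (Y t) ** Y t = mat 1" for t using Y0(1) by (simp add: St_def)
  have YYX: "transpose (Y t) ** (Y t ** X) = X" for X :: "real^'b::finite^'p" and t
    by (simp add: matrix_mul_assoc YY)
  \<comment> \<open>Comes from differentiating the orthonormality of the columns of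
    \<open>Ys s t\<close> at \<open>s = 0\<close>.\<close>
  have tan: "transpose (Y t) ** \<Gamma> t = - (transpose (\<Gamma> t) ** Y t)" for t
  proof -
    have "((\<lambda>s. mat 1 :: real^'p^'p) has_vector_derivative transpose (Y t) ** \<Gamma> t + transpose (\<Gamma> t) ** Y t) (at 0)"
    proof (rule has_vector_derivative_eventually)
      show "((\<lambda>s. transpose (Ys s t) ** Ys s t) has_vector_derivative
          transpose (Y t) ** \<Gamma> t + transpose (\<Gamma> t) ** Y t) (at 0)"
        using has_vector_derivative_matmul[OF dYst dYs, of t t] by (simp add: Y)
      show "\<forall>\<^sub>F s in nhds 0. transpose (Ys s t) ** Ys s t = mat 1"
        using ev by (auto elim: eventually_mono simp: St_def)
    qed
    then have "transpose (Y t) ** \<Gamma> t + transpose (\<Gamma> t) ** Y t = 0"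
      using vector_derivative_unique_at has_vector_derivative_const by blast
    then show ?thesis by (simp add: eq_neg_iff_add_eq_0)
  qed
  note jac = geo_variation_jacobi[OF PGr D1 D2 d\<Xi>[unfolded \<Xi>], folded \<gamma>]
  have jacobi_iff: "jacobi_field CARD('p) \<gamma> K \<and> K 0 = 0 \<and> cov_deriv CARD('p) \<gamma> K 0 = \<Delta>2 \<longleftrightarrow> K = J" for K
    using jac jacobi_field_unique[OF PGr D1, folded \<gamma>, of K J] by auto
  have JT: "J t \<in> TGr (\<gamma> t)" for t
    using jac(1) by (simp add: jacobi_field_def field_along_def)
  have lift: "hor_lift (Y t) (J t) = \<Gamma> t + Y t ** transpose (\<Gamma> t) ** Y t" for t
    by (simp add: hor_lift_def J_def mat_simps YY)
  \<comment> \<open>Tangency to the Stiefel manifold trades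
    \<open>transpose (\<Gamma> t) ** Y t\<close> for
    \<open>- (transpose (Y t) ** \<Gamma> t)\<close>.\<close>
  have lift': "\<Gamma> t + Y t ** transpose (\<Gamma> t) ** Y t = (mat 1 - Y t ** transpose (Y t)) ** \<Gamma> t" for t
    by (simp add: mat_simps tan)
  show ?thesis
    using geodesic_geo[OF PGr D1] geodesic_variation_geo[OF PGr D1 D2] Y0 tan JT jacobi_iff lift lift' d\<Xi>
    by (simp add: \<gamma> \<Xi> TSt_def)
qed

end
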